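(* Let $n$ be a positive integer and $p$ a real number with $n>p>1$. Let $K:(0,\infty)\to(0,\infty)$ be a $C^1$ function such that $(K_1)$ the function $r\mapsto p+\frac{rK'(r)}{K(r)}$ is strictly positive and decreasing on $(0,\infty)$. Let $f:[0,\infty)\to\mathbb R$ satisfy: $(f_1)$ $f(0)=0$, and there exists $u_0>0$ such that $f(u)>0$ for $u>u_0$, and $f(u)\le 0$, $f(u)\not\equiv 0$, for $u\in(0,u_0)$; $(f_2)$ $f$ is continuous on $[0,\infty)$ and locally Lipschitz continuous on $[u_0,\infty)$; and, denoting by $D$ the set of points of $[u_0,\infty)$ at which $f'$ exists, $(f_3)$ $(p-1)f(u)\le f'(u)(u-u_0)$ for all $u\in D$; $(f_4)$ the function $u\mapsto \frac{uf'(u)}{f(u)}$ is decreasing on $D\setminus\{u_0\}$. Then the problem $$-(r^{n-1}\phi_p(u'))'=r^{n-1}K(r)f(u),\quad r>0,$$ $$u'(0)=0,\quad \lim_{r\to\infty}u(r)=0,\quad u(r)\ge 0\ \text{ for } r>0,$$ has at most one non-trivial solution (i.e. at most one solution $u\not\equiv 0$).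
   Context: $\phi_p(s):=|s|^{p-2}s$ for $s\neq 0$ and $\phi_p(0)=0$. A solution of the equation is a function $u\in C^1[0,\infty)$ such that $r^{n-1}\phi_p(u')\in C^1[0,\infty)$ and the equation holds. "Decreasing" means non-increasing (as opposed to "strictly decreasing"). *)

theory Defs
  imports "HOL-Analysis.Analysis"
begin

(* At s = 0 the factor s makes the value 0 for every p. *)
definition phi :: "real \<Rightarrow> real \<Rightarrow> real" where
  "phi p s = \<bar>s\<bar> powr (p - 2) * s"

(* The functions u live on [0,\<infinity>) but are modelled as total functions on the reals.
   Derivatives are taken within [0,\<infinity>), hence one-sided at 0, so that the (junk)
   values on the negative half-line play no role; for r > 0 this is the usual
   two-sided derivative.  The library's C1_differentiable_on demands two-sided
   derivatives and is therefore not suitable on [0,\<infinity>). *)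
definition half_deriv :: "(real \<Rightarrow> real) \<Rightarrow> real \<Rightarrow> real" where
  "half_deriv u r = vector_derivative u (at r within {0..})"

definition C1_half_line :: "(real \<Rightarrow> real) \<Rightarrow> bool" where
  "C1_half_line u \<longleftrightarrow> u differentiable_on {0..} \<and> continuous_on {0..} (half_deriv u)"

definition flux :: "nat \<Rightarrow> real \<Rightarrow> (real \<Rightarrow> real) \<Rightarrow> real \<Rightarrow> real" where
  "flux n p u r = r ^ (n - 1) * phi p (half_deriv u r)"

definition is_solution ::
  "nat \<Rightarrow> real \<Rightarrow> (real \<Rightarrow> real) \<Rightarrow> (real \<Rightarrow> real) \<Rightarrow> (real \<Rightarrow> real) \<Rightarrow> bool" where
  "is_solution n p K f u \<longleftrightarrow>
     C1_half_line u \<and> C1_half_line (flux n p u) \<and>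
     (\<forall>r>0. - half_deriv (flux n p u) r = r ^ (n - 1) * K r * f (u r)) \<and>
     half_deriv u 0 = 0 \<and>
     (u \<longlongrightarrow> 0) at_top \<and>
     (\<forall>r>0. u r \<ge> 0)"

definition nontrivial :: "(real \<Rightarrow> real) \<Rightarrow> bool" where
  "nontrivial u \<longleftrightarrow> (\<exists>r\<ge>0. u r \<noteq> 0)"

(* As u0 > 0, every point of this set is interior to the domain [0,\<infinity>) of f, so
   differentiability is two-sided, also at u0. *)
definition diff_points :: "(real \<Rightarrow> real) \<Rightarrow> real \<Rightarrow> real set" where
  "diff_points f u0 = {u. u \<ge> u0 \<and> f differentiable (at u)}"

end

theory Submission
  imports Defs
begin

text \<open>
  Use the level \<open>s = u(r)\<close> of a decreasing solution as the independent variable, and describe the solution by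
  \<open>\<rho>(s) = r\<close> and \<open>z(s) = -r u'(r)\<close>. In the scaling invariant quantities \<open>\<beta> = z / s\<close> and
  \<open>y = r\<^sup>p K(r) f(s) / s\<^sup>p\<^sup>-\<^sup>1\<close> the orbits obey a comparison principle: at equal \<open>\<beta>\<close>, an orbit with a larger level,
  a smaller radius and a larger \<open>y\<close> keeps these three properties as \<open>\<beta>\<close> increases, because \<open>u f'/f\<close> is decreasing in \<open>u\<close>
  and \<open>p + r K'/K\<close> is decreasing in \<open>r\<close>. Applied to two arcs of one orbit, the principle shows that \<open>\<beta>\<close> is monotone
  as long as \<open>u > u\<^sub>0\<close>, since \<open>\<beta> \<ge> (n - p) / (p - 1)\<close> at \<open>u\<^sub>0\<close>. Applied to two solutions with \<open>v(0) > u(0)\<close>, it gives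
  \<open>z\<^sub>v \<ge> z\<^sub>u\<close> at all levels above \<open>u\<^sub>0\<close>, and Picone's identity together with \<open>(p - 1) f \<le> f' (u - u\<^sub>0)\<close> gives
  \<open>\<rho>\<^sub>v \<le> \<rho>\<^sub>u\<close> at \<open>u\<^sub>0\<close>. Below \<open>u\<^sub>0\<close>, where \<open>f \<le> 0\<close>, these inequalities are preserved and \<open>z\<^sub>v - z\<^sub>u\<close> grows,
  so that \<open>z\<^sub>v\<close> stays away from zero and \<open>v\<close> would have to become negative. Hence \<open>u(0) = v(0)\<close>, and then \<open>u = v\<close>
  because in the variable \<open>s\<close> the system is Lipschitz in \<open>(\<rho>, z)\<close> even where \<open>f\<close> is merely continuous.
\<close>

section \<open>Monotonicity of Lipschitz functions via Vitali coverings\<close>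

text \<open>The hypotheses on \<open>f'\<close> speak only about the points where it exists, but the
  phase plane needs a slope of \<open>f\<close> at every level above \<open>u0\<close>. It is
  obtained from two facts: a Lipschitz function whose derivative is nonnegative wherever it exists
  is nondecreasing, so that a monotone elasticity on the differentiability set makes
  \<open>ln (f (exp x))\<close> concave; and a concave function has a right derivative everywhere.
  Hence the arguments that differentiate \<open>f\<close> use one-sided derivatives. The coordinate
  \<open>z / s\<close> is chosen because at a fixed value of it the speed \<open>zeta\<close>
  depends on the orbit only through the reaction term, while level and radius enter the growth of
  that term only through the two decreasing functions of the hypotheses. Two points lie outside the
  phase plane. That solutions decrease follows from a dissipated energy, whose limit at 0 needs care
  because \<open>K\<close> may be singular there. And the profile system degenerates at the top
  level, where \<open>z\<close> tends to 0, so solutions with equal \<open>u 0\<close> are first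
  identified near \<open>r = 0\<close> by a contraction estimate in the variable
  \<open>r\<close>.\<close>

lemma Vitali_real_intervals:
  fixes S U :: "real set" and P :: "real \<Rightarrow> real \<Rightarrow> bool"
  assumes U: "open U" "S \<subseteq> U"
    and fine: "\<And>x d. x \<in> S \<Longrightarrow> d > 0 \<Longrightarrow> \<exists>c e. c < e \<and> x \<in> {c..e} \<and> e - c < d \<and> P c e"
  obtains C where "countable C" "\<And>i. i \<in> C \<Longrightarrow> fst i < snd i \<and> P (fst i) (snd i) \<and> {fst i..snd i} \<subseteq> U"
    "disjoint_family_on (\<lambda>i. {fst i..snd i}) C" "negligible (S - (\<Union>i\<in>C. {fst i..snd i}))"
proof -
  let ?K = "{i :: real \<times> real. fst i < snd i \<and> P (fst i) (snd i) \<and> {fst i..snd i} \<subseteq> U}"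
  let ?a = "\<lambda>i :: real \<times> real. (fst i + snd i) / 2" and ?r = "\<lambda>i :: real \<times> real. (snd i - fst i) / 2"
  have cb: "cball (?a i) (?r i) = {fst i..snd i}" for i
    by (auto simp: cball_eq_atLeastAtMost field_simps)
  have ex: "\<exists>i. i \<in> ?K \<and> x \<in> cball (?a i) (?r i) \<and> ?r i < d" if xd: "x \<in> S" "0 < d" for x d
  proof -
    from U xd obtain e0 where e0: "e0 > 0" "ball x e0 \<subseteq> U"
      by (meson openE subsetD)
    obtain c e where ce: "c < e" "x \<in> {c..e}" "e - c < min d e0" "P c e"
      using fine[OF xd(1), of "min d e0"] xd(2) e0(1) by auto
    have "{c..e} \<subseteq> ball x e0" using ce by (auto simp: dist_real_def)
    then have "(c, e) \<in> ?K" using ce e0 by auto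
    then show ?thesis using ce unfolding cb by (intro exI[of _ "(c,e)"]) auto
  qed
  have pos: "0 < ?r i" if "i \<in> ?K" for i using that by simp
  obtain C where C: "countable C" "C \<subseteq> ?K"
     "pairwise (\<lambda>i j. disjnt (cball (?a i) (?r i)) (cball (?a j) (?r j))) C"
     "negligible (S - (\<Union>i \<in> C. cball (?a i) (?r i)))"
    using Vitali_covering_theorem_cballs[of ?K ?r S ?a, OF pos ex] by blast
  show thesis
  proof (rule that[of C])
    show "disjoint_family_on (\<lambda>i. {fst i..snd i}) C"
      using C(3) unfolding cb disjoint_family_on_def pairwise_def disjnt_def by blast
  qed (use C cb in auto)
qed

lemma emeasure_UN_mono_countable:
  assumes "countable C" "disjoint_family_on X C" "\<And>i. i \<in> C \<Longrightarrow> X i \<in> sets M" "sets N = sets M"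
    and le: "\<And>i. i \<in> C \<Longrightarrow> emeasure M (X i) \<le> c * emeasure N (X i)"
  shows "emeasure M (\<Union>i\<in>C. X i) \<le> c * emeasure N (\<Union>i\<in>C. X i)"
proof -
  have "emeasure M (\<Union>i\<in>C. X i) = (\<integral>\<^sup>+i. emeasure M (X i) \<partial>count_space C)"
    by (rule emeasure_UN_countable) (use assms in auto)
  also have "\<dots> \<le> (\<integral>\<^sup>+i. c * emeasure N (X i) \<partial>count_space C)"
    by (rule nn_integral_mono) (use le in auto)
  also have "\<dots> = c * (\<integral>\<^sup>+i. emeasure N (X i) \<partial>count_space C)"
    by (rule nn_integral_cmult) auto
  also have "(\<integral>\<^sup>+i. emeasure N (X i) \<partial>count_space C) = emeasure N (\<Union>i\<in>C. X i)"
    by (rule emeasure_UN_countable[symmetric]) (use assms in auto)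
  finally show ?thesis .
qed

lemma negligible_borel_cover:
  assumes "negligible (N :: real set)"
  obtains N' where "N' \<in> null_sets lborel" "N \<subseteq> N'"
  using assms unfolding negligible_iff_null_sets null_sets_completion_iff2 by blast

text \<open>\<open>S\<close> need not be measurable, hence the outer measure; a Borel null set
  swallows the part of \<open>S\<close> that a Vitali cover misses.\<close>

lemma outer_measure_le_Vitali:
  fixes S :: "real set"
  assumes "W \<in> sets borel" "negligible (S - W)"
  shows "outer_measure_of lborel S \<le> emeasure lborel W"
proof -
  obtain N where N: "N \<in> null_sets lborel" "S - W \<subseteq> N" using negligible_borel_cover[OF assms(2)] .
  have "outer_measure_of lborel S \<le> outer_measure_of lborel (W \<union> N)"
    by (rule outer_measure_of_mono) (use N in auto)
  also have "\<dots> = emeasure lborel (W \<union> N)"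
    using assms N by (intro outer_measure_of_eq) auto
  also have "\<dots> = emeasure lborel W"
    using N assms by (simp add: emeasure_Un_null_set)
  finally show ?thesis .
qed

text \<open>The classical Vitali argument for derivates. Intervals of slope at most \<open>p\<close>
  are chosen inside an open set barely larger than \<open>E\<close>, then intervals of slope at
  least \<open>q\<close> inside those. Comparing Lebesgue measure with the Stieltjes measure of
  \<open>F\<close> gives \<open>q * m \<le> p * (m + \<epsilon>)\<close> for the outer measure
  \<open>m\<close> of \<open>E\<close>.\<close>

lemma negligible_distinct_slopes:
  fixes F :: "real \<Rightarrow> real" and E :: "real set"
  assumes mono: "\<And>x y. x \<le> y \<Longrightarrow> F x \<le> F y" and cont: "continuous_on UNIV F"
    and pq: "0 \<le> p" "p < q" and E: "bounded E"
    and lo: "\<And>x d. x \<in> E \<Longrightarrow> d > 0 \<Longrightarrow> \<exists>c e. c < e \<and> x \<in> {c..e} \<and> e - c < d \<and> F e - F c \<le> p * (e - c)"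
    and hi: "\<And>x d. x \<in> E \<Longrightarrow> d > 0 \<Longrightarrow> \<exists>c e. c < e \<and> x \<in> {c..e} \<and> e - c < d \<and> F e - F c \<ge> q * (e - c)"
  shows "negligible E"
proof -
  let ?nu = "interval_measure F"
  have nu: "emeasure ?nu {c..e} = ennreal (F e - F c)" if "c \<le> e" for c e
    using emeasure_interval_measure_Icc[OF that mono cont] by simp
  \<comment> \<open>A measurable hull of the possibly non-measurable \<open>E\<close>, with the same
    outer measure.\<close>
  obtain B where B: "B \<in> sets lborel" "E \<subseteq> B" "outer_measure_of lborel E = emeasure lborel B"
    using outer_measure_of_attain[of E lborel] by auto
  obtain R where "\<forall>x\<in>E. norm x \<le> R" using E unfolding bounded_iff by blast
  then have R: "E \<subseteq> cball 0 R" by auto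
  have "emeasure lborel B \<le> emeasure lborel (cball (0::real) R)"
    using outer_measure_of_mono[OF R, of lborel] B(3) by simp
  also have "\<dots> < \<infinity>" by (simp add: cball_eq_atLeastAtMost emeasure_lborel_Icc_eq)
  finally have fin: "emeasure lborel B < \<infinity>" .
  define m where "m = measure lborel B"
  have m: "emeasure lborel B = ennreal m" "m \<ge> 0"
    using fin by (auto simp: m_def emeasure_eq_ennreal_measure)
  have key: "q * m \<le> p * (m + \<epsilon>)" if eps: "\<epsilon> > 0" for \<epsilon>
  proof -
    obtain G where G: "open G" "B \<subseteq> G" "emeasure lebesgue (G - B) < ennreal \<epsilon>"
      using sets_lebesgue_outer_open[OF sets_completionI_sets[OF B(1)] eps] by metis
    have GB: "G \<in> sets borel" using G by simp
    have "emeasure lborel G = emeasure lborel (B \<union> (G - B))" using G by (simp add: Un_absorb1)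
    also have "\<dots> \<le> emeasure lborel B + emeasure lborel (G - B)"
      by (rule emeasure_subadditive) (use B GB in auto)
    also have "\<dots> \<le> ennreal m + ennreal \<epsilon>"
      using G B(1) GB m by (intro add_mono) (auto simp: emeasure_completion intro: less_imp_le)
    finally have muG: "emeasure lborel G \<le> ennreal (m + \<epsilon>)" using m eps by simp
    have EG: "E \<subseteq> G" using B(2) G(2) by simp
    obtain C where C: "countable C" "\<And>i. i \<in> C \<Longrightarrow> fst i < snd i \<and> F (snd i) - F (fst i) \<le> p * (snd i - fst i) \<and> {fst i..snd i} \<subseteq> G"
      "disjoint_family_on (\<lambda>i. {fst i..snd i}) C" "negligible (E - (\<Union>i\<in>C. {fst i..snd i}))"
      using Vitali_real_intervals[OF G(1) EG, of "\<lambda>c e. F e - F c \<le> p * (e - c)", OF lo] by blast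
    define V where "V = (\<Union>i\<in>C. {fst i..snd i})"
    have Vb: "V \<in> sets borel" unfolding V_def using C(1) by (intro sets.countable_UN') auto
    have "emeasure ?nu V \<le> ennreal p * emeasure lborel V" unfolding V_def
    proof (rule emeasure_UN_mono_countable[OF C(1,3)])
      fix i assume "i \<in> C"
      from C(2)[OF this] show "emeasure ?nu {fst i..snd i} \<le> ennreal p * emeasure lborel {fst i..snd i}"
        using pq by (simp add: nu ennreal_mult[symmetric] ennreal_leI)
    qed auto
    also have "\<dots> \<le> ennreal p * emeasure lborel G"
      using C(2) GB unfolding V_def by (intro mult_left_mono emeasure_mono) auto
    also have "\<dots> \<le> ennreal p * ennreal (m + \<epsilon>)" by (intro mult_left_mono muG) auto
    also have "\<dots> = ennreal (p * (m + \<epsilon>))" using pq m eps by (simp add: ennreal_mult)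
    finally have nuV: "emeasure ?nu V \<le> ennreal (p * (m + \<epsilon>))" .
    \<comment> \<open>The second cover must lie in an open set; passing to open intervals loses only
      the countably many endpoints.\<close>
    define U where "U = (\<Union>i\<in>C. {fst i<..<snd i})"
    have Uo: "open U" unfolding U_def by auto
    have UV: "U \<subseteq> V" unfolding U_def V_def by (auto intro: less_imp_le)
    have negU: "negligible (E - U)"
    proof -
      have "countable (fst ` C \<union> snd ` C)" using C(1) by auto
      then have "negligible (fst ` C \<union> snd ` C)" by (simp add: countable_imp_null_set_lborel null_sets_completionI negligible_iff_null_sets)
      moreover have "E - U \<subseteq> (E - V) \<union> (fst ` C \<union> snd ` C)"
        unfolding U_def V_def by force
      ultimately show ?thesis using C(4) unfolding V_def by (metis negligible_Un negligible_subset)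
    qed
    obtain D where D: "countable D" "\<And>i. i \<in> D \<Longrightarrow> fst i < snd i \<and> F (snd i) - F (fst i) \<ge> q * (snd i - fst i) \<and> {fst i..snd i} \<subseteq> U"
      "disjoint_family_on (\<lambda>i. {fst i..snd i}) D" "negligible (E \<inter> U - (\<Union>i\<in>D. {fst i..snd i}))"
      using Vitali_real_intervals[OF Uo Int_lower2, of E "\<lambda>c e. F e - F c \<ge> q * (e - c)", OF hi[OF IntD1]] by blast
    define W where "W = (\<Union>i\<in>D. {fst i..snd i})"
    have Wb: "W \<in> sets borel" unfolding W_def using D(1) by (intro sets.countable_UN') auto
    have "emeasure lborel W \<le> ennreal (1/q) * emeasure ?nu W" unfolding W_def
    proof (rule emeasure_UN_mono_countable[OF D(1,3)])
      fix i assume i: "i \<in> D"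
      have "snd i - fst i \<le> (1/q) * (F (snd i) - F (fst i))"
        using D(2)[OF i] pq by (simp add: field_simps)
      then show "emeasure lborel {fst i..snd i} \<le> ennreal (1/q) * emeasure ?nu {fst i..snd i}"
        using D(2)[OF i] pq mono[of "fst i" "snd i"] by (simp add: nu ennreal_mult[symmetric] ennreal_leI)
    qed auto
    also have "\<dots> \<le> ennreal (1/q) * emeasure ?nu V"
      using D(2) UV Vb unfolding W_def by (intro mult_left_mono emeasure_mono) (auto simp del: sets_lborel)
    also have "\<dots> \<le> ennreal (1/q) * ennreal (p * (m + \<epsilon>))" by (intro mult_left_mono nuV) auto
    also have "\<dots> = ennreal (1/q * (p * (m + \<epsilon>)))" using pq m eps by (subst ennreal_mult[symmetric]) auto
    finally have muW: "emeasure lborel W \<le> ennreal (1/q * (p * (m + \<epsilon>)))" .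
    have "negligible (E - W)"
    proof (rule negligible_subset)
      show "negligible ((E - U) \<union> (E \<inter> U - W))" using negU D(4) unfolding W_def by (rule negligible_Un)
    qed auto
    from outer_measure_le_Vitali[OF Wb this] have "ennreal m \<le> ennreal (1/q * (p * (m + \<epsilon>)))"
      using muW B m by simp
    then have "m \<le> 1/q * (p * (m + \<epsilon>))" using pq m eps by (subst (asm) ennreal_le_iff) auto
    then show ?thesis using pq by (simp add: field_simps)
  qed
  have "m = 0"
  proof (rule ccontr)
    assume "m \<noteq> 0"
    then have m0: "m > 0" using m by simp
    \<comment> \<open>\<open>t\<close> is the excess of \<open>q * m\<close> over
      \<open>p * m\<close>; with \<open>\<epsilon> = t / (2 * (p + 1))\<close> the inequality
      \<open>key\<close> can absorb at most half of it.\<close>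
    define t where "t = (q - p) * m"
    have t: "t > 0" unfolding t_def using m0 pq by simp
    have "q * m \<le> p * (m + t / (2 * (p + 1)))"
      using t pq by (intro key) auto
    moreover have "p * (t / (2 * (p + 1))) \<le> t / 2"
    proof -
      have "p / (p + 1) \<le> 1" using pq by simp
      then have "p / (p + 1) * (t / 2) \<le> 1 * (t / 2)"
        using t by (intro mult_right_mono) auto
      then show ?thesis by (simp add: field_simps)
    qed
    moreover have "q * m = p * m + t" unfolding t_def by (simp add: algebra_simps)
    ultimately show False using t distrib_left[of p m "t / (2 * (p + 1))"] by linarith
  qed
  then have "B \<in> null_sets lborel" using m B(1) by (auto simp: null_sets_def)
  then show ?thesis using B(2) by (metis negligible_iff_null_sets null_sets_completion_iff2)
qed

text \<open>The infimum of the bounds that the difference quotient undercuts arbitrarily close to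
  \<open>x\<close> is its lower limit, finite by the Lipschitz bound. If no rational pair separates
  it from the upper limit, the quotient converges.\<close>

lemma Lipschitz_real_differentiable:
  fixes h :: "real \<Rightarrow> real"
  assumes lip: "L-lipschitz_on {a..b} h" and x: "x \<in> {a<..<b}"
    and slopes: "\<And>p q. p \<in> \<rat> \<Longrightarrow> q \<in> \<rat> \<Longrightarrow> p < q \<Longrightarrow>
       \<not> ((\<exists>\<^sub>F y in at x. (h y - h x) / (y - x) < p) \<and> (\<exists>\<^sub>F y in at x. (h y - h x) / (y - x) > q))"
  shows "h differentiable (at x)"
proof -
  let ?s = "\<lambda>y. (h y - h x) / (y - x)"
  have L0: "L \<ge> 0" using lip lipschitz_on_nonneg by blast
  have ab: "\<forall>\<^sub>F y in at x. y \<in> {a<..<b}"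
    using x by (intro eventually_at_in_open') auto
  have bd: "\<forall>\<^sub>F y in at x. \<bar>?s y\<bar> \<le> L"
  proof (rule eventually_mono[OF ab])
    fix y assume y: "y \<in> {a<..<b}"
    have "\<bar>h y - h x\<bar> \<le> L * \<bar>y - x\<bar>"
      using lipschitz_onD[OF lip, of y x] y x by (auto simp: dist_real_def)
    then show "\<bar>?s y\<bar> \<le> L" using L0 by (cases "y = x") (auto simp: divide_simps abs_divide)
  qed
  define A where "A = {c. \<exists>\<^sub>F y in at x. ?s y < c}"
  have "\<forall>\<^sub>F y in at x. ?s y < L + 1" using bd by eventually_elim linarith
  then have ne: "L + 1 \<in> A"
    unfolding A_def using eventually_frequently[of "at x"] by simp
  have lb: "c \<ge> - L" if "c \<in> A" for c
  proof (rule ccontr)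
    assume c: "\<not> c \<ge> - L"
    have "\<forall>\<^sub>F y in at x. \<not> ?s y < c" using bd by eventually_elim (use c in linarith)
    then show False using that unfolding A_def frequently_def by auto
  qed
  define l where "l = Inf A"
  have bdd: "bdd_below A" using lb by (meson bdd_belowI)
  have "(?s \<longlongrightarrow> l) (at x)"
  proof (rule order_tendstoI)
    fix c assume "c < l"
    then have "c \<notin> A" using cInf_lower[OF _ bdd, of c] unfolding l_def by auto
    obtain c' where c': "c < c'" "c' < l" using \<open>c < l\<close> dense by blast
    then have "c' \<notin> A" using cInf_lower[OF _ bdd, of c'] unfolding l_def by auto
    then have "\<forall>\<^sub>F y in at x. \<not> ?s y < c'" unfolding A_def frequently_def by auto
    then show "\<forall>\<^sub>F y in at x. c < ?s y" by eventually_elim (use c' in auto)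
  next
    fix c assume "l < c"
    obtain q where q: "q \<in> \<rat>" "l < q" "q < c" using Rats_dense_in_real[OF \<open>l < c\<close>] by auto
    obtain p where p: "p \<in> \<rat>" "l < p" "p < q" using Rats_dense_in_real[OF \<open>l < q\<close>] by auto
    obtain c1 where "c1 \<in> A" "c1 < p" using cInf_lessD[of A p] ne p unfolding l_def by auto
    then have "\<exists>\<^sub>F y in at x. ?s y < p" unfolding A_def by (auto elim!: frequently_elim1)
    then have "\<not> (\<exists>\<^sub>F y in at x. ?s y > q)" using slopes[OF p(1) q(1) p(3)] by auto
    then have "\<forall>\<^sub>F y in at x. \<not> ?s y > q" unfolding frequently_def by auto
    then show "\<forall>\<^sub>F y in at x. ?s y < c" by eventually_elim (use q in auto)
  qed
  then have "(h has_real_derivative l) (at x)"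
    by (simp add: has_field_derivative_iff)
  then show ?thesis by (auto simp: real_differentiable_def)
qed

text \<open>Supplies the small intervals of a Vitali cover: each has \<open>x\<close> as an
  endpoint, so its slope is a difference quotient at \<open>x\<close>.\<close>

lemma frequently_slope_interval:
  fixes h :: "real \<Rightarrow> real"
  assumes fr: "\<exists>\<^sub>F y in at x. P ((h y - h x) / (y - x))" and x: "x \<in> {a<..<b}" and d: "d > 0"
  shows "\<exists>c e. c < e \<and> x \<in> {c..e} \<and> e - c < d \<and> {c..e} \<subseteq> {a<..<b} \<and> P ((h e - h c) / (e - c))"
proof -
  have "\<forall>\<^sub>F y in at x. y \<in> {a<..<b} \<inter> ball x d \<and> y \<noteq> x"
    using eventually_at_in_open[of "{a<..<b} \<inter> ball x d" x, OF open_Int] x d by simp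
  from frequently_eventually_frequently[OF fr this]
  obtain y where y: "P ((h y - h x) / (y - x))" "y \<in> {a<..<b}" "dist x y < d" "y \<noteq> x"
    by (auto dest!: frequently_ex)
  have sym: "(h y - h x) / (y - x) = (h x - h y) / (x - y)"
    by (metis minus_diff_eq minus_divide_divide)
  show ?thesis
  proof (cases "x < y")
    case True
    then show ?thesis by (intro exI[of _ x] exI[of _ y]) (use y x in \<open>auto simp: dist_real_def\<close>)
  next
    case False
    then show ?thesis by (intro exI[of _ y] exI[of _ x]) (use y x sym in \<open>auto simp: dist_real_def\<close>)
  qed
qed

text \<open>Almost every point is a point of differentiability, since the others lie in countably
  many sets with two distinct rational slopes. The good points are covered by intervals on which
  \<open>F\<close>, which is \<open>h\<close> plus the slope \<open>L + 1\<close>, rises at a rate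
  of almost \<open>L + 1\<close>; hence \<open>F\<close> rises at that rate over the whole
  interval.\<close>

theorem Lipschitz_nondecreasing:
  fixes h :: "real \<Rightarrow> real"
  assumes lip: "L-lipschitz_on {a..b} h" and ab: "a \<le> b"
    and der: "\<And>x. x \<in> {a<..<b} \<Longrightarrow> h differentiable (at x) \<Longrightarrow> deriv h x \<ge> 0"
  shows "h a \<le> h b"
proof -
  have L0: "L \<ge> 0" using lip lipschitz_on_nonneg by blast
  \<comment> \<open>Clamping extends \<open>F\<close> to the whole line, as its Stieltjes measure
    requires. The constant is \<open>L + 1\<close> instead of \<open>L\<close> so that the slope
    \<open>L + 1 - \<epsilon>\<close> used below is positive even for \<open>L = 0\<close>.\<close>
  define F where "F = (\<lambda>x. h (max a (min b x)) + (L + 1) * max a (min b x))"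
  have mono: "F x \<le> F y" if "x \<le> y" for x y
  proof -
    let ?x = "max a (min b x)" and ?y = "max a (min b y)"
    have xy: "?x \<le> ?y" "?x \<in> {a..b}" "?y \<in> {a..b}" using that ab by auto
    have "\<bar>h ?x - h ?y\<bar> \<le> L * (?y - ?x)"
      using lipschitz_onD[OF lip xy(2,3)] xy(1) by (simp add: dist_real_def)
    then have "h ?x - h ?y \<le> L * (?y - ?x)" by linarith
    then have "h ?x + L * ?x \<le> h ?y + L * ?y" by (simp add: right_diff_distrib)
    then show ?thesis unfolding F_def distrib_right using xy(1) by linarith
  qed
  have cont: "continuous_on UNIV F"
  proof -
    have c: "continuous_on UNIV (\<lambda>x. max a (min b x))" by (intro continuous_intros)
    have "continuous_on UNIV (\<lambda>x. h (max a (min b x)))"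
      by (rule continuous_on_compose2[OF lipschitz_on_continuous_on[OF lip] c]) (use ab in auto)
    then show ?thesis unfolding F_def by (intro continuous_intros c)
  qed
  have F: "F x = h x + (L + 1) * x" if "x \<in> {a..b}" for x
  proof -
    have "max a (min b x) = x" using that by auto
    then show ?thesis unfolding F_def by simp
  qed
  define E where "E p q = {x \<in> {a<..<b}. (\<exists>\<^sub>F y in at x. (h y - h x) / (y - x) < p) \<and> (\<exists>\<^sub>F y in at x. (h y - h x) / (y - x) > q)}" for p q
  have slopeF: "F e - F c = (h e - h c) + (L + 1) * (e - c)" if "{c..e} \<subseteq> {a<..<b}" "c < e" for c e
  proof -
    have "c \<in> {a..b}" "e \<in> {a..b}" using that by (auto simp: subset_eq less_imp_le)
    then show ?thesis using F by (simp add: algebra_simps)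
  qed
  have negE: "negligible (E p q)" if "p < q" for p q
  proof -
    have "negligible (E p q)" if "E p q \<noteq> {}"
    proof -
      from that obtain x0 where x0: "x0 \<in> E p q" by auto
      \<comment> \<open>Guarantees that the shifted lower slope \<open>p + (L + 1)\<close> is
        nonnegative, as the negligibility lemma demands.\<close>
      have pl: "p \<ge> - L"
      proof -
        obtain c e where ce: "c < e" "{c..e} \<subseteq> {a<..<b}" "(h e - h c) / (e - c) < p"
          using frequently_slope_interval[of "\<lambda>s. s < p" h x0 a b 1] x0 unfolding E_def by (simp, blast)
        have "F c \<le> F e" using mono ce by simp
        have "c \<in> {a..b}" "e \<in> {a..b}" using ce by (auto simp: subset_eq less_imp_le)
        then have "\<bar>h c - h e\<bar> \<le> L * (e - c)"
          using lipschitz_onD[OF lip, of c e] ce(1) by (simp add: dist_real_def)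
        then have "- L \<le> (h e - h c) / (e - c)" using ce(1) by (simp add: field_simps abs_le_iff)
        then show ?thesis using ce by linarith
      qed
      show ?thesis
      proof (rule negligible_distinct_slopes[OF mono cont, of "p + (L + 1)" "q + (L + 1)"])
        show "bounded (E p q)" by (rule bounded_subset[of "{a<..<b}"]) (auto simp: E_def)
      next
        fix x d :: real assume x: "x \<in> E p q" "d > 0"
        obtain c e where ce: "c < e" "x \<in> {c..e}" "e - c < d" "{c..e} \<subseteq> {a<..<b}" "(h e - h c) / (e - c) < p"
          using frequently_slope_interval[of "\<lambda>s. s < p" h x a b d] x unfolding E_def by (simp, blast)
        then have "F e - F c \<le> (p + (L + 1)) * (e - c)"
          using slopeF[OF ce(4,1)] by (simp add: field_simps)
        then show "\<exists>c e. c < e \<and> x \<in> {c..e} \<and> e - c < d \<and> F e - F c \<le> (p + (L + 1)) * (e - c)"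
          using ce by blast
        obtain c e where ce: "c < e" "x \<in> {c..e}" "e - c < d" "{c..e} \<subseteq> {a<..<b}" "(h e - h c) / (e - c) > q"
          using frequently_slope_interval[of "\<lambda>s. s > q" h x a b d] x unfolding E_def by (simp, blast)
        then have "F e - F c \<ge> (q + (L + 1)) * (e - c)"
          using slopeF[OF ce(4,1)] by (simp add: field_simps)
        then show "\<exists>c e. c < e \<and> x \<in> {c..e} \<and> e - c < d \<and> F e - F c \<ge> (q + (L + 1)) * (e - c)"
          using ce by blast
      qed (use \<open>p < q\<close> pl in auto)
    qed
    then show ?thesis by (cases "E p q = {}") auto
  qed
  define S where "S = {x \<in> {a<..<b}. h differentiable (at x)}"
  let ?Q = "{(p, q). p \<in> \<rat> \<and> q \<in> \<rat> \<and> p < q} :: (real \<times> real) set"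
  have cQ: "countable ?Q"
    by (rule countable_subset[of _ "\<rat> \<times> \<rat>"]) (auto intro: countable_rat)
  have "{a<..<b} - S \<subseteq> (\<Union>(p, q)\<in>?Q. E p q)"
    using Lipschitz_real_differentiable[OF lip] unfolding S_def E_def by blast
  moreover have "negligible (\<Union>(p, q)\<in>?Q. E p q)"
    by (rule negligible_countable_Union) (use cQ negE in auto)
  ultimately have negS: "negligible ({a<..<b} - S)" using negligible_subset by blast
  let ?nu = "interval_measure F"
  have nu: "emeasure ?nu {c..e} = ennreal (F e - F c)" if "c \<le> e" for c e
    using emeasure_interval_measure_Icc[OF that mono cont] by simp
  have key: "(b - a) \<le> 1 / (L + 1 - \<epsilon>) * (F b - F a)" if eps: "\<epsilon> > 0" "\<epsilon> < 1" for \<epsilon>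
  proof -
    have fine: "\<exists>c e. c < e \<and> x \<in> {c..e} \<and> e - c < d \<and> F e - F c \<ge> (L + 1 - \<epsilon>) * (e - c)" if x: "x \<in> S" "d > 0" for x d
    proof -
      have "(h has_real_derivative deriv h x) (at x)"
        using x unfolding S_def by (simp add: DERIV_deriv_iff_real_differentiable)
      then have "((\<lambda>y. (h y - h x) / (y - x)) \<longlongrightarrow> deriv h x) (at x)"
        by (simp add: has_field_derivative_iff)
      moreover have "- \<epsilon> < deriv h x" using der[of x] x(1) eps(1) unfolding S_def by simp
      ultimately have "\<forall>\<^sub>F y in at x. - \<epsilon> < (h y - h x) / (y - x)" by (rule order_tendstoD)
      then have "\<exists>\<^sub>F y in at x. - \<epsilon> < (h y - h x) / (y - x)" by (intro eventually_frequently) auto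
      then obtain c e where ce: "c < e" "x \<in> {c..e}" "e - c < d" "{c..e} \<subseteq> {a<..<b}" "(h e - h c) / (e - c) > - \<epsilon>"
        using frequently_slope_interval[of "\<lambda>s. s > - \<epsilon>" h x a b d] x unfolding S_def by (simp, blast)
      then have "F e - F c \<ge> (L + 1 - \<epsilon>) * (e - c)"
        using slopeF[OF ce(4,1)] by (simp add: field_simps)
      then show ?thesis using ce by blast
    qed
    have So: "S \<subseteq> {a<..<b}" unfolding S_def by auto
    obtain D where D: "countable D" "\<And>i. i \<in> D \<Longrightarrow> fst i < snd i \<and> F (snd i) - F (fst i) \<ge> (L + 1 - \<epsilon>) * (snd i - fst i) \<and> {fst i..snd i} \<subseteq> {a<..<b}"
      "disjoint_family_on (\<lambda>i. {fst i..snd i}) D" "negligible (S - (\<Union>i\<in>D. {fst i..snd i}))"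
      using Vitali_real_intervals[of "{a<..<b}" S "\<lambda>c e. F e - F c \<ge> (L + 1 - \<epsilon>) * (e - c)", OF open_greaterThanLessThan So fine] by blast
    define W where "W = (\<Union>i\<in>D. {fst i..snd i})"
    have Wb: "W \<in> sets borel" unfolding W_def using D(1) by (intro sets.countable_UN') auto
    have "negligible ({a<..<b} - W)"
    proof (rule negligible_subset)
      show "negligible (({a<..<b} - S) \<union> (S - W))" using negS D(4) unfolding W_def by (rule negligible_Un)
    qed auto
    from outer_measure_le_Vitali[OF Wb this] have "ennreal (b - a) \<le> emeasure lborel W"
      using ab by simp
    also have "\<dots> \<le> ennreal (1 / (L + 1 - \<epsilon>)) * emeasure ?nu W" unfolding W_def
    proof (rule emeasure_UN_mono_countable[OF D(1,3)])
      fix i assume i: "i \<in> D"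
      have "snd i - fst i \<le> (1 / (L + 1 - \<epsilon>)) * (F (snd i) - F (fst i))"
        using D(2)[OF i] that L0 by (simp add: field_simps)
      then show "emeasure lborel {fst i..snd i} \<le> ennreal (1 / (L + 1 - \<epsilon>)) * emeasure ?nu {fst i..snd i}"
        using D(2)[OF i] that L0 mono[of "fst i" "snd i"] by (simp add: nu ennreal_mult[symmetric] ennreal_leI del: ennreal_mult)
    qed auto
    also have "\<dots> \<le> ennreal (1 / (L + 1 - \<epsilon>)) * emeasure ?nu {a..b}"
      unfolding W_def by (intro mult_left_mono emeasure_mono) (use D(2) in \<open>auto simp: subset_eq less_imp_le\<close>)
    also have "\<dots> = ennreal (1 / (L + 1 - \<epsilon>) * (F b - F a))"
      using eps L0 mono[OF ab] ab by (simp only: nu) (subst ennreal_mult[symmetric], auto)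
    finally show ?thesis using that L0 mono[OF ab] by (subst (asm) ennreal_le_iff) auto
  qed
  have "h b - h a \<ge> - \<epsilon>" if "\<epsilon> > 0" for \<epsilon>
  proof -
    \<comment> \<open>\<open>key\<close> needs a number below 1; the \<open>+ 1\<close> in the
      denominator admits \<open>a = b\<close>.\<close>
    define \<delta> where "\<delta> = min (1/2) (\<epsilon> / (b - a + 1))"
    have d: "\<delta> > 0" "\<delta> < 1" "\<delta> \<le> \<epsilon> / (b - a + 1)" using that ab unfolding \<delta>_def by auto
    have "(L + 1 - \<delta>) * (b - a) \<le> F b - F a" using key[OF d(1,2)] d L0 by (simp add: field_simps)
    then have "h b - h a \<ge> - (\<delta> * (b - a))" using F[of a] F[of b] ab by (simp add: algebra_simps)
    moreover have "\<delta> * (b - a) \<le> \<epsilon> / (b - a + 1) * (b - a + 1)" using d ab by (intro mult_mono) auto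
    ultimately show ?thesis using ab by simp
  qed
  then have "h a \<le> h b + \<epsilon>" if "\<epsilon> > 0" for \<epsilon> using that by (smt (verit))
  then show ?thesis by (rule field_le_epsilon)
qed

section \<open>One-sided derivatives and the elasticity of f\<close>

text \<open>A tilt by a small positive slope makes the right derivative strictly positive; then the
  last point at which the tilted function is at least its initial value can only be
  \<open>b\<close>.\<close>

lemma right_deriv_nonneg_imp_le:
  fixes F :: "real \<Rightarrow> real"
  assumes "a \<le> b" and cont: "continuous_on {a..b} F"
    and der: "\<And>x. a \<le> x \<Longrightarrow> x < b \<Longrightarrow> \<exists>d\<ge>0. (F has_real_derivative d) (at x within {x..})"
  shows "F a \<le> F b"
proof -
  have "F a \<le> F b + e" if e: "e > 0" for e
  proof -
    define \<epsilon> where "\<epsilon> = e / (b - a + 1)"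
    have \<epsilon>: "\<epsilon> > 0" "\<epsilon> * (b - a) \<le> e"
      using e assms(1) by (auto simp: \<epsilon>_def field_simps)
    define G where "G = (\<lambda>t. F t + \<epsilon> * (t - a))"
    have contG: "continuous_on {a..b} G" unfolding G_def by (intro continuous_intros cont)
    define S where "S = {t \<in> {a..b}. G a \<le> G t}"
    have "closed S" unfolding S_def
      by (intro continuous_on_closed_Collect_le continuous_on_const contG closed_atLeastAtMost)
    moreover have "a \<in> S" using assms(1) unfolding S_def by auto
    moreover have bdd: "bdd_above S" unfolding S_def by auto
    ultimately have c: "Sup S \<in> S" by (intro closed_contains_Sup) auto
    define c where "c = Sup S"
    have cS: "a \<le> c" "c \<le> b" "G a \<le> G c" using c unfolding c_def S_def by auto
    have "c = b"
    proof (rule ccontr)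
      assume "c \<noteq> b"
      then have cb: "c < b" using cS by simp
      obtain d where d: "d \<ge> 0" "(F has_real_derivative d) (at c within {c..})"
        using der[OF cS(1) cb] by blast
      have "(G has_real_derivative d + \<epsilon>) (at c within {c..})"
        unfolding G_def by (auto intro!: derivative_eq_intros d)
      from has_real_derivative_pos_inc_right[OF this] obtain \<delta> where
        \<delta>: "\<delta> > 0" "\<And>h. h > 0 \<Longrightarrow> c + h \<in> {c..} \<Longrightarrow> h < \<delta> \<Longrightarrow> G c < G (c + h)"
        using d \<epsilon> by auto
      define h where "h = min (\<delta>/2) (b - c)"
      have h: "h > 0" "h < \<delta>" "c + h \<le> b" using \<delta>(1) cb by (auto simp: h_def)
      then have "c + h \<in> S" using \<delta>(2)[of h] cS unfolding S_def by auto
      then have "c + h \<le> c" unfolding c_def using bdd by (rule cSup_upper)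
      then show False using h by simp
    qed
    then show ?thesis using cS \<epsilon> unfolding G_def by simp
  qed
  then show ?thesis by (rule field_le_epsilon)
qed

lemma left_deriv_nonneg_imp_le:
  fixes F :: "real \<Rightarrow> real"
  assumes "a \<le> b" and cont: "continuous_on {a..b} F"
    and der: "\<And>x. a < x \<Longrightarrow> x \<le> b \<Longrightarrow> \<exists>d\<ge>0. (F has_real_derivative d) (at x within {..x})"
  shows "F a \<le> F b"
proof -
  have "(\<lambda>x. - F (- x)) (- b) \<le> (\<lambda>x. - F (- x)) (- a)"
  proof (rule right_deriv_nonneg_imp_le[of "- b" "- a" "\<lambda>x. - F (- x)"])
    show "continuous_on {- b..- a} (\<lambda>x. - F (- x))"
      by (intro continuous_intros continuous_on_compose2[OF cont]) auto
    fix x assume x: "- b \<le> x" "x < - a"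
    then obtain d where d: "d \<ge> 0" "(F has_real_derivative d) (at (- x) within {..- x})"
      using der[of "- x"] by auto
    have "(F has_real_derivative d) (at (- x) within uminus ` {x..})" using d(2) by simp
    then have "((F \<circ> uminus) has_real_derivative d * (-1)) (at x within {x..})"
      by (rule DERIV_image_chain) (auto intro!: derivative_eq_intros)
    then have "((\<lambda>x. - F (- x)) has_real_derivative d) (at x within {x..})"
      using DERIV_minus by (fastforce simp: o_def)
    with d show "\<exists>d\<ge>0. ((\<lambda>x. - F (- x)) has_real_derivative d) (at x within {x..})" by auto
  qed (use assms in auto)
  then show ?thesis by simp
qed

text \<open>A one-sided mean value theorem: otherwise \<open>h x - \<mu> * x\<close> would be
  nondecreasing.\<close>

lemma Lipschitz_exists_deriv_less:
  fixes h :: "real \<Rightarrow> real"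
  assumes lip: "L-lipschitz_on {a..b} h" and ab: "a \<le> b" and less: "h b - h a < \<mu> * (b - a)"
  shows "\<exists>x\<in>{a<..<b}. h differentiable (at x) \<and> deriv h x < \<mu>"
proof (rule ccontr)
  assume contra: "\<not> ?thesis"
  define k where "k = (\<lambda>x. h x - \<mu> * x)"
  have "(L + \<bar>\<mu>\<bar>)-lipschitz_on {a..b} k" unfolding k_def
    using lipschitz_on_diff[OF lip lipschitz_on_cmult_real[OF lipschitz_on_id, of \<mu>]] by simp
  then have "k a \<le> k b"
  proof (rule Lipschitz_nondecreasing[OF _ ab])
    fix x assume x: "x \<in> {a<..<b}" "k differentiable (at x)"
    then have "(k has_real_derivative deriv k x) (at x)"
      by (simp add: DERIV_deriv_iff_real_differentiable)
    then have "((\<lambda>x. k x + \<mu> * x) has_real_derivative deriv k x + \<mu>) (at x)"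
      by (auto intro!: derivative_eq_intros)
    then have "(h has_real_derivative deriv k x + \<mu>) (at x)" unfolding k_def by simp
    then show "deriv k x \<ge> 0" using contra x(1) by (force simp: real_differentiable_def DERIV_imp_deriv)
  qed
  then show False using less unfolding k_def by (simp add: algebra_simps)
qed

lemma ln_Lipschitz:
  assumes "c > (0::real)"
  shows "(1/c)-lipschitz_on {c..} ln"
proof (rule lipschitz_onI)
  have *: "ln y - ln x \<le> 1/c * (y - x)" if "c \<le> x" "x \<le> y" for x y
  proof -
    have "ln y - ln x \<le> (y - x) / x" using that assms by (intro ln_diff_le) auto
    also have "\<dots> \<le> (y - x) / c" using that assms by (intro divide_left_mono) auto
    finally show ?thesis by simp
  qed
  fix x y assume "x \<in> {c..}" "y \<in> {c..}"
  then show "dist (ln x) (ln y) \<le> 1/c * dist x y"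
  proof (induction x y rule: linorder_wlog)
    case (le x y)
    then have "ln x \<le> ln y" using assms by auto
    then show ?case using * [of x y] le by (simp add: dist_real_def abs_minus_commute)
  qed (simp add: dist_commute)
qed (use assms in auto)

lemma Lipschitz_ln:
  assumes lip: "L-lipschitz_on {a..b} f" and pos: "\<And>x. x \<in> {a..b} \<Longrightarrow> f x > (0::real)" and ab: "a \<le> (b::real)"
  shows "\<exists>L'. L'-lipschitz_on {a..b} (\<lambda>x. ln (f x))"
proof -
  obtain x0 where x0: "x0 \<in> {a..b}" "\<And>x. x \<in> {a..b} \<Longrightarrow> f x0 \<le> f x"
    using continuous_attains_inf[of "{a..b}" f] lipschitz_on_continuous_on[OF lip] ab by auto
  have "(1 / f x0 * L)-lipschitz_on {a..b} (\<lambda>x. ln (f x))"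
    by (rule lipschitz_on_compose2[OF lip lipschitz_on_subset[OF ln_Lipschitz]]) (use x0 pos in auto)
  then show ?thesis by blast
qed

lemma C1_Lipschitz:
  fixes f :: "real \<Rightarrow> real"
  assumes "\<And>x. x \<in> {a..b} \<Longrightarrow> (f has_real_derivative f' x) (at x)" "continuous_on {a..b} f'"
  shows "\<exists>L. L-lipschitz_on {a..b} f"
proof -
  have "bounded (f' ` {a..b})" using assms(2) by (intro compact_imp_bounded compact_continuous_image) auto
  then obtain C where C: "\<forall>x\<in>{a..b}. norm (f' x) \<le> C" unfolding bounded_iff by blast
  have "(max C 0)-lipschitz_on {a..b} f"
  proof (rule bounded_derivative_imp_lipschitz)
    fix x assume "x \<in> {a..b}"
    then show "(f has_derivative (*) (f' x)) (at x within {a..b})"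
      using assms(1) by (simp add: has_field_derivative_def has_derivative_at_withinI)
    show "onorm ((*) (f' x)) \<le> max C 0"
      by (rule onorm_bound) (use C \<open>x \<in> {a..b}\<close> in \<open>auto simp: abs_mult le_max_iff_disj intro!: mult_right_mono\<close>)
  qed auto
  then show ?thesis by blast
qed

text \<open>The assumption is concavity in terms of adjacent chords. The slope of the chord from
  \<open>x\<close> grows as its right end approaches \<open>x\<close>, and any chord ending at
  \<open>x\<close> bounds it, so it converges to its supremum \<open>D x\<close>.\<close>

lemma concave_right_derivative:
  fixes h :: "real \<Rightarrow> real"
  assumes chord: "\<And>x y z. l < x \<Longrightarrow> x < y \<Longrightarrow> y < z \<Longrightarrow> (h y - h x) / (y - x) \<ge> (h z - h y) / (z - y)"
  shows "\<exists>D. (\<forall>x>l. (h has_real_derivative D x) (at x within {x..})) \<and> antimono_on {l<..} D"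
proof -
  define sl where "sl x y = (h y - h x) / (y - x)" for x y
  have dec: "sl x z \<le> sl x y" "sl y z \<le> sl x z" if "l < x" "x < y" "y < z" for x y z
  proof -
    have c: "sl y z \<le> sl x y" using chord[OF that] unfolding sl_def .
    have eq: "sl x z = (sl x y * (y - x) + sl y z * (z - y)) / (z - x)"
      using that unfolding sl_def by simp
    have "sl x z * (z - x) = sl x y * (y - x) + sl y z * (z - y)" using eq that by simp
    moreover have "sl y z * (z - y) \<le> sl x y * (z - y)" "sl y z * (y - x) \<le> sl x y * (y - x)"
      using c that by (auto intro: mult_right_mono)
    ultimately have "sl x z * (z - x) \<le> sl x y * (z - x)" "sl y z * (z - x) \<le> sl x z * (z - x)"
      by (auto simp: algebra_simps)
    then show "sl x z \<le> sl x y" "sl y z \<le> sl x z" using that by simp_all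
  qed
  define D where "D x = Sup (sl x ` {x<..})" for x
  have bd: "bdd_above (sl x ` {x<..})" if xl: "l < x" for x
  proof -
    obtain w where w: "l < w" "w < x" using dense[of l x] xl by blast
    have "sl x y \<le> sl w x" if "x < y" for y using chord[OF w that] unfolding sl_def .
    then show ?thesis by (intro bdd_aboveI2) auto
  qed
  have le: "sl x y \<le> D x" if "l < x" "x < y" for x y
    unfolding D_def using that by (intro cSup_upper bd) auto
  have ge: "D y \<le> sl x y" if "l < x" "x < y" for x y
    unfolding D_def by (rule cSup_least) (use that chord in \<open>auto simp: sl_def\<close>)
  have "(h has_real_derivative D x) (at x within {x..})" if x: "l < x" for x
  proof -
    have "(sl x \<longlongrightarrow> D x) (at_right x)"
    proof (rule order_tendstoI)
      fix a assume "a < D x"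
      then obtain y where y: "y > x" "a < sl x y"
        unfolding D_def using bd[OF x] by (subst (asm) less_cSup_iff) auto
      have "\<forall>\<^sub>F t in at_right x. t \<in> {x<..<y}" using y by (intro eventually_at_right_real)
      then show "\<forall>\<^sub>F t in at_right x. a < sl x t"
        by eventually_elim (use y dec(1)[OF x] in force)
    next
      fix a assume "D x < a"
      have "\<forall>\<^sub>F t in at_right x. t > x" by (rule eventually_at_right_less)
      then show "\<forall>\<^sub>F t in at_right x. sl x t < a"
        by eventually_elim (use le[OF x] \<open>D x < a\<close> in force)
    qed
    then have "(h has_real_derivative D x) (at x within {x<..})"
      unfolding sl_def by (simp add: has_field_derivative_iff)
    moreover have "{x..} - {x} = {x<..} - {x}" by auto
    ultimately show ?thesis by (metis at_within_def has_field_derivative_iff)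
  qed
  moreover have "antimono_on {l<..} D"
  proof (rule monotone_onI)
    fix x y assume "x \<in> {l<..}" "y \<in> {l<..}" "x \<le> y"
    then show "D y \<le> D x" using ge[of x y] le[of x y] by (cases "x = y") auto
  qed
  ultimately show ?thesis by blast
qed

text \<open>In logarithmic coordinates the elasticity \<open>u f' / f\<close> is an ordinary slope,
  so its monotonicity becomes concavity of \<open>ln (f (exp x))\<close>, and the right derivative
  of that function extends the elasticity to every level above \<open>u0\<close>. The second claim
  integrates \<open>(ln f)' \<ge> (p - 1) / (u - u0)\<close>.\<close>

lemma elasticity:
  fixes f :: "real \<Rightarrow> real"
  assumes u0: "u0 > 0" and p: "p > 1" and pos: "\<And>u. u > u0 \<Longrightarrow> f u > 0"
    and lip: "local_lipschitz (UNIV :: real set) {u0..} (\<lambda>_. f)"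
    and f3: "\<And>u. u > u0 \<Longrightarrow> f differentiable (at u) \<Longrightarrow> (p - 1) * f u \<le> deriv f u * (u - u0)"
    and f4: "\<And>u v. u > u0 \<Longrightarrow> u \<le> v \<Longrightarrow> f differentiable (at u) \<Longrightarrow> f differentiable (at v) \<Longrightarrow>
       v * deriv f v / f v \<le> u * deriv f u / f u"
  shows "\<exists>g. (\<forall>s>u0. (f has_real_derivative g s * f s / s) (at s within {s..}) \<and> g s > p - 1) \<and> antimono_on {u0<..} g"
    and "u0 < s \<Longrightarrow> s \<le> t \<Longrightarrow> f s / (s - u0) powr (p - 1) \<le> f t / (t - u0) powr (p - 1)"
proof -
  have lipf: "\<exists>L. L-lipschitz_on {a..b} f" if "u0 < a" for a b
  proof -
    have "local_lipschitz {0::real} {a..b} (\<lambda>_. f)"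
      by (rule local_lipschitz_subset[OF lip]) (use that in auto)
    then obtain L where "\<And>t. t \<in> {0::real} \<Longrightarrow> L-lipschitz_on {a..b} f"
      using local_lipschitz_compact_implies_lipschitz[where X="{a..b}" and T="{0::real}" and f="\<lambda>_. f"] by auto
    then show ?thesis by blast
  qed
  have lnlip: "\<exists>L. L-lipschitz_on {a..b} (\<lambda>x. ln (f x))" if "u0 < a" "a \<le> b" for a b
    using lipf[OF that(1), of b] Lipschitz_ln[of _ a b f] that pos by force
  have mono: "f s / (s - u0) powr (p - 1) \<le> f t / (t - u0) powr (p - 1)" if st: "u0 < s" "s \<le> t" for s t
  proof -
    define k where "k = (\<lambda>x. ln (f x) - (p - 1) * ln (x - u0))"
    obtain L1 where L1: "L1-lipschitz_on {s..t} (\<lambda>x. ln (f x))" using lnlip[OF st] by blast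
    have "\<exists>L. L-lipschitz_on {s..t} (\<lambda>x. (p - 1) * ln (x - u0))"
    proof (rule C1_Lipschitz)
      show "((\<lambda>x. (p - 1) * ln (x - u0)) has_real_derivative (p - 1) * (1 / (x - u0))) (at x)" if "x \<in> {s..t}" for x
        using that st by (auto intro!: derivative_eq_intros)
      show "continuous_on {s..t} (\<lambda>x. (p - 1) * (1 / (x - u0)))"
        using st by (intro continuous_intros) auto
    qed
    then obtain L2 where L2: "L2-lipschitz_on {s..t} (\<lambda>x. (p - 1) * ln (x - u0))" by blast
    have "k s \<le> k t"
    proof (rule Lipschitz_nondecreasing[OF _ st(2)])
      show "(L1 + L2)-lipschitz_on {s..t} k" unfolding k_def by (intro lipschitz_on_diff L1 L2)
      fix x assume x: "x \<in> {s<..<t}" "k differentiable (at x)"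
      \<comment> \<open>\<open>G\<close> rebuilds \<open>f\<close> from \<open>k\<close>, so that
        differentiability of \<open>k\<close> at \<open>x\<close> passes to \<open>f\<close> and the
        growth hypothesis applies at \<open>x\<close>.\<close>
      define G where "G = (\<lambda>x. exp (k x + (p - 1) * ln (x - u0)))"
      have x0: "x > u0" using x st by auto
      have eqG: "G y = f y" if "y > u0" for y using pos[OF that] unfolding G_def k_def by simp
      have ev: "\<forall>\<^sub>F y in nhds x. G y = f y"
        using x0 by (intro eventually_mono[OF eventually_nhds_in_open[of "{u0<..}" x]] eqG) auto
      have dk: "(k has_real_derivative deriv k x) (at x)"
        using x by (simp add: DERIV_deriv_iff_real_differentiable)
      have "(G has_real_derivative (deriv k x + (p - 1) / (x - u0)) * G x) (at x)"
        unfolding G_def using x0 by (auto intro!: derivative_eq_intros dk)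
      then have df: "(f has_real_derivative (deriv k x + (p - 1) / (x - u0)) * f x) (at x)"
        using DERIV_cong_ev[OF refl ev refl] eqG[OF x0] by simp
      then have "(p - 1) * f x \<le> (deriv k x + (p - 1) / (x - u0)) * f x * (x - u0)"
        using f3[OF x0] DERIV_imp_deriv[OF df] by (metis real_differentiable_def)
      also have "\<dots> = deriv k x * (x - u0) * f x + (p - 1) * f x" using x0 by (simp add: field_simps)
      finally have "0 \<le> deriv k x * ((x - u0) * f x)" by (simp add: mult.assoc)
      moreover have "(x - u0) * f x > 0" using x0 pos[OF x0] by simp
      ultimately show "deriv k x \<ge> 0" using mult_neg_pos by (metis not_less)
    qed
    then have "exp (k s) \<le> exp (k t)" by simp
    moreover have "exp (k x) = f x / (x - u0) powr (p - 1)" if "x > u0" for x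
      using that pos[OF that] unfolding k_def by (simp add: exp_diff powr_def mult.commute)
    ultimately show ?thesis using st by simp
  qed
  then show "u0 < s \<Longrightarrow> s \<le> t \<Longrightarrow> f s / (s - u0) powr (p - 1) \<le> f t / (t - u0) powr (p - 1)" .
  define h where "h = (\<lambda>x. ln (f (exp x)))"
  define l where "l = ln u0"
  have el: "exp x > u0" if "x > l" for x using that u0 unfolding l_def by (metis exp_less_cancel_iff exp_ln)
  have hlip: "\<exists>L. L-lipschitz_on {a..b} h" if ab: "l < a" "a \<le> b" for a b
  proof -
    obtain L1 where L1: "L1-lipschitz_on {exp a..exp b} (\<lambda>x. ln (f x))"
      using lnlip[OF el[OF ab(1)], of "exp b"] ab by auto
    obtain L2 where L2: "L2-lipschitz_on {a..b} (exp :: real \<Rightarrow> real)"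
      using C1_Lipschitz[of a b exp exp] DERIV_exp continuous_on_exp[OF continuous_on_id] by blast
    have "(L1 * L2)-lipschitz_on {a..b} h" unfolding h_def
      by (rule lipschitz_on_compose2[OF L2 lipschitz_on_subset[OF L1]]) auto
    then show ?thesis by blast
  qed
  have dh: "f differentiable (at (exp x)) \<and> exp x * deriv f (exp x) / f (exp x) = deriv h x"
    if x: "x > l" "h differentiable (at x)" for x
  proof -
    define G where "G = (\<lambda>y. exp (h (ln y)))"
    have eqG: "G y = f y" if "y > u0" for y using pos[OF that] that u0 unfolding G_def h_def by simp
    have ev: "\<forall>\<^sub>F y in nhds (exp x). G y = f y"
      using el[OF x(1)] by (intro eventually_mono[OF eventually_nhds_in_open[of "{u0<..}" "exp x"]] eqG) auto
    have dh: "(h has_real_derivative deriv h x) (at (ln (exp x)))"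
      using x by (simp add: DERIV_deriv_iff_real_differentiable)
    have "(ln has_real_derivative 1 / exp x) (at (exp x))" by (auto intro!: derivative_eq_intros)
    then have "((\<lambda>y. h (ln y)) has_real_derivative deriv h x * (1 / exp x)) (at (exp x))"
      using dh by (rule DERIV_chain'[where f=ln and g=h])
    then have "(G has_real_derivative (deriv h x * (1 / exp x)) * G (exp x)) (at (exp x))"
      unfolding G_def by (auto intro!: derivative_eq_intros)
    then have df: "(f has_real_derivative (deriv h x * (1 / exp x)) * f (exp x)) (at (exp x))"
      using DERIV_cong_ev[OF refl ev refl] eqG[OF el[OF x(1)]] by simp
    then show ?thesis using DERIV_imp_deriv[OF df] pos[OF el[OF x(1)]]
      by (auto simp: real_differentiable_def)
  qed
  have chord: "(h y - h x) / (y - x) \<ge> (h z - h y) / (z - y)" if xyz: "l < x" "x < y" "y < z" for x y z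
  proof (rule ccontr)
    assume "\<not> ?thesis"
    \<comment> \<open>If concavity fails, there is a point \<open>a\<close> with slope below
      \<open>\<mu>\<close> to the left of a point \<open>b\<close> with slope above
      \<open>\<mu>\<close>; at both of them \<open>f\<close> is differentiable after the change of
      variable, contrary to \<open>f4\<close>.\<close>
    then obtain \<mu> where \<mu>: "(h y - h x) / (y - x) < \<mu>" "\<mu> < (h z - h y) / (z - y)" using dense by (metis not_le)
    obtain L1 where L1: "L1-lipschitz_on {x..y} h" using hlip[of x y] xyz by auto
    obtain L2 where L2: "L2-lipschitz_on {y..z} h" using hlip[of y z] xyz by auto
    obtain a where a: "a \<in> {x<..<y}" "h differentiable (at a)" "deriv h a < \<mu>"
      using Lipschitz_exists_deriv_less[OF L1, of \<mu>] \<mu>(1) xyz by (auto simp: field_simps)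
    obtain b where b: "b \<in> {y<..<z}" "(\<lambda>x. - h x) differentiable (at b)" "deriv (\<lambda>x. - h x) b < - \<mu>"
      using Lipschitz_exists_deriv_less[OF lipschitz_on_minus[OF L2], of "- \<mu>"] \<mu>(2) xyz by (auto simp: field_simps)
    have "((\<lambda>x. - h x) has_real_derivative deriv (\<lambda>x. - h x) b) (at b)"
      using b by (simp add: DERIV_deriv_iff_real_differentiable)
    from DERIV_minus[OF this] have hb: "(h has_real_derivative - deriv (\<lambda>x. - h x) b) (at b)" by simp
    have hb': "h differentiable (at b)" "deriv h b > \<mu>"
      using hb b DERIV_imp_deriv[OF hb] by (auto simp: real_differentiable_def)
    have "deriv h b \<le> deriv h a"
      using dh[of a] dh[of b] f4[of "exp a" "exp b"] a b hb' xyz el[of a] by auto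
    then show False using a hb' by simp
  qed
  obtain D where D: "\<And>x. x > l \<Longrightarrow> (h has_real_derivative D x) (at x within {x..})" "antimono_on {l<..} D"
    using concave_right_derivative[of l h] chord by blast
  define g where "g = (\<lambda>s. D (ln s))"
  have lnl: "ln s > l" if "s > u0" for s using that u0 unfolding l_def by simp
  have df: "(f has_real_derivative g s * f s / s) (at s within {s..})" if s: "s > u0" for s
  proof -
    have s0: "s > 0" using s u0 by simp
    have "(h has_real_derivative D (ln s)) (at (ln s) within ln ` {s..})"
      by (rule has_field_derivative_subset[OF D(1)[OF lnl[OF s]]]) (use s0 in auto)
    moreover have "(ln has_real_derivative 1 / s) (at s within {s..})"
      using s0 by (auto intro!: derivative_eq_intros)
    ultimately have "((h \<circ> ln) has_real_derivative D (ln s) * (1 / s)) (at s within {s..})"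
      by (rule DERIV_image_chain)
    then have "((\<lambda>y. exp ((h \<circ> ln) y)) has_real_derivative exp ((h \<circ> ln) s) * (D (ln s) * (1 / s))) (at s within {s..})"
      by (rule DERIV_chain'[OF _ DERIV_exp])
    moreover have "exp ((h \<circ> ln) y) = f y" if "y \<in> {s..}" for y
      using that s0 s pos[of y] unfolding h_def by simp
    ultimately have "(f has_real_derivative exp ((h \<circ> ln) s) * (D (ln s) * (1 / s))) (at s within {s..})"
      by (auto intro: has_field_derivative_transform_within[OF _ zero_less_one])
    then show ?thesis unfolding g_def using pos[OF s] s0 by (simp add: h_def algebra_simps)
  qed
  have gp: "g s > p - 1" if s: "s > u0" for s
  proof -
    \<comment> \<open>The right derivative of this nondecreasing quotient yields
      \<open>g s * (s - u0) / s \<ge> p - 1\<close>; since \<open>(s - u0) / s < 1\<close>, the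
      bound on \<open>g s\<close> itself is strict.\<close>
    define q where "q = (\<lambda>x. f x / (x - u0) powr (p - 1))"
    have "(q has_real_derivative (g s * f s / s * (s - u0) powr (p - 1) - f s * ((p - 1) * (s - u0) powr (p - 2))) / ((s - u0) powr (p - 1))\<^sup>2) (at s within {s..})"
      unfolding q_def using s
      by (auto intro!: derivative_eq_intros df simp: power2_eq_square)
    then have lim: "((\<lambda>y. (q y - q s) / (y - s)) \<longlongrightarrow> (g s * f s / s * (s - u0) powr (p - 1) - f s * ((p - 1) * (s - u0) powr (p - 2))) / ((s - u0) powr (p - 1))\<^sup>2) (at s within {s..})"
      by (simp add: has_field_derivative_iff)
    have "0 \<le> (g s * f s / s * (s - u0) powr (p - 1) - f s * ((p - 1) * (s - u0) powr (p - 2))) / ((s - u0) powr (p - 1))\<^sup>2"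
    proof (rule tendsto_lowerbound[OF lim])
      show "\<forall>\<^sub>F y in at s within {s..}. 0 \<le> (q y - q s) / (y - s)"
        unfolding eventually_at_filter using mono[OF s] unfolding q_def
        by (intro always_eventually) auto
      have "at s within {s..} = at_right s" by (metis at_within_Icc_at_right at_within_Ici_at_right) 
      then show "at s within {s..} \<noteq> bot" by simp
    qed
    then have "f s * ((p - 1) * (s - u0) powr (p - 2)) \<le> g s * f s / s * (s - u0) powr (p - 1)"
      using s by (simp add: zero_le_divide_iff)
    also have "(s - u0) powr (p - 1) = (s - u0) powr (p - 2) * (s - u0)"
      using s powr_mult_base[of "s - u0" "p - 2"] by (simp add: mult.commute)
    finally have "(p - 1) * (f s * (s - u0) powr (p - 2)) \<le> (g s * (s - u0) / s) * (f s * (s - u0) powr (p - 2))"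
      by (simp only: times_divide_eq_left times_divide_eq_right mult_ac)
    then have "p - 1 \<le> g s * (s - u0) / s"
      by (rule mult_right_le_imp_le) (use s pos[OF s] in simp)
    then have "p - 1 \<le> g s * ((s - u0) / s)" by simp
    moreover have "0 < (s - u0) / s" "(s - u0) / s < 1" using s u0 by auto
    ultimately show ?thesis using p
      by (smt (verit, best) mult_le_0_iff mult_less_cancel_left2)
  qed
  have "antimono_on {u0<..} g" unfolding g_def
    by (intro monotone_onI monotone_onD[OF D(2)]) (use u0 lnl in auto)
  with df gp show "\<exists>g. (\<forall>s>u0. (f has_real_derivative g s * f s / s) (at s within {s..}) \<and> g s > p - 1) \<and> antimono_on {u0<..} g"
    by blast
qed

section \<open>The phase plane and its comparison principle\<close>

lemma Icc_left_deriv_nonneg_imp_le: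
  fixes F :: "real \<Rightarrow> real"
  assumes ab: "a \<le> b" and c: "c \<le> a" and cont: "continuous_on {a..b} F"
    and der: "\<And>x. a < x \<Longrightarrow> x \<le> b \<Longrightarrow> \<exists>d\<ge>0. (F has_real_derivative d) (at x within {c..x})"
  shows "F a \<le> F b"
proof (rule left_deriv_nonneg_imp_le[OF ab cont])
  fix x assume x: "a < x" "x \<le> b"
  have "at x within {..x} = at_left x" 
    by (rule at_within_nhd[of _ UNIV]) auto
  moreover have "at x within {c..x} = at_left x" using x c by (intro at_within_Icc_at_left) simp
  ultimately show "\<exists>d\<ge>0. (F has_real_derivative d) (at x within {..x})" using der[OF x] by simp
qed

text \<open>As long as \<open>D \<ge> 0\<close>, \<open>A\<close> and \<open>B\<close> grow, so they
  are still positive at the end \<open>T\<close> of this range and, by continuity, slightly beyond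
  it. There a negative \<open>D\<close> would obey \<open>D' \<ge> C * D\<close>, and Gronwall
  forbids it to arise from a nonnegative value. The strict positivity of \<open>A\<close> and
  \<open>B\<close> is what carries the argument across \<open>T\<close>.\<close>

lemma barrier:
  fixes D A B :: "real \<Rightarrow> real"
  assumes x01: "x0 \<le> x1"
    and cD: "continuous_on {x0..x1} D" and cA: "continuous_on {x0..x1} A" and cB: "continuous_on {x0..x1} B"
    and ini: "D x0 \<ge> 0" "A x0 > 0" "B x0 > 0"
    and dA: "\<And>x. x0 < x \<Longrightarrow> x \<le> x1 \<Longrightarrow> D x \<ge> 0 \<Longrightarrow> \<exists>d\<ge>0. (A has_real_derivative d) (at x within {x0..x})"
    and dB: "\<And>x. x0 < x \<Longrightarrow> x \<le> x1 \<Longrightarrow> D x \<ge> 0 \<Longrightarrow> \<exists>d\<ge>0. (B has_real_derivative d) (at x within {x0..x})"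
    and dD: "\<And>x. x0 < x \<Longrightarrow> x \<le> x1 \<Longrightarrow> D x < 0 \<Longrightarrow> A x > 0 \<Longrightarrow> B x > 0 \<Longrightarrow>
                \<exists>d\<ge>C * D x. (D has_real_derivative d) (at x within {x0..x})"
  shows "D x1 \<ge> 0 \<and> A x1 > 0 \<and> B x1 > 0"
proof -
  define G where "G = {t \<in> {x0..x1}. \<forall>x\<in>{x0..t}. D x \<ge> 0}"
  have x0G: "x0 \<in> G" using ini x01 by (auto simp: G_def)
  have bdd: "bdd_above G" by (auto simp: G_def)
  define T where "T = Sup G"
  have T: "x0 \<le> T" "T \<le> x1"
    unfolding T_def using x0G bdd by (auto intro!: cSup_upper cSup_least simp: G_def)
  have less: "D x \<ge> 0" if "x0 \<le> x" "x < T" for x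
  proof -
    obtain t where "t \<in> G" "x < t" using less_cSupD[of G x] x0G \<open>x < T\<close> unfolding T_def by auto
    then show ?thesis using that by (auto simp: G_def)
  qed
  have DT: "D T \<ge> 0"
  proof (cases "T = x0")
    case False
    then have "T > x0" using T by simp
    have "(D \<longlongrightarrow> D T) (at T within {x0..T})"
      using cD T by (metis atLeastAtMost_iff atLeastatMost_subset_iff continuous_on_def continuous_on_subset order_refl)
    then have "(D \<longlongrightarrow> D T) (at_left T)" using at_within_Icc_at_left[OF \<open>T > x0\<close>] by simp
    moreover have "\<forall>\<^sub>F x in at_left T. D x \<ge> 0"
      using eventually_at_left_real[OF \<open>T > x0\<close>] by eventually_elim (use less in auto)
    ultimately show ?thesis by (intro tendsto_lowerbound) auto
  qed (use ini in simp)
  have upto: "D x \<ge> 0" if "x0 \<le> x" "x \<le> T" for x using less[of x] DT that by (cases "x = T") auto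
  have sub: "{x0..T} \<subseteq> {x0..x1}" using T by auto
  have "A x0 \<le> A T" "B x0 \<le> B T"
    by (rule Icc_left_deriv_nonneg_imp_le[of x0 T x0]; use T upto dA dB continuous_on_subset[OF cA sub] continuous_on_subset[OF cB sub] in auto)+
  then have AB: "A T > 0" "B T > 0" using ini by auto
  have "T = x1"
  proof (rule ccontr)
    assume "T \<noteq> x1"
    then have Tx: "T < x1" using T by simp
    have "(A \<longlongrightarrow> A T) (at T within {x0..x1})" "(B \<longlongrightarrow> B T) (at T within {x0..x1})"
      using cA cB T by (auto simp: continuous_on_def)
    then have "\<forall>\<^sub>F x in at T within {x0..x1}. A x > 0 \<and> B x > 0"
      using AB by (intro eventually_conj) (auto dest: order_tendstoD(1))
    then obtain \<delta> where \<delta>: "\<delta> > 0" "\<And>x. x \<in> {x0..x1} \<Longrightarrow> x \<noteq> T \<Longrightarrow> dist x T < \<delta> \<Longrightarrow> A x > 0 \<and> B x > 0"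
      unfolding eventually_at by auto
    define w where "w = min x1 (T + \<delta> / 2)"
    have w: "T < w" "w \<le> x1" "w < T + \<delta>" using Tx \<delta> by (auto simp: w_def)
    have ABw: "A x > 0 \<and> B x > 0" if "T < x" "x \<le> w" for x
      using \<delta>(2)[of x] that w T by (auto simp: dist_real_def)
    have "w \<notin> G" using cSup_upper[OF _ bdd, of w] w unfolding T_def by auto
    then obtain x where x: "x0 \<le> x" "x \<le> w" "D x < 0" using w T by (auto simp: G_def not_le)
    then have Tlx: "T < x" using upto[of x] by force
    define P where "P = {t \<in> {T..x}. 0 \<le> D t}"
    have "closed P" unfolding P_def
      by (intro continuous_on_closed_Collect_le continuous_on_const continuous_on_subset[OF cD] closed_atLeastAtMost) (use T w x in auto)
    moreover have TP: "T \<in> P" using DT Tlx by (auto simp: P_def)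
    moreover have bP: "bdd_above P" by (auto simp: P_def)
    ultimately have "Sup P \<in> P" by (intro closed_contains_Sup) auto
    define T' where "T' = Sup P"
    have T': "T \<le> T'" "T' \<le> x" "D T' \<ge> 0" using \<open>Sup P \<in> P\<close> by (auto simp: T'_def P_def)
    have neg: "D t < 0" if "T' < t" "t \<le> x" for t
    proof (rule ccontr)
      assume "\<not> D t < 0"
      then have "t \<in> P" using that T' by (auto simp: P_def)
      then have "t \<le> T'" unfolding T'_def using bP by (rule cSup_upper)
      then show False using that by simp
    qed
    \<comment> \<open>The exponential weight turns \<open>D' \<ge> C * D\<close> into monotonicity
      from the last point \<open>T'\<close> with \<open>D \<ge> 0\<close> up to
      \<open>x\<close>.\<close>
    have "D T' * exp (- C * T') \<le> D x * exp (- C * x)"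
    proof (rule Icc_left_deriv_nonneg_imp_le[of T' x x0])
      show "continuous_on {T'..x} (\<lambda>t. D t * exp (- C * t))"
        by (intro continuous_intros continuous_on_subset[OF cD]) (use T' T w x in auto)
      fix t assume t: "T' < t" "t \<le> x"
      obtain d where d: "d \<ge> C * D t" "(D has_real_derivative d) (at t within {x0..t})"
        using dD[of t] neg[OF t] ABw[of t] t T' T w x by auto
      have "((\<lambda>t. D t * exp (- C * t)) has_real_derivative (d - C * D t) * exp (- C * t)) (at t within {x0..t})"
        by (auto intro!: derivative_eq_intros d simp: algebra_simps)
      then show "\<exists>d\<ge>0. ((\<lambda>t. D t * exp (- C * t)) has_real_derivative d) (at t within {x0..t})"
        using d(1) by (intro exI[of _ "(d - C * D t) * exp (- C * t)"]) auto
    qed (use T T' in auto)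
    moreover have "D x * exp (- C * x) < 0" using x by (simp add: mult_neg_pos)
    moreover have "D T' * exp (- C * T') \<ge> 0" using T' by simp
    ultimately show False by linarith
  qed
  then show ?thesis using DT AB by simp
qed

lemma DERIV_inverse_open:
  fixes f :: "real \<Rightarrow> real"
  assumes "open S" "x \<in> S" "continuous_on S f" "\<And>x. x \<in> S \<Longrightarrow> g (f x) = x"
    and "(f has_real_derivative D) (at x)" "D \<noteq> 0"
  shows "(g has_real_derivative 1 / D) (at (f x))"
  unfolding has_field_derivative_def
  by (rule has_derivative_inverse_strong[OF assms(1-4) assms(5)[unfolded has_field_derivative_def]])
     (use assms(6) in \<open>auto simp: fun_eq_iff\<close>)

lemma decreasing_inverse:
  fixes \<beta> \<beta>' :: "real \<Rightarrow> real"
  assumes der: "\<And>s. l < s \<Longrightarrow> s < r \<Longrightarrow> (\<beta> has_real_derivative \<beta>' s) (at s)"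
    and neg: "\<And>s. l < s \<Longrightarrow> s < r \<Longrightarrow> \<beta>' s < 0"
  obtains S where "\<And>s. l < s \<Longrightarrow> s < r \<Longrightarrow> S (\<beta> s) = s"
    and "\<And>s. l < s \<Longrightarrow> s < r \<Longrightarrow> (S has_real_derivative 1 / \<beta>' s) (at (\<beta> s))"
    and "\<And>s t x. l < s \<Longrightarrow> s \<le> t \<Longrightarrow> t < r \<Longrightarrow> \<beta> t \<le> x \<Longrightarrow> x \<le> \<beta> s \<Longrightarrow> s \<le> S x \<and> S x \<le> t \<and> \<beta> (S x) = x"
    and "\<And>s t. l < s \<Longrightarrow> s < t \<Longrightarrow> t < r \<Longrightarrow> \<beta> t < \<beta> s"
proof -
  have dec: "\<beta> t < \<beta> s" if "l < s" "s < t" "t < r" for s t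
    by (rule DERIV_neg_imp_decreasing[OF that(2)]) (use that der neg in \<open>meson order.strict_trans1 order.strict_trans2\<close>)
  have inj: "inj_on \<beta> {l<..<r}"
    by (rule linorder_inj_onI) (use dec in force)+
  have cont: "continuous_on {l<..<r} \<beta>"
    by (rule continuous_at_imp_continuous_on) (use DERIV_isCont[OF der] in auto)
  define S where "S = inv_into {l<..<r} \<beta>"
  have S: "S (\<beta> s) = s" if "l < s" "s < r" for s
    unfolding S_def using that inj by (intro inv_into_f_f) auto
  show thesis
  proof (rule that[of S])
    show "(S has_real_derivative 1 / \<beta>' s) (at (\<beta> s))" if "l < s" "s < r" for s
      by (rule DERIV_inverse_open[where S="{l<..<r}"]) (use that der neg[of s] cont S in auto)
    show "s \<le> S x \<and> S x \<le> t \<and> \<beta> (S x) = x" if st: "l < s" "s \<le> t" "t < r" "\<beta> t \<le> x" "x \<le> \<beta> s" for s t x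
    proof -
      have "continuous_on {s..t} \<beta>" by (rule continuous_on_subset[OF cont]) (use st in auto)
      then obtain w where w: "s \<le> w" "w \<le> t" "\<beta> w = x" using IVT2'[of \<beta> t x s] st by blast
      then show ?thesis using S[of w] st by auto
    qed
  qed (use S dec in auto)
qed

text \<open>What the phase plane sees of the problem. For the equation,
  \<open>kap r = r powr p * K r\<close>, \<open>m r = p + r K' / K\<close> is its logarithmic
  derivative, \<open>mh = (n - p) / (p - 1)\<close>, and \<open>J r\<close> is
  \<open>r powr (p - n)\<close> times the integral of \<open>t ^ (n - 1) * K t\<close> over
  \<open>(0, r)\<close>. Thus \<open>kap / J\<close> is the quotient of \<open>r ^ n * K r\<close>
  and that integral. \<open>g\<close> is the elasticity of \<open>f\<close> from the right.\<close>

locale profile_system =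
  fixes p mh u0 :: real and kap m J f g :: "real \<Rightarrow> real"
  assumes p: "p > 1" and mh: "mh > 0" and u0: "u0 > 0"
    and kap_pos: "r > 0 \<Longrightarrow> kap r > 0"
    and kap_deriv: "r > 0 \<Longrightarrow> (kap has_real_derivative m r * kap r / r) (at r)"
    and m_pos: "r > 0 \<Longrightarrow> m r > 0"
    and m_antimono: "0 < r \<Longrightarrow> r \<le> r' \<Longrightarrow> m r' \<le> m r"
    and J_pos: "r > 0 \<Longrightarrow> J r > 0"
    and J_mono: "0 < r \<Longrightarrow> r \<le> r' \<Longrightarrow> J r \<le> J r'"
    and kap_J_antimono: "0 < r \<Longrightarrow> r \<le> r' \<Longrightarrow> kap r' / J r' \<le> kap r / J r"
    and kap_J_ge: "r > 0 \<Longrightarrow> kap r / J r \<ge> (p - 1) * mh + m r"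
    and f_cont: "continuous_on {0..} f"
    and f_pos: "s > u0 \<Longrightarrow> f s > 0"
    and f_nonpos: "0 < s \<Longrightarrow> s \<le> u0 \<Longrightarrow> f s \<le> 0"
    and f_deriv: "s > u0 \<Longrightarrow> (f has_real_derivative g s * f s / s) (at s within {s..})"
    and g_gt: "s > u0 \<Longrightarrow> g s > p - 1"
    and g_antimono: "u0 < s \<Longrightarrow> s \<le> t \<Longrightarrow> g t \<le> g s"
    and f_ratio_mono: "u0 < s \<Longrightarrow> s \<le> t \<Longrightarrow> f s / (s - u0) powr (p - 1) \<le> f t / (t - u0) powr (p - 1)"
begin

text \<open>The differential equations alone forget the two ends of the solution, with
  \<open>\<alpha> = u 0\<close>. The bounds by \<open>J\<close> keep what follows from integrating
  the equation from \<open>r = 0\<close>; the last clause, that \<open>z\<close> is not bounded away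
  from 0 near level 0, keeps the fact that \<open>u\<close> never becomes negative.\<close>

definition profile :: "(real \<Rightarrow> real) \<Rightarrow> (real \<Rightarrow> real) \<Rightarrow> real \<Rightarrow> bool" where
  "profile \<rho> z \<alpha> \<longleftrightarrow> \<alpha> > u0 \<and>
     (\<forall>s\<in>{0<..<\<alpha>}. \<rho> s > 0 \<and> z s > 0 \<and> (\<rho> has_real_derivative - \<rho> s / z s) (at s) \<and>
        (z has_real_derivative mh - kap (\<rho> s) * f s * z s powr (1 - p) / (p - 1)) (at s)) \<and>
     (z \<longlongrightarrow> 0) (at_left \<alpha>) \<and>
     (\<forall>s\<in>{u0<..<\<alpha>}. f s * J (\<rho> s) \<le> z s powr (p - 1) \<and> z s powr (p - 1) \<le> f \<alpha> * J (\<rho> s)) \<and>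
     \<not> (\<exists>d>0. \<exists>e>0. \<forall>s\<in>{0<..<e}. d \<le> z s)"

lemma profileD:
  assumes "profile \<rho> z \<alpha>" "0 < s" "s < \<alpha>"
  shows "\<rho> s > 0" "z s > 0" "(\<rho> has_real_derivative - \<rho> s / z s) (at s)"
    "(z has_real_derivative mh - kap (\<rho> s) * f s * z s powr (1 - p) / (p - 1)) (at s)"
  using assms unfolding profile_def by auto

lemma profile_cont:
  assumes "profile \<rho> z \<alpha>" "0 < s" "s < \<alpha>"
  shows "isCont \<rho> s" "isCont z s" "isCont (\<lambda>s. kap (\<rho> s)) s" "isCont f s"
proof -
  note P = profileD[OF assms]
  show r: "isCont \<rho> s" "isCont z s" using P(3,4) DERIV_isCont by blast+
  have "isCont kap (\<rho> s)" using kap_deriv[OF P(1)] DERIV_isCont by blast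
  then show "isCont (\<lambda>s. kap (\<rho> s)) s" by (rule isCont_o2[OF r(1)])
  show "isCont f s" by (rule continuous_on_interior[OF f_cont]) (use assms in simp)
qed

lemma profile_rho_antimono:
  assumes "profile \<rho> z \<alpha>" "0 < s" "s < t" "t < \<alpha>"
  shows "\<rho> t < \<rho> s"
proof (rule DERIV_neg_imp_decreasing[OF assms(3)])
  fix x assume x: "s \<le> x" "x \<le> t"
  then have "0 < x" "x < \<alpha>" using assms by auto
  note P = profileD[OF assms(1) this]
  show "\<exists>y. (\<rho> has_real_derivative y) (at x) \<and> y < 0" using P by (intro exI[of _ "- \<rho> x / z x"]) auto
qed

text \<open>In the logarithmic radius \<open>beta\<close> has derivative \<open>beta * zeta\<close>, and \<open>yy\<close> is the
  reaction term; both are invariant under the scaling \<open>u(r) \<mapsto> \<lambda> u(\<mu> r)\<close>.\<close>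

definition yy :: "(real \<Rightarrow> real) \<Rightarrow> real \<Rightarrow> real" where
  "yy \<rho> s = kap (\<rho> s) * f s / s powr (p - 1)"

definition zeta :: "(real \<Rightarrow> real) \<Rightarrow> (real \<Rightarrow> real) \<Rightarrow> real \<Rightarrow> real" where
  "zeta \<rho> z s = z s / s - mh + kap (\<rho> s) * f s * z s powr (1 - p) / (p - 1)"

text \<open>At equal values of \<open>z / s\<close>, \<open>zeta\<close> is an increasing function
  of \<open>yy\<close> alone; so \<open>yy\<close> decides which of two orbits has the larger
  \<open>zeta\<close>.\<close>

lemma zeta_yy:
  assumes "s > 0" "z s > 0"
  shows "zeta \<rho> z s = z s / s - mh + yy \<rho> s * (z s / s) powr (1 - p) / (p - 1)"
proof -
  have "(z s / s) powr (1 - p) = z s powr (1 - p) * s powr (p - 1)"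
    using assms by (simp add: powr_divide powr_diff field_simps)
  then show ?thesis using assms unfolding zeta_def yy_def by simp
qed

lemma beta_deriv:
  assumes "profile \<rho> z \<alpha>" "0 < s" "s < \<alpha>"
  shows "((\<lambda>s. z s / s) has_real_derivative - zeta \<rho> z s / s) (at s)"
  unfolding zeta_def using assms profileD[OF assms]
  by (auto intro!: derivative_eq_intros simp: field_simps power2_eq_square)

lemma zeta_cont:
  assumes "profile \<rho> z \<alpha>" "0 < s" "s < \<alpha>"
  shows "isCont (zeta \<rho> z) s"
proof -
  have "zeta \<rho> z = (\<lambda>s. z s / s - mh + kap (\<rho> s) * f s * z s powr (1 - p) / (p - 1))"
    by (auto simp: zeta_def)
  then show ?thesis
    using profile_cont[OF assms] profileD(2)[OF assms] assms p
    by (auto intro!: continuous_intros)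
qed

lemma yy_pos: "profile \<rho> z \<alpha> \<Longrightarrow> u0 < s \<Longrightarrow> s < \<alpha> \<Longrightarrow> yy \<rho> s > 0"
  unfolding yy_def using profileD(1)[of \<rho> z \<alpha> s] kap_pos f_pos u0 by simp

lemma yy_cont:
  assumes "profile \<rho> z \<alpha>" "0 < s" "s < \<alpha>"
  shows "isCont (yy \<rho>) s"
proof -
  have "yy \<rho> = (\<lambda>s. kap (\<rho> s) * f s / s powr (p - 1))" by (auto simp: yy_def)
  then show ?thesis using profile_cont[OF assms] assms by (auto intro!: continuous_intros)
qed

text \<open>In the logarithm the effects of radius and level separate into a term with
  \<open>m\<close> and a term with \<open>g\<close>. The derivative is one-sided because that of
  \<open>f\<close> is.\<close>

lemma ln_yy_deriv:
  assumes P: "profile \<rho> z \<alpha>" and s: "u0 < s" "s < \<alpha>"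
  shows "((\<lambda>s. ln (yy \<rho> s)) has_real_derivative - m (\<rho> s) / z s + (g s - (p - 1)) / s) (at s within {s..})"
proof -
  have s0: "s > 0" using s u0 by simp
  note Q = profileD[OF P s0 s(2)]
  have "((\<lambda>s. ln (kap (\<rho> s)) + ln (f s) - (p - 1) * ln s) has_real_derivative
     m (\<rho> s) * kap (\<rho> s) / \<rho> s * (- \<rho> s / z s) * inverse (kap (\<rho> s)) + g s * f s / s * inverse (f s) - (p - 1) * (1 / s)) (at s within {s..})"
    using Q s0 f_pos[OF s(1)] kap_pos[OF Q(1)]
    by (auto intro!: derivative_eq_intros DERIV_chain'[OF _ kap_deriv] f_deriv[OF s(1)] has_field_derivative_at_within[OF Q(3)] simp: divide_inverse)
  moreover have "m (\<rho> s) * kap (\<rho> s) / \<rho> s * (- \<rho> s / z s) * inverse (kap (\<rho> s)) + g s * f s / s * inverse (f s) - (p - 1) * (1 / s)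
     = - m (\<rho> s) / z s + (g s - (p - 1)) / s"
    using Q s0 f_pos[OF s(1)] kap_pos[OF Q(1)] by (simp add: field_simps)
  ultimately have "((\<lambda>s. ln (kap (\<rho> s)) + ln (f s) - (p - 1) * ln s) has_real_derivative - m (\<rho> s) / z s + (g s - (p - 1)) / s) (at s within {s..})"
    by simp
  then show ?thesis
  proof (rule has_field_derivative_transform_within)
    show "0 < \<alpha> - s" using s by simp
    fix x assume x: "x \<in> {s..}" "dist x s < \<alpha> - s"
    then have "u0 < x" "x < \<alpha>" "x > 0" using s u0 by (auto simp: dist_real_def)
    then show "ln (kap (\<rho> x)) + ln (f x) - (p - 1) * ln x = ln (yy \<rho> x)"
      unfolding yy_def using kap_pos[OF profileD(1)[OF P]] f_pos
      by (simp add: ln_mult ln_div ln_powr less_imp_neq[symmetric])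
  qed (use s in auto)
qed

text \<open>Where \<open>zeta > 0\<close>, the quotient \<open>z / s\<close> decreases in the level
  and can replace it as independent variable. The inverse \<open>S\<close> reverses the order, so
  right derivatives in the level become left derivatives in \<open>x\<close>; this is why the last
  claim is stated within \<open>{z t / t..x}\<close>.\<close>

lemma arc_inverse:
  assumes P: "profile \<rho> z \<alpha>" and I: "u0 \<le> l" "r \<le> \<alpha>" "\<And>s. l < s \<Longrightarrow> s < r \<Longrightarrow> zeta \<rho> z s > 0"
  obtains S where "\<And>s. l < s \<Longrightarrow> s < r \<Longrightarrow> S (z s / s) = s"
    and "\<And>s. l < s \<Longrightarrow> s < r \<Longrightarrow> (S has_real_derivative - (s / zeta \<rho> z s)) (at (z s / s))"
    and "\<And>s t x. l < s \<Longrightarrow> s \<le> t \<Longrightarrow> t < r \<Longrightarrow> z t / t \<le> x \<Longrightarrow> x \<le> z s / s \<Longrightarrow> s \<le> S x \<and> S x \<le> t \<and> z (S x) / S x = x"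
    and "\<And>s t. l < s \<Longrightarrow> s < t \<Longrightarrow> t < r \<Longrightarrow> z t / t < z s / s"
    and "\<And>s t x. l < s \<Longrightarrow> s \<le> t \<Longrightarrow> t < r \<Longrightarrow> z t / t \<le> x \<Longrightarrow> x \<le> z s / s \<Longrightarrow>
      ((\<lambda>x. ln (yy \<rho> (S x))) has_real_derivative (m (\<rho> (S x)) / x - (g (S x) - (p - 1))) / zeta \<rho> z (S x)) (at x within {z t / t..x})"
proof -
  have pos: "s > 0" "s < \<alpha>" "s > u0" if "l < s" "s < r" for s using that I u0 by auto
  have der: "((\<lambda>s. z s / s) has_real_derivative - zeta \<rho> z s / s) (at s)" "- zeta \<rho> z s / s < 0" if "l < s" "s < r" for s
    using beta_deriv[OF P pos(1,2)[OF that]] I(3)[OF that] pos[OF that] by auto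
  obtain S where S: "\<And>s. l < s \<Longrightarrow> s < r \<Longrightarrow> S (z s / s) = s"
    "\<And>s. l < s \<Longrightarrow> s < r \<Longrightarrow> (S has_real_derivative 1 / (- zeta \<rho> z s / s)) (at (z s / s))"
    "\<And>s t x. l < s \<Longrightarrow> s \<le> t \<Longrightarrow> t < r \<Longrightarrow> z t / t \<le> x \<Longrightarrow> x \<le> z s / s \<Longrightarrow> s \<le> S x \<and> S x \<le> t \<and> z (S x) / S x = x"
    "\<And>s t. l < s \<Longrightarrow> s < t \<Longrightarrow> t < r \<Longrightarrow> z t / t < z s / s"
    using decreasing_inverse[of l r "\<lambda>s. z s / s" "\<lambda>s. - zeta \<rho> z s / s", OF der] by blast
  have dS: "(S has_real_derivative - (s / zeta \<rho> z s)) (at (z s / s))" if "l < s" "s < r" for s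
    using S(2)[OF that] by simp
  have dY: "((\<lambda>x. ln (yy \<rho> (S x))) has_real_derivative (m (\<rho> (S x)) / x - (g (S x) - (p - 1))) / zeta \<rho> z (S x)) (at x within {z t / t..x})"
    if st: "l < s" "s \<le> t" "t < r" and x: "z t / t \<le> x" "x \<le> z s / s" for s t x
  proof -
    have T: "s \<le> S w \<and> S w \<le> t \<and> z (S w) / S w = w" if "z t / t \<le> w" "w \<le> z s / s" for w
      using S(3)[OF st that] .
    have R: "l < S w" "S w < r" if "z t / t \<le> w" "w \<le> z s / s" for w
      using T[OF that] st by auto
    note Rx = R[OF x] and Tx = T[OF x]
    note px = pos[OF Rx]
    have e1: "z (S x) = x * S x" using Tx px by (auto simp: field_simps)
    have xp: "x > 0" using profileD(2)[OF P px(1,2)] px(1) unfolding e1 by (simp add: zero_less_mult_iff)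
    have sub: "S ` {z t / t..x} \<subseteq> {S x..}"
    proof clarsimp
      fix w assume w: "z t / t \<le> w" "w \<le> x"
      then have w': "z t / t \<le> w" "w \<le> z s / s" using x by auto
      show "S x \<le> S w"
      proof (rule ccontr)
        assume "\<not> S x \<le> S w"
        then have "z (S x) / S x < z (S w) / S w" using S(4)[of "S w" "S x"] Rx R[OF w'] by auto
        then show False using Tx T[OF w'] w by auto
      qed
    qed
    have dSx: "(S has_real_derivative - (S x / zeta \<rho> z (S x))) (at x)" using dS[OF Rx] Tx by simp
    have "((\<lambda>s. ln (yy \<rho> s)) \<circ> S has_real_derivative (- m (\<rho> (S x)) / z (S x) + (g (S x) - (p - 1)) / S x) * (- (S x / zeta \<rho> z (S x)))) (at x within {z t / t..x})"
      by (rule DERIV_image_chain[OF has_field_derivative_subset[OF ln_yy_deriv[OF P px(3,2)] sub] has_field_derivative_at_within[OF dSx]])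
    moreover have "(- m (\<rho> (S x)) / z (S x) + (g (S x) - (p - 1)) / S x) * (- (S x / zeta \<rho> z (S x))) = (m (\<rho> (S x)) / x - (g (S x) - (p - 1))) / zeta \<rho> z (S x)"
      unfolding e1 using px(1) I(3)[OF Rx] xp by (simp add: field_simps)
    ultimately show ?thesis unfolding o_def by simp
  qed
  show thesis by (rule that[OF S(1) dS S(3,4) dY])
qed

text \<open>An application of \<open>barrier\<close> with \<open>x = z / s\<close> as variable and
  the logarithms of the quotients of \<open>yy\<close>, of the radii and of the levels as
  \<open>D\<close>, \<open>A\<close> and \<open>B\<close>. If \<open>D \<ge> 0\<close>, orbit 1 has
  the larger \<open>zeta\<close>, so its level and radius change more slowly in \<open>x\<close> and
  both gaps widen. While the gaps are open, the monotonicity of \<open>m\<close> and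
  \<open>g\<close> favours orbit 1 in the growth of \<open>yy\<close>.\<close>

lemma comparison:
  assumes P1: "profile \<rho>1 z1 \<alpha>1" and I1: "u0 \<le> l1" "r1 \<le> \<alpha>1" "\<And>s. l1 < s \<Longrightarrow> s < r1 \<Longrightarrow> zeta \<rho>1 z1 s > 0"
    and P2: "profile \<rho>2 z2 \<alpha>2" and I2: "u0 \<le> l2" "r2 \<le> \<alpha>2" "\<And>s. l2 < s \<Longrightarrow> s < r2 \<Longrightarrow> zeta \<rho>2 z2 s > 0"
    and s: "l1 < s1" "s1 < r1" "l2 < s2" "s2 < r2" "z1 s1 / s1 = z2 s2 / s2"
    and ini: "s2 < s1" "\<rho>1 s1 < \<rho>2 s2" "yy \<rho>2 s2 \<le> yy \<rho>1 s1"
    and t: "l1 < t1" "t1 < r1" "l2 < t2" "t2 < r2" "z1 t1 / t1 = z2 t2 / t2" "z1 s1 / s1 \<le> z1 t1 / t1"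
  shows "t2 < t1 \<and> \<rho>1 t1 < \<rho>2 t2 \<and> yy \<rho>2 t2 \<le> yy \<rho>1 t1"
proof -
  have pos1: "s > 0" "s < \<alpha>1" "s > u0" if "l1 < s" "s < r1" for s using that I1 u0 by auto
  have pos2: "s > 0" "s < \<alpha>2" "s > u0" if "l2 < s" "s < r2" for s using that I2 u0 by auto
  obtain S1 where S1: "\<And>s. l1 < s \<Longrightarrow> s < r1 \<Longrightarrow> S1 (z1 s / s) = s"
    "\<And>s. l1 < s \<Longrightarrow> s < r1 \<Longrightarrow> (S1 has_real_derivative - (s / zeta \<rho>1 z1 s)) (at (z1 s / s))"
    "\<And>s t x. l1 < s \<Longrightarrow> s \<le> t \<Longrightarrow> t < r1 \<Longrightarrow> z1 t / t \<le> x \<Longrightarrow> x \<le> z1 s / s \<Longrightarrow> s \<le> S1 x \<and> S1 x \<le> t \<and> z1 (S1 x) / S1 x = x"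
    "\<And>s t. l1 < s \<Longrightarrow> s < t \<Longrightarrow> t < r1 \<Longrightarrow> z1 t / t < z1 s / s"
    "\<And>s t x. l1 < s \<Longrightarrow> s \<le> t \<Longrightarrow> t < r1 \<Longrightarrow> z1 t / t \<le> x \<Longrightarrow> x \<le> z1 s / s \<Longrightarrow>
      ((\<lambda>x. ln (yy \<rho>1 (S1 x))) has_real_derivative (m (\<rho>1 (S1 x)) / x - (g (S1 x) - (p - 1))) / zeta \<rho>1 z1 (S1 x)) (at x within {z1 t / t..x})"
    by (rule arc_inverse[OF P1 I1]) blast+
  obtain S2 where S2: "\<And>s. l2 < s \<Longrightarrow> s < r2 \<Longrightarrow> S2 (z2 s / s) = s"
    "\<And>s. l2 < s \<Longrightarrow> s < r2 \<Longrightarrow> (S2 has_real_derivative - (s / zeta \<rho>2 z2 s)) (at (z2 s / s))"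
    "\<And>s t x. l2 < s \<Longrightarrow> s \<le> t \<Longrightarrow> t < r2 \<Longrightarrow> z2 t / t \<le> x \<Longrightarrow> x \<le> z2 s / s \<Longrightarrow> s \<le> S2 x \<and> S2 x \<le> t \<and> z2 (S2 x) / S2 x = x"
    "\<And>s t. l2 < s \<Longrightarrow> s < t \<Longrightarrow> t < r2 \<Longrightarrow> z2 t / t < z2 s / s"
    "\<And>s t x. l2 < s \<Longrightarrow> s \<le> t \<Longrightarrow> t < r2 \<Longrightarrow> z2 t / t \<le> x \<Longrightarrow> x \<le> z2 s / s \<Longrightarrow>
      ((\<lambda>x. ln (yy \<rho>2 (S2 x))) has_real_derivative (m (\<rho>2 (S2 x)) / x - (g (S2 x) - (p - 1))) / zeta \<rho>2 z2 (S2 x)) (at x within {z2 t / t..x})"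
    by (rule arc_inverse[OF P2 I2]) blast+
  define x0 where "x0 = z1 s1 / s1"
  define x1 where "x1 = z1 t1 / t1"
  have x01: "x0 \<le> x1" using t unfolding x0_def x1_def by simp
  have x0p: "x0 > 0" unfolding x0_def using profileD(2)[OF P1, of s1] pos1[of s1] s(1,2) by simp
  have ts1: "t1 \<le> s1" using S1(4)[of s1 t1] s t by force
  have ts2: "t2 \<le> s2" using S2(4)[of s2 t2] s t by force
  have T1: "t1 \<le> S1 x \<and> S1 x \<le> s1 \<and> z1 (S1 x) / S1 x = x" if "x0 \<le> x" "x \<le> x1" for x
    using S1(3)[of t1 s1 x] that s t ts1 unfolding x0_def x1_def by auto
  have T2: "t2 \<le> S2 x \<and> S2 x \<le> s2 \<and> z2 (S2 x) / S2 x = x" if "x0 \<le> x" "x \<le> x1" for x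
    using S2(3)[of t2 s2 x] that s t ts2 unfolding x0_def x1_def by auto
  have R1: "l1 < S1 x" "S1 x < r1" "S1 x > 0" "S1 x < \<alpha>1" "S1 x > u0" if "x0 \<le> x" "x \<le> x1" for x
    using T1[OF that] s t pos1[of "S1 x"] by auto
  have R2: "l2 < S2 x" "S2 x < r2" "S2 x > 0" "S2 x < \<alpha>2" "S2 x > u0" if "x0 \<le> x" "x \<le> x1" for x
    using T2[OF that] s t pos2[of "S2 x"] by auto
  define \<zeta>1 where "\<zeta>1 x = zeta \<rho>1 z1 (S1 x)" for x
  define \<zeta>2 where "\<zeta>2 x = zeta \<rho>2 z2 (S2 x)" for x
  have z1p: "\<zeta>1 x > 0" if "x0 \<le> x" "x \<le> x1" for x using I1(3) R1[OF that] unfolding \<zeta>1_def by simp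
  have z2p: "\<zeta>2 x > 0" if "x0 \<le> x" "x \<le> x1" for x using I2(3) R2[OF that] unfolding \<zeta>2_def by simp
  have dS1: "(S1 has_real_derivative - (S1 x / \<zeta>1 x)) (at x)" if "x0 \<le> x" "x \<le> x1" for x
    using S1(2)[OF R1(1,2)[OF that]] T1[OF that] unfolding \<zeta>1_def by simp
  have dS2: "(S2 has_real_derivative - (S2 x / \<zeta>2 x)) (at x)" if "x0 \<le> x" "x \<le> x1" for x
    using S2(2)[OF R2(1,2)[OF that]] T2[OF that] unfolding \<zeta>2_def by simp
  have cS1: "isCont S1 x" if "x0 \<le> x" "x \<le> x1" for x using DERIV_isCont[OF dS1[OF that]] .
  have cS2: "isCont S2 x" if "x0 \<le> x" "x \<le> x1" for x using DERIV_isCont[OF dS2[OF that]] .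
  have cz1: "isCont \<zeta>1 x" if "x0 \<le> x" "x \<le> x1" for x
    unfolding \<zeta>1_def using isCont_o2[OF cS1[OF that] zeta_cont[OF P1 R1(3,4)[OF that]]] .
  have cz2: "isCont \<zeta>2 x" if "x0 \<le> x" "x \<le> x1" for x
    unfolding \<zeta>2_def using isCont_o2[OF cS2[OF that] zeta_cont[OF P2 R2(3,4)[OF that]]] .
  define Y1 where "Y1 x = yy \<rho>1 (S1 x)" for x
  define Y2 where "Y2 x = yy \<rho>2 (S2 x)" for x
  have cY1: "isCont Y1 x" if "x0 \<le> x" "x \<le> x1" for x
    unfolding Y1_def using isCont_o2[OF cS1[OF that] yy_cont[OF P1 R1(3,4)[OF that]]] .
  have cY2: "isCont Y2 x" if "x0 \<le> x" "x \<le> x1" for x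
    unfolding Y2_def using isCont_o2[OF cS2[OF that] yy_cont[OF P2 R2(3,4)[OF that]]] .
  have Y1p: "Y1 x > 0" if "x0 \<le> x" "x \<le> x1" for x unfolding Y1_def using yy_pos[OF P1] R1[OF that] by simp
  have Y2p: "Y2 x > 0" if "x0 \<le> x" "x \<le> x1" for x unfolding Y2_def using yy_pos[OF P2] R2[OF that] by simp
  have zY1: "\<zeta>1 x = x - mh + Y1 x * x powr (1 - p) / (p - 1)" if "x0 \<le> x" "x \<le> x1" for x
    using zeta_yy[of "S1 x" z1 \<rho>1] R1[OF that] profileD(2)[OF P1] T1[OF that] unfolding \<zeta>1_def Y1_def by simp
  have zY2: "\<zeta>2 x = x - mh + Y2 x * x powr (1 - p) / (p - 1)" if "x0 \<le> x" "x \<le> x1" for x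
    using zeta_yy[of "S2 x" z2 \<rho>2] R2[OF that] profileD(2)[OF P2] T2[OF that] unfolding \<zeta>2_def Y2_def by simp
  define D where "D x = ln (Y1 x) - ln (Y2 x)" for x
  define A where "A x = ln (\<rho>2 (S2 x)) - ln (\<rho>1 (S1 x))" for x
  define B where "B x = ln (S1 x) - ln (S2 x)" for x
  \<comment> \<open>\<open>Q x\<close> is the factor in the bound of
    \<open>1 / \<zeta>1 x - 1 / \<zeta>2 x\<close> by \<open>- D x\<close>. Its maximum
    \<open>M\<close>, multiplied by the bound \<open>g t2\<close> for the elasticity, is the
    Gronwall constant \<open>C\<close>.\<close>
  define Q where "Q x = Y2 x * x powr (1 - p) / ((p - 1) * \<zeta>1 x * \<zeta>2 x)" for x
  have contI: "continuous_on {x0..x1} F" if "\<And>x. x0 \<le> x \<Longrightarrow> x \<le> x1 \<Longrightarrow> isCont F x" for F :: "real \<Rightarrow> real"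
    using that by (intro continuous_at_imp_continuous_on) auto
  have "continuous_on {x0..x1} Q"
  proof (rule contI)
    fix x assume x: "x0 \<le> x" "x \<le> x1"
    show "isCont Q x" unfolding Q_def
      using cY2[OF x] cz1[OF x] cz2[OF x] z1p[OF x] z2p[OF x] x x0p p by (auto intro!: continuous_intros)
  qed
  then have "\<exists>w\<in>{x0..x1}. \<forall>x\<in>{x0..x1}. Q x \<le> Q w"
    using x01 by (intro continuous_attains_sup) auto
  then obtain M where M: "\<And>x. x0 \<le> x \<Longrightarrow> x \<le> x1 \<Longrightarrow> Q x \<le> M" by force
  define C where "C = g t2 * M"
  have dA: "(A has_real_derivative (1 / x) * (1 / \<zeta>2 x - 1 / \<zeta>1 x)) (at x within {x0..x})" if x: "x0 \<le> x" "x \<le> x1" for x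
  proof -
    note Q1 = profileD[OF P1 R1(3,4)[OF x]] and Q2 = profileD[OF P2 R2(3,4)[OF x]]
    have e1: "z1 (S1 x) = x * S1 x" "z2 (S2 x) = x * S2 x" using T1[OF x] T2[OF x] R1(3)[OF x] R2(3)[OF x] by (auto simp: field_simps)
    have "(A has_real_derivative 1 / \<rho>2 (S2 x) * ((- \<rho>2 (S2 x) / z2 (S2 x)) * (- (S2 x / \<zeta>2 x))) -
        1 / \<rho>1 (S1 x) * ((- \<rho>1 (S1 x) / z1 (S1 x)) * (- (S1 x / \<zeta>1 x)))) (at x)"
      unfolding A_def
      by (intro DERIV_diff DERIV_chain'[OF DERIV_chain'[OF dS2[OF x] Q2(3)] DERIV_ln_divide[OF Q2(1)]]
           DERIV_chain'[OF DERIV_chain'[OF dS1[OF x] Q1(3)] DERIV_ln_divide[OF Q1(1)]])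
    moreover have "1 / \<rho>2 (S2 x) * ((- \<rho>2 (S2 x) / z2 (S2 x)) * (- (S2 x / \<zeta>2 x))) -
        1 / \<rho>1 (S1 x) * ((- \<rho>1 (S1 x) / z1 (S1 x)) * (- (S1 x / \<zeta>1 x))) = (1 / x) * (1 / \<zeta>2 x - 1 / \<zeta>1 x)"
      using Q1 Q2 z1p[OF x] z2p[OF x] R1(3)[OF x] R2(3)[OF x] x x0p unfolding e1 by (simp add: field_simps)
    ultimately show ?thesis by (simp add: has_field_derivative_at_within)
  qed
  have dB: "(B has_real_derivative (1 / \<zeta>2 x - 1 / \<zeta>1 x)) (at x within {x0..x})" if x: "x0 \<le> x" "x \<le> x1" for x
  proof -
    have "(B has_real_derivative 1 / S1 x * (- (S1 x / \<zeta>1 x)) - 1 / S2 x * (- (S2 x / \<zeta>2 x))) (at x)"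
      unfolding B_def by (intro DERIV_diff DERIV_chain'[OF dS1[OF x] DERIV_ln_divide[OF R1(3)[OF x]]] DERIV_chain'[OF dS2[OF x] DERIV_ln_divide[OF R2(3)[OF x]]])
    moreover have "1 / S1 x * (- (S1 x / \<zeta>1 x)) - 1 / S2 x * (- (S2 x / \<zeta>2 x)) = 1 / \<zeta>2 x - 1 / \<zeta>1 x"
      using R1(3)[OF x] R2(3)[OF x] by simp
    ultimately show ?thesis by (metis has_field_derivative_at_within)
  qed
  define N1 where "N1 x = m (\<rho>1 (S1 x)) / x - (g (S1 x) - (p - 1))" for x
  define N2 where "N2 x = m (\<rho>2 (S2 x)) / x - (g (S2 x) - (p - 1))" for x
  have dY1: "((\<lambda>x. ln (Y1 x)) has_real_derivative N1 x / \<zeta>1 x) (at x within {x0..x})" if x: "x0 \<le> x" "x \<le> x1" for x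
    using S1(5)[of t1 s1 x] x s t ts1 unfolding Y1_def N1_def \<zeta>1_def x0_def x1_def by simp
  have dY2: "((\<lambda>x. ln (Y2 x)) has_real_derivative N2 x / \<zeta>2 x) (at x within {x0..x})" if x: "x0 \<le> x" "x \<le> x1" for x
    using S2(5)[of t2 s2 x] x s t ts2 unfolding Y2_def N2_def \<zeta>2_def x0_def x1_def by simp
  have z12: "1 / \<zeta>2 x - 1 / \<zeta>1 x \<ge> 0" if x: "x0 \<le> x" "x \<le> x1" and D: "D x \<ge> 0" for x
  proof -
    have "Y2 x \<le> Y1 x" using D Y1p[OF x] Y2p[OF x] unfolding D_def by simp
    then have "Y2 x * (x powr (1 - p) / (p - 1)) \<le> Y1 x * (x powr (1 - p) / (p - 1))"
      using p by (intro mult_right_mono) auto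
    then have "\<zeta>2 x \<le> \<zeta>1 x" unfolding zY1[OF x] zY2[OF x] by simp
    then show ?thesis using z1p[OF x] z2p[OF x] by (simp add: frac_le)
  qed
  have rhop: "\<rho>1 (S1 x) > 0" "\<rho>2 (S2 x) > 0" if "x0 \<le> x" "x \<le> x1" for x
    using profileD(1)[OF P1 R1(3,4)[OF that]] profileD(1)[OF P2 R2(3,4)[OF that]] by auto
  have "D x1 \<ge> 0 \<and> A x1 > 0 \<and> B x1 > 0"
  proof (rule barrier[OF x01])
    show "continuous_on {x0..x1} D" unfolding D_def
      using Y1p Y2p cY1 cY2 by (intro contI) (auto intro!: continuous_intros simp: less_imp_neq[symmetric])
    show "continuous_on {x0..x1} A" unfolding A_def
    proof (intro contI)
      fix x assume x: "x0 \<le> x" "x \<le> x1"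
      show "isCont (\<lambda>x. ln (\<rho>2 (S2 x)) - ln (\<rho>1 (S1 x))) x"
        using isCont_o2[OF cS1[OF x] profile_cont(1)[OF P1 R1(3,4)[OF x]]] isCont_o2[OF cS2[OF x] profile_cont(1)[OF P2 R2(3,4)[OF x]]]
          rhop[OF x] by (auto intro!: continuous_intros)
    qed
    show "continuous_on {x0..x1} B" unfolding B_def
      using R1(3) R2(3) cS1 cS2 by (intro contI) (auto intro!: continuous_intros simp: less_imp_neq[symmetric])
    have e0: "S1 x0 = s1" "S2 x0 = s2" unfolding x0_def using S1(1)[OF s(1,2)] S2(1)[OF s(3,4)] by (simp_all only: s(5))
    show "0 \<le> D x0" "0 < A x0" "0 < B x0"
      using ini Y1p[of x0] Y2p[of x0] x01 rhop[of x0] R1(3)[of x0] R2(3)[of x0] unfolding D_def A_def B_def Y1_def Y2_def e0 by auto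
    show "\<exists>d\<ge>0. (A has_real_derivative d) (at x within {x0..x})" if "x0 < x" "x \<le> x1" "D x \<ge> 0" for x
      using dA[of x] z12[of x] that x0p by (intro exI[of _ "(1 / x) * (1 / \<zeta>2 x - 1 / \<zeta>1 x)"]) auto
    show "\<exists>d\<ge>0. (B has_real_derivative d) (at x within {x0..x})" if "x0 < x" "x \<le> x1" "D x \<ge> 0" for x
      using dB[of x] z12[of x] that x0p by (intro exI[of _ "1 / \<zeta>2 x - 1 / \<zeta>1 x"]) auto
    show "\<exists>d\<ge>C * D x. (D has_real_derivative d) (at x within {x0..x})"
      if x: "x0 < x" "x \<le> x1" and neg: "D x < 0" "A x > 0" "B x > 0" for x
    proof (intro exI conjI)
      have xx: "x0 \<le> x" "x \<le> x1" using x by auto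
      show "(D has_real_derivative N1 x / \<zeta>1 x - N2 x / \<zeta>2 x) (at x within {x0..x})"
        unfolding D_def by (intro DERIV_diff dY1[OF xx] dY2[OF xx])
      have xp: "x > 0" using x x0p by simp
      have ord: "\<rho>1 (S1 x) < \<rho>2 (S2 x)" "S2 x < S1 x"
        using neg rhop[OF xx] R1(3)[OF xx] R2(3)[OF xx] unfolding A_def B_def by auto
      have "m (\<rho>2 (S2 x)) \<le> m (\<rho>1 (S1 x))" using m_antimono rhop[OF xx] ord by auto
      then have "m (\<rho>2 (S2 x)) / x \<le> m (\<rho>1 (S1 x)) / x" using xp by (simp add: divide_right_mono)
      moreover have "g (S1 x) \<le> g (S2 x)" using g_antimono R2(5)[OF xx] ord by auto
      ultimately have N12: "N2 x \<le> N1 x" unfolding N1_def N2_def by simp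
      \<comment> \<open>\<open>t2\<close> is the lowest level of the arc, hence the place where
        \<open>g\<close> is largest.\<close>
      have "g (S2 x) \<le> g t2" using g_antimono[of t2 "S2 x"] T2[OF xx] pos2(3)[of t2] t by auto
      moreover have "m (\<rho>2 (S2 x)) / x > 0" using m_pos rhop[OF xx] xp by simp
      ultimately have N2: "N2 x \<ge> - g t2" unfolding N2_def using p by simp
      have gt: "g t2 > 0" using g_gt[of t2] pos2(3)[of t2] t p by auto
      have Yl: "Y1 x < Y2 x" using neg(1) Y1p[OF xx] Y2p[OF xx] unfolding D_def by simp
      then have "Y1 x * (x powr (1 - p) / (p - 1)) \<le> Y2 x * (x powr (1 - p) / (p - 1))"
        using p by (intro mult_right_mono) auto
      then have zl: "\<zeta>1 x \<le> \<zeta>2 x" unfolding zY1[OF xx] zY2[OF xx] by simp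
      then have inv: "1 / \<zeta>1 x - 1 / \<zeta>2 x \<ge> 0" using z1p[OF xx] z2p[OF xx] by (simp add: frac_le)
      have "Y2 x - Y1 x \<le> Y2 x * (- D x)"
      proof -
        have "1 + D x \<le> exp (D x)" by (rule exp_ge_add_one_self)
        also have "exp (D x) = Y1 x / Y2 x" unfolding D_def using Y1p[OF xx] Y2p[OF xx] by (simp add: exp_diff)
        finally show ?thesis using Y2p[OF xx] by (simp add: field_simps)
      qed
      then have "(Y2 x - Y1 x) * (x powr (1 - p) / ((p - 1) * \<zeta>1 x * \<zeta>2 x)) \<le> Y2 x * (- D x) * (x powr (1 - p) / ((p - 1) * \<zeta>1 x * \<zeta>2 x))"
        using p z1p[OF xx] z2p[OF xx] by (intro mult_right_mono) auto
      also have "\<dots> = Q x * (- D x)" unfolding Q_def by simp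
      also have "\<dots> \<le> M * (- D x)" using M[OF xx] neg by (intro mult_right_mono) auto
      finally have up: "(Y2 x - Y1 x) * (x powr (1 - p) / ((p - 1) * \<zeta>1 x * \<zeta>2 x)) \<le> M * (- D x)" .
      have "\<zeta>2 x - \<zeta>1 x = (Y2 x - Y1 x) * (x powr (1 - p) / (p - 1))"
        unfolding zY1[OF xx] zY2[OF xx] by (simp add: left_diff_distrib diff_divide_distrib)
      moreover have "1 / \<zeta>1 x - 1 / \<zeta>2 x = (\<zeta>2 x - \<zeta>1 x) / (\<zeta>1 x * \<zeta>2 x)"
        using z1p[OF xx] z2p[OF xx] by (simp add: field_simps)
      ultimately have "1 / \<zeta>1 x - 1 / \<zeta>2 x = (Y2 x - Y1 x) * (x powr (1 - p) / ((p - 1) * \<zeta>1 x * \<zeta>2 x))"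
        by (simp add: mult.assoc)
      then have inv2: "1 / \<zeta>1 x - 1 / \<zeta>2 x \<le> M * (- D x)" using up by simp
      have "C * D x \<le> - g t2 * (1 / \<zeta>1 x - 1 / \<zeta>2 x)"
        using mult_left_mono[OF inv2, of "g t2"] gt unfolding C_def by (simp add: algebra_simps)
      also have "\<dots> \<le> N2 x * (1 / \<zeta>1 x - 1 / \<zeta>2 x)" using N2 inv by (intro mult_right_mono) auto
      also have "\<dots> \<le> N1 x / \<zeta>1 x - N2 x / \<zeta>2 x"
        using N12 z1p[OF xx] by (simp add: right_diff_distrib divide_right_mono)
      finally show "C * D x \<le> N1 x / \<zeta>1 x - N2 x / \<zeta>2 x" .
    qed
  qed
  moreover have "S1 x1 = t1" "S2 x1 = t2" unfolding x1_def using S1(1)[OF t(1,2)] S2(1)[OF t(3,4)] by (simp_all only: t(5))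
  ultimately show ?thesis
    using Y1p[of x1] Y2p[of x1] rhop[of x1] R1(3)[of x1] R2(3)[of x1] x01 unfolding D_def A_def B_def Y1_def Y2_def by auto
qed

end

section \<open>Two orbits near their tops\<close>

context profile_system begin

text \<open>This quotient differs from the one in \<open>f_ratio_mono\<close> by the factor
  \<open>((s - u0) / s) powr (p - 1)\<close>, which increases strictly because
  \<open>u0 > 0\<close>.\<close>

lemma f_ratio_strict:
  assumes "u0 < s" "s < t"
  shows "f s / s powr (p - 1) < f t / t powr (p - 1)"
proof -
  have eq: "f x / x powr (p - 1) = f x / (x - u0) powr (p - 1) * ((x - u0) / x) powr (p - 1)" if "x > u0" for x
    using that u0 by (simp add: powr_divide)
  have "(s - u0) / s < (t - u0) / t" using assms u0 by (simp add: field_simps)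
  then have "((s - u0) / s) powr (p - 1) < ((t - u0) / t) powr (p - 1)"
    using assms u0 p by (intro powr_less_mono2) auto
  moreover have "0 < f s / (s - u0) powr (p - 1)" using f_pos assms by simp
  ultimately have "f s / (s - u0) powr (p - 1) * ((s - u0) / s) powr (p - 1) < f s / (s - u0) powr (p - 1) * ((t - u0) / t) powr (p - 1)"
    by (rule mult_strict_left_mono)
  also have "\<dots> \<le> f t / (t - u0) powr (p - 1) * ((t - u0) / t) powr (p - 1)"
    using f_ratio_mono assms by (intro mult_right_mono) auto
  finally show ?thesis using eq assms by simp
qed

lemma beta_tendsto_0:
  assumes P: "profile \<rho> z \<alpha>"
  shows "((\<lambda>s. z s / s) \<longlongrightarrow> 0) (at_left \<alpha>)"
proof -
  have "\<alpha> \<noteq> 0" "(z \<longlongrightarrow> 0) (at_left \<alpha>)" using P u0 unfolding profile_def by auto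
  then have "((\<lambda>s. z s / s) \<longlongrightarrow> 0 / \<alpha>) (at_left \<alpha>)" by (intro tendsto_intros)
  then show ?thesis by simp
qed

lemma beta_small:
  assumes P: "profile \<rho> z \<alpha>" and "e > 0" "a < \<alpha>"
  obtains s where "a < s" "s < \<alpha>" "z s / s < e"
proof -
  have "\<forall>\<^sub>F s in at_left \<alpha>. z s / s < e" by (rule order_tendstoD(2)[OF beta_tendsto_0[OF P] assms(2)])
  moreover have "\<forall>\<^sub>F s in at_left \<alpha>. s \<in> {a<..<\<alpha>}" by (rule eventually_at_left_real[OF assms(3)])
  ultimately have "\<forall>\<^sub>F s in at_left \<alpha>. z s / s < e \<and> s \<in> {a<..<\<alpha>}" by eventually_elim simp
  then show thesis using eventually_happens[of _ "at_left \<alpha>"] that by auto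
qed

lemma beta_isCont:
  assumes P: "profile \<rho> z \<alpha>" "0 < s" "s < \<alpha>"
  shows "isCont (\<lambda>s. z s / s) s"
  using DERIV_isCont[OF beta_deriv[OF assms]] .

lemma beta_IVT:
  assumes P: "profile \<rho> z \<alpha>" and s: "0 < a" "a \<le> b" "b < \<alpha>" "z b / b \<le> x" "x \<le> z a / a"
  obtains s where "a \<le> s" "s \<le> b" "z s / s = x"
proof -
  have "\<exists>s. a \<le> s \<and> s \<le> b \<and> (\<lambda>s. z s / s) s = x"
  proof (rule IVT2'[of "\<lambda>s. z s / s"])
    show "continuous_on {a..b} (\<lambda>s. z s / s)"
      by (intro continuous_at_imp_continuous_on ballI beta_isCont[OF P]) (use s in auto)
  qed (use s in auto)
  then show thesis using that by blast
qed

text \<open>Whenever \<open>yy \<rho>1 < yy \<rho>2\<close> at some small common value of \<open>beta\<close>, this relation gets worse as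
  \<open>beta\<close> decreases to zero, where however the quotient of the two is at least one.\<close>

lemma small_beta_start:
  assumes P1: "profile \<rho>1 z1 \<alpha>1" and I1: "\<And>s. u0 < s \<Longrightarrow> s < \<alpha>1 \<Longrightarrow> zeta \<rho>1 z1 s > 0"
    and P2: "profile \<rho>2 z2 \<alpha>2" and I2: "\<And>s. u0 < s \<Longrightarrow> s < \<alpha>2 \<Longrightarrow> zeta \<rho>2 z2 s > 0"
    and less: "\<alpha>2 < \<alpha>1" and e: "e > 0"
  obtains s1 s2 where "u0 < s1" "s1 < \<alpha>1" "u0 < s2" "s2 < \<alpha>2" "z1 s1 / s1 = z2 s2 / s2" "z1 s1 / s1 < e"
    "s2 < s1" "\<rho>1 s1 < \<rho>2 s2" "yy \<rho>2 s2 \<le> yy \<rho>1 s1"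
proof -
  have al: "\<alpha>1 > u0" "\<alpha>2 > u0" using P1 P2 unfolding profile_def by auto
  \<comment> \<open>Orbit 1 is followed above \<open>\<sigma>\<close> and orbit 2 above some
    \<open>a < \<alpha>2\<close> so close to \<open>\<alpha>2\<close> that
    \<open>f \<alpha>2 / a powr (p - 1)\<close> stays below
    \<open>f \<sigma> / \<sigma> powr (p - 1)\<close>. The levels are then separated by
    \<open>\<alpha>2\<close>.\<close>
  define \<sigma> where "\<sigma> = (\<alpha>1 + \<alpha>2) / 2"
  have \<sigma>: "\<alpha>2 < \<sigma>" "\<sigma> < \<alpha>1" using less by (auto simp: \<sigma>_def)
  have c1: "f \<alpha>2 / \<alpha>2 powr (p - 1) < f \<sigma> / \<sigma> powr (p - 1)" using f_ratio_strict[OF al(2) \<sigma>(1)] .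
  have "((\<lambda>s. f \<alpha>2 / s powr (p - 1)) \<longlongrightarrow> f \<alpha>2 / \<alpha>2 powr (p - 1)) (at_left \<alpha>2)"
    using al u0 by (intro tendsto_intros) auto
  from order_tendstoD(2)[OF this c1] have "\<forall>\<^sub>F s in at_left \<alpha>2. f \<alpha>2 / s powr (p - 1) < f \<sigma> / \<sigma> powr (p - 1) \<and> s \<in> {u0<..<\<alpha>2}"
    using eventually_at_left_real[OF al(2)] by eventually_elim simp
  from eventually_happens[OF this] obtain a where a: "f \<alpha>2 / a powr (p - 1) < f \<sigma> / \<sigma> powr (p - 1)" "u0 < a" "a < \<alpha>2" by auto
  have pos1: "s > 0" if "s > u0" for s using that u0 by simp
  obtain S1 where S1: "\<And>s. u0 < s \<Longrightarrow> s < \<alpha>1 \<Longrightarrow> S1 (z1 s / s) = s"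
    "\<And>s. u0 < s \<Longrightarrow> s < \<alpha>1 \<Longrightarrow> (S1 has_real_derivative - (s / zeta \<rho>1 z1 s)) (at (z1 s / s))"
    "\<And>s t x. u0 < s \<Longrightarrow> s \<le> t \<Longrightarrow> t < \<alpha>1 \<Longrightarrow> z1 t / t \<le> x \<Longrightarrow> x \<le> z1 s / s \<Longrightarrow> s \<le> S1 x \<and> S1 x \<le> t \<and> z1 (S1 x) / S1 x = x"
    "\<And>s t. u0 < s \<Longrightarrow> s < t \<Longrightarrow> t < \<alpha>1 \<Longrightarrow> z1 t / t < z1 s / s"
    "\<And>s t x. u0 < s \<Longrightarrow> s \<le> t \<Longrightarrow> t < \<alpha>1 \<Longrightarrow> z1 t / t \<le> x \<Longrightarrow> x \<le> z1 s / s \<Longrightarrow>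
      ((\<lambda>x. ln (yy \<rho>1 (S1 x))) has_real_derivative (m (\<rho>1 (S1 x)) / x - (g (S1 x) - (p - 1))) / zeta \<rho>1 z1 (S1 x)) (at x within {z1 t / t..x})"
    by (rule arc_inverse[OF P1 order_refl order_refl I1]) blast+
  obtain S2 where S2: "\<And>s. u0 < s \<Longrightarrow> s < \<alpha>2 \<Longrightarrow> S2 (z2 s / s) = s"
    "\<And>s. u0 < s \<Longrightarrow> s < \<alpha>2 \<Longrightarrow> (S2 has_real_derivative - (s / zeta \<rho>2 z2 s)) (at (z2 s / s))"
    "\<And>s t x. u0 < s \<Longrightarrow> s \<le> t \<Longrightarrow> t < \<alpha>2 \<Longrightarrow> z2 t / t \<le> x \<Longrightarrow> x \<le> z2 s / s \<Longrightarrow> s \<le> S2 x \<and> S2 x \<le> t \<and> z2 (S2 x) / S2 x = x"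
    "\<And>s t. u0 < s \<Longrightarrow> s < t \<Longrightarrow> t < \<alpha>2 \<Longrightarrow> z2 t / t < z2 s / s"
    "\<And>s t x. u0 < s \<Longrightarrow> s \<le> t \<Longrightarrow> t < \<alpha>2 \<Longrightarrow> z2 t / t \<le> x \<Longrightarrow> x \<le> z2 s / s \<Longrightarrow>
      ((\<lambda>x. ln (yy \<rho>2 (S2 x))) has_real_derivative (m (\<rho>2 (S2 x)) / x - (g (S2 x) - (p - 1))) / zeta \<rho>2 z2 (S2 x)) (at x within {z2 t / t..x})"
    by (rule arc_inverse[OF P2 order_refl order_refl I2]) blast+
  define ma where "ma = m (\<rho>2 a)"
  have ma: "ma > 0" unfolding ma_def using m_pos profileD(1)[OF P2 pos1[OF a(2)] a(3)] by simp
  have ga: "g a > 0" using g_gt[OF a(2)] p by simp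
  have bp: "z1 \<sigma> / \<sigma> > 0" "z2 a / a > 0"
    using profileD(2)[OF P1, of \<sigma>] profileD(2)[OF P2, of a] \<sigma> al a pos1 by auto
  \<comment> \<open>Values up to \<open>w\<close> are attained by both orbits in these ranges. The
    bound \<open>ma / g a\<close> lets \<open>m / x\<close> dominate the elasticity, which makes the
    numerator \<open>N2\<close> below nonnegative.\<close>
  define w where "w = min (min (z1 \<sigma> / \<sigma>) (z2 a / a)) (min e (ma / g a))"
  have w: "w > 0" "w \<le> z1 \<sigma> / \<sigma>" "w \<le> z2 a / a" "w \<le> e" "w \<le> ma / g a"
    using bp e ma ga unfolding w_def by auto
  define X where "X = w / 2"
  have X: "X > 0" "X < z1 \<sigma> / \<sigma>" "X < z2 a / a" "X < e" "X < ma / g a"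
    using w unfolding X_def by linarith+
  have T1: "\<sigma> \<le> S1 x \<and> S1 x < \<alpha>1 \<and> z1 (S1 x) / S1 x = x" if x: "0 < x" "x \<le> X" for x
  proof -
    obtain t where t: "\<sigma> < t" "t < \<alpha>1" "z1 t / t < x" using beta_small[OF P1 x(1) \<sigma>(2)] .
    show ?thesis using S1(3)[of \<sigma> t x] t x X \<sigma> al by auto
  qed
  have T2: "a \<le> S2 x \<and> S2 x < \<alpha>2 \<and> z2 (S2 x) / S2 x = x" if x: "0 < x" "x \<le> X" for x
  proof -
    obtain t where t: "a < t" "t < \<alpha>2" "z2 t / t < x" using beta_small[OF P2 x(1) a(3)] .
    show ?thesis using S2(3)[of a t x] t x X a by auto
  qed
  have R1: "S1 x > 0" "S1 x > u0" "S1 x < \<alpha>1" "S1 x > \<alpha>2" if "0 < x" "x \<le> X" for x using T1[OF that] \<sigma> al u0 by auto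
  have R2: "S2 x > 0" "S2 x > u0" "S2 x < \<alpha>2" if "0 < x" "x \<le> X" for x using T2[OF that] a u0 by auto
  have S21: "S2 x < S1 x" if "0 < x" "x \<le> X" for x using R1[OF that] R2[OF that] by simp
  have rp: "\<rho>1 (S1 x) > 0" "\<rho>2 (S2 x) > 0" if "0 < x" "x \<le> X" for x
    using profileD(1)[OF P1 R1(1,3)[OF that]] profileD(1)[OF P2 R2(1,3)[OF that]] by auto
  have zp: "z1 (S1 x) powr (p - 1) = x powr (p - 1) * S1 x powr (p - 1)" "z2 (S2 x) powr (p - 1) = x powr (p - 1) * S2 x powr (p - 1)"
    if x: "0 < x" "x \<le> X" for x
  proof -
    have "z1 (S1 x) = x * S1 x" "z2 (S2 x) = x * S2 x"
      using T1[OF x] T2[OF x] R1(1)[OF x] R2(1)[OF x] by (auto simp: field_simps)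
    then show "z1 (S1 x) powr (p - 1) = x powr (p - 1) * S1 x powr (p - 1)" "z2 (S2 x) powr (p - 1) = x powr (p - 1) * S2 x powr (p - 1)"
      using x R1(1)[OF x] R2(1)[OF x] by (auto simp: powr_mult)
  qed
  have q1: "f s * J (\<rho>1 s) \<le> z1 s powr (p - 1)" "z1 s powr (p - 1) \<le> f \<alpha>1 * J (\<rho>1 s)" if "u0 < s" "s < \<alpha>1" for s
    using P1 that unfolding profile_def by auto
  have q2: "f s * J (\<rho>2 s) \<le> z2 s powr (p - 1)" "z2 s powr (p - 1) \<le> f \<alpha>2 * J (\<rho>2 s)" if "u0 < s" "s < \<alpha>2" for s
    using P2 that unfolding profile_def by auto
  \<comment> \<open>Both flux bounds are read at the same value \<open>x\<close> of
    \<open>z / s\<close>: the smaller bound for \<open>f / s powr (p - 1)\<close> on orbit 2 forces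
    the larger \<open>J\<close>, hence the larger radius.\<close>
  have JJ: "J (\<rho>1 (S1 x)) < J (\<rho>2 (S2 x))" if x: "0 < x" "x \<le> X" for x
  proof -
    have j: "J (\<rho>1 (S1 x)) > 0" "J (\<rho>2 (S2 x)) > 0" using J_pos rp[OF x] by auto
    have "f \<sigma> / \<sigma> powr (p - 1) \<le> f (S1 x) / S1 x powr (p - 1)"
      using f_ratio_strict[of \<sigma> "S1 x"] T1[OF x] \<sigma> al by (cases "S1 x = \<sigma>") auto
    moreover have "f \<alpha>2 / S2 x powr (p - 1) \<le> f \<alpha>2 / a powr (p - 1)"
      using T2[OF x] a pos1[OF a(2)] f_pos[OF al(2)] p by (intro divide_left_mono powr_mono2) auto
    ultimately have lt: "f \<alpha>2 / S2 x powr (p - 1) < f (S1 x) / S1 x powr (p - 1)" using a(1) by linarith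
    have "f (S1 x) / S1 x powr (p - 1) * J (\<rho>1 (S1 x)) \<le> x powr (p - 1)"
      using q1(1)[OF R1(2,3)[OF x]] zp(1)[OF x] R1(1)[OF x] by (simp add: field_simps)
    also have "\<dots> \<le> f \<alpha>2 / S2 x powr (p - 1) * J (\<rho>2 (S2 x))"
      using q2(2)[OF R2(2,3)[OF x]] zp(2)[OF x] R2(1)[OF x] by (simp add: field_simps)
    also have "\<dots> < f (S1 x) / S1 x powr (p - 1) * J (\<rho>2 (S2 x))" using lt j by (intro mult_strict_right_mono)
    finally show ?thesis using f_pos[OF R1(2)[OF x]] R1(1)[OF x] by (simp add: mult_less_cancel_left divide_less_cancel)
  qed
  have ord: "\<rho>1 (S1 x) < \<rho>2 (S2 x)" if x: "0 < x" "x \<le> X" for x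
    using JJ[OF x] J_mono[of "\<rho>2 (S2 x)" "\<rho>1 (S1 x)"] rp[OF x] by force
  define Y1 where "Y1 x = yy \<rho>1 (S1 x)" for x
  define Y2 where "Y2 x = yy \<rho>2 (S2 x)" for x
  have Yp: "Y1 x > 0" "Y2 x > 0" if "0 < x" "x \<le> X" for x
    unfolding Y1_def Y2_def using yy_pos[OF P1 R1(2,3)[OF that]] yy_pos[OF P2 R2(2,3)[OF that]] by auto
  have "\<exists>x>0. x \<le> X \<and> Y2 x \<le> Y1 x"
  proof (rule ccontr)
    assume "\<not> ?thesis"
    then have neg: "Y1 x < Y2 x" if "0 < x" "x \<le> X" for x using that by force
    define D where "D x = ln (Y1 x) - ln (Y2 x)" for x
    \<comment> \<open>With \<open>Y1 < Y2\<close> throughout one has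
      \<open>\<zeta>1 \<le> \<zeta>2\<close> and \<open>N1 \<ge> N2 \<ge> 0\<close>, so
      \<open>ln (Y1 / Y2)\<close> increases with \<open>x\<close> and, for small \<open>x\<close>,
      stays below its negative value at \<open>X\<close>.\<close>
    have mono: "D x0 \<le> D X" if x0: "0 < x0" "x0 \<le> X" for x0
    proof (rule Icc_left_deriv_nonneg_imp_le[OF x0(2) order_refl])
      have "continuous_on {x0..X} D"
      proof (intro continuous_at_imp_continuous_on ballI)
        fix x assume "x \<in> {x0..X}"
        then have x: "0 < x" "x \<le> X" using x0 by auto
        have "isCont S1 x" using DERIV_isCont[OF S1(2)[OF R1(2,3)[OF x]]] T1[OF x] by simp
        from isCont_o2[OF this yy_cont[OF P1 R1(1,3)[OF x]]] have 1: "isCont Y1 x" unfolding Y1_def .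
        have "isCont S2 x" using DERIV_isCont[OF S2(2)[OF R2(2,3)[OF x]]] T2[OF x] by simp
        from isCont_o2[OF this yy_cont[OF P2 R2(1,3)[OF x]]] have 2: "isCont Y2 x" unfolding Y2_def .
        show "isCont D x" unfolding D_def using Yp[OF x] 1 2 by (auto intro!: continuous_intros)
      qed
      then show "continuous_on {x0..X} D" .
      fix x assume x': "x0 < x" "x \<le> X"
      then have x: "0 < x" "x \<le> X" using x0 by auto
      have t1: "z1 (S1 x0) / S1 x0 = x0" "z2 (S2 x0) / S2 x0 = x0" using T1[OF x0] T2[OF x0] by auto
      have lt1: "S1 x \<le> S1 x0"
      proof (rule ccontr)
        assume "\<not> S1 x \<le> S1 x0"
        then have "z1 (S1 x) / S1 x < z1 (S1 x0) / S1 x0" using S1(4) R1[OF x0] R1[OF x] by auto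
        then show False using T1[OF x] t1 x' by simp
      qed
      have lt2: "S2 x \<le> S2 x0"
      proof (rule ccontr)
        assume "\<not> S2 x \<le> S2 x0"
        then have "z2 (S2 x) / S2 x < z2 (S2 x0) / S2 x0" using S2(4) R2[OF x0] R2[OF x] by auto
        then show False using T2[OF x] t1 x' by simp
      qed
      define N1 where "N1 = m (\<rho>1 (S1 x)) / x - (g (S1 x) - (p - 1))"
      define N2 where "N2 = m (\<rho>2 (S2 x)) / x - (g (S2 x) - (p - 1))"
      define \<zeta>1 where "\<zeta>1 = zeta \<rho>1 z1 (S1 x)"
      define \<zeta>2 where "\<zeta>2 = zeta \<rho>2 z2 (S2 x)"
      have d1: "((\<lambda>x. ln (Y1 x)) has_real_derivative N1 / \<zeta>1) (at x within {x0..x})"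
        using S1(5)[OF R1(2)[OF x] lt1 R1(3)[OF x0], of x] T1[OF x] t1 x' unfolding Y1_def N1_def \<zeta>1_def by simp
      have d2: "((\<lambda>x. ln (Y2 x)) has_real_derivative N2 / \<zeta>2) (at x within {x0..x})"
        using S2(5)[OF R2(2)[OF x] lt2 R2(3)[OF x0], of x] T2[OF x] t1 x' unfolding Y2_def N2_def \<zeta>2_def by simp
      have "m (\<rho>2 (S2 x)) \<le> m (\<rho>1 (S1 x))" using m_antimono rp[OF x] ord[OF x] by auto
      then have "m (\<rho>2 (S2 x)) / x \<le> m (\<rho>1 (S1 x)) / x" using x by (simp add: divide_right_mono)
      moreover have "g (S1 x) \<le> g (S2 x)" using g_antimono R2(2)[OF x] S21[OF x] by auto
      ultimately have N12: "N2 \<le> N1" unfolding N1_def N2_def by simp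
      have N2: "N2 \<ge> 0"
      proof -
        have "\<rho>2 (S2 x) \<le> \<rho>2 a" using profile_rho_antimono[OF P2, of a "S2 x"] T2[OF x] pos1[OF a(2)] by (cases "S2 x = a") auto
        then have "ma \<le> m (\<rho>2 (S2 x))" unfolding ma_def using m_antimono rp[OF x] by auto
        moreover have "g (S2 x) \<le> g a" using g_antimono[OF a(2)] T2[OF x] by simp
        moreover have "x * g a \<le> ma" using x X(5) ga by (simp add: field_simps) (smt (verit) mult_right_mono)
        ultimately have "g (S2 x) \<le> m (\<rho>2 (S2 x)) / x"
          using x by (simp add: field_simps) (smt (verit) mult_left_mono mult_right_mono)
        then show ?thesis unfolding N2_def using p by simp
      qed
      have zpos: "\<zeta>1 > 0" "\<zeta>2 > 0" unfolding \<zeta>1_def \<zeta>2_def using I1 I2 R1[OF x] R2[OF x] by auto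
      have e1: "\<zeta>1 = x - mh + Y1 x * (x powr (1 - p) / (p - 1))" "\<zeta>2 = x - mh + Y2 x * (x powr (1 - p) / (p - 1))"
        unfolding \<zeta>1_def \<zeta>2_def Y1_def Y2_def
        using zeta_yy[where z=z1 and \<rho>=\<rho>1, OF R1(1)[OF x] profileD(2)[OF P1 R1(1,3)[OF x]]]
          zeta_yy[where z=z2 and \<rho>=\<rho>2, OF R2(1)[OF x] profileD(2)[OF P2 R2(1,3)[OF x]]] T1[OF x] T2[OF x] by auto
      have "Y1 x * (x powr (1 - p) / (p - 1)) \<le> Y2 x * (x powr (1 - p) / (p - 1))"
        using neg[OF x] p by (intro mult_right_mono) auto
      then have "\<zeta>1 \<le> \<zeta>2" using e1 by simp
      then have "N2 / \<zeta>2 \<le> N1 / \<zeta>1" using N12 N2 zpos by (intro frac_le) auto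
      moreover have "(D has_real_derivative N1 / \<zeta>1 - N2 / \<zeta>2) (at x within {x0..x})"
        unfolding D_def by (intro DERIV_diff d1 d2)
      ultimately show "\<exists>d\<ge>0. (D has_real_derivative d) (at x within {x0..x})" by (intro exI conjI) auto
    qed
    \<comment> \<open>The flux bounds give \<open>Y2 \<le> kap / J * x powr (p - 1)\<close> at the
      radius of orbit 2 and, up to the factor \<open>f (S1 x) / f \<alpha>1\<close>, the opposite
      estimate for \<open>Y1\<close>; and \<open>kap / J\<close> is larger at the smaller radius.
      The factor tends to 1 at the top, which contradicts \<open>mono\<close>.\<close>
    have low: "ln (f (S1 x)) - ln (f \<alpha>1) \<le> D x" if x: "0 < x" "x \<le> X" for x
    proof -
      have j: "J (\<rho>1 (S1 x)) > 0" "J (\<rho>2 (S2 x)) > 0" using J_pos rp[OF x] by auto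
      have k: "kap (\<rho>1 (S1 x)) > 0" "kap (\<rho>2 (S2 x)) > 0" using kap_pos rp[OF x] by auto
      have ff: "f (S1 x) > 0" "f (S2 x) > 0" "f \<alpha>1 > 0" using f_pos R1[OF x] R2[OF x] al by auto
      have 1: "Y2 x \<le> kap (\<rho>2 (S2 x)) / J (\<rho>2 (S2 x)) * x powr (p - 1)"
      proof -
        have "f (S2 x) / S2 x powr (p - 1) * J (\<rho>2 (S2 x)) \<le> x powr (p - 1)"
          using q2(1)[OF R2(2,3)[OF x]] zp(2)[OF x] R2(1)[OF x] by (simp add: field_simps)
        then have "kap (\<rho>2 (S2 x)) / J (\<rho>2 (S2 x)) * (f (S2 x) / S2 x powr (p - 1) * J (\<rho>2 (S2 x))) \<le> kap (\<rho>2 (S2 x)) / J (\<rho>2 (S2 x)) * x powr (p - 1)"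
          using j k by (intro mult_left_mono) auto
        then show ?thesis unfolding Y2_def yy_def using j by simp
      qed
      have 2: "kap (\<rho>1 (S1 x)) / J (\<rho>1 (S1 x)) * x powr (p - 1) * (f (S1 x) / f \<alpha>1) \<le> Y1 x"
      proof -
        have "x powr (p - 1) / f \<alpha>1 \<le> J (\<rho>1 (S1 x)) / S1 x powr (p - 1)"
          using q1(2)[OF R1(2,3)[OF x]] zp(1)[OF x] R1(1)[OF x] ff by (simp add: field_simps)
        then have "kap (\<rho>1 (S1 x)) / J (\<rho>1 (S1 x)) * f (S1 x) * (x powr (p - 1) / f \<alpha>1) \<le> kap (\<rho>1 (S1 x)) / J (\<rho>1 (S1 x)) * f (S1 x) * (J (\<rho>1 (S1 x)) / S1 x powr (p - 1))"
          using j k ff by (intro mult_left_mono) auto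
        then show ?thesis unfolding Y1_def yy_def using j by (simp add: mult_ac)
      qed
      have "Y2 x * (f (S1 x) / f \<alpha>1) \<le> kap (\<rho>2 (S2 x)) / J (\<rho>2 (S2 x)) * x powr (p - 1) * (f (S1 x) / f \<alpha>1)"
        using 1 ff by (intro mult_right_mono) auto
      also have "\<dots> \<le> kap (\<rho>1 (S1 x)) / J (\<rho>1 (S1 x)) * x powr (p - 1) * (f (S1 x) / f \<alpha>1)"
        using kap_J_antimono[OF rp(1)[OF x]] ord[OF x] ff by (intro mult_right_mono) auto
      also note 2
      finally have "ln (Y2 x * (f (S1 x) / f \<alpha>1)) \<le> ln (Y1 x)"
        using Yp[OF x] ff by (subst ln_le_cancel_iff) auto
      then show ?thesis unfolding D_def using Yp[OF x] ff by (simp add: ln_mult ln_div less_imp_neq[symmetric])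
    qed
    have "((\<lambda>s. ln (f s) - ln (f \<alpha>1)) \<longlongrightarrow> ln (f \<alpha>1) - ln (f \<alpha>1)) (at_left \<alpha>1)"
    proof (intro tendsto_intros)
      have "isCont f \<alpha>1" by (rule continuous_on_interior[OF f_cont]) (use al u0 in simp)
      then show "(f \<longlongrightarrow> f \<alpha>1) (at_left \<alpha>1)" unfolding isCont_def by (rule tendsto_within_subset) simp
      show "f \<alpha>1 \<noteq> 0" using f_pos[OF al(1)] by simp
    qed
    then have "ln (f \<alpha>1) - ln (f \<alpha>1) \<le> D X"
    proof (rule tendsto_upperbound)
      have XX: "0 < X" "X \<le> X" using X by auto
      have "S1 X < \<alpha>1" using R1[OF XX] by simp
      from eventually_at_left_real[OF this] show "\<forall>\<^sub>F s in at_left \<alpha>1. ln (f s) - ln (f \<alpha>1) \<le> D X"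
      proof eventually_elim
        case (elim s)
        then have s: "u0 < s" "s < \<alpha>1" using R1[OF XX] by auto
        have "z1 s / s < z1 (S1 X) / S1 X" using S1(4)[of "S1 X" s] R1[OF XX] elim by auto
        then have x: "0 < z1 s / s" "z1 s / s \<le> X"
          using T1[OF XX] profileD(2)[OF P1 pos1[OF s(1)] s(2)] pos1[OF s(1)] by auto
        show ?case using low[OF x] mono[OF x] S1(1)[OF s] by simp
      qed
    qed simp
    moreover have "D X < 0" unfolding D_def using neg[of X] Yp[of X] X by simp
    ultimately show False by simp
  qed
  then obtain x where x: "0 < x" "x \<le> X" "Y2 x \<le> Y1 x" by blast
  show thesis
    by (rule that[of "S1 x" "S2 x"])
      (use R1[OF x(1,2)] R2[OF x(1,2)] T1[OF x(1,2)] T2[OF x(1,2)] S21[OF x(1,2)] ord[OF x(1,2)] x X in \<open>auto simp: Y1_def Y2_def\<close>)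
qed
end

section \<open>Monotonicity of the orbits\<close>

lemma powr_within_deriv:
  assumes "(h has_real_derivative d) (at x within S)" "h x > 0"
  shows "((\<lambda>x. h x powr q) has_real_derivative q * h x powr q / h x * d) (at x within S)"
proof -
  have "((\<lambda>x. h x powr q) has_real_derivative q * h x powr (q - 1) * d) (at x within S)"
    by (rule DERIV_chain'[OF assms(1) has_real_derivative_powr[OF assms(2)]])
  then show ?thesis using assms(2) by (simp add: powr_diff)
qed

context profile_system begin

text \<open>\<open>zeta\<close> solves a linear equation with forcing term
  \<open>- om * N / s\<close>, where \<open>N\<close> is the numerator of the growth rate of
  \<open>ln yy\<close> in the variable \<open>z / s\<close>.\<close>

lemma zeta_right_deriv:
  assumes P: "profile \<rho> z \<alpha>" and s: "u0 < s" "s < \<alpha>"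
  defines "om \<equiv> kap (\<rho> s) * f s * z s powr (1 - p) / (p - 1)"
    and "N \<equiv> m (\<rho> s) * s / z s - (g s - (p - 1))"
  shows "(zeta \<rho> z has_real_derivative - zeta \<rho> z s / s - om * N / s + (p - 1) * om * zeta \<rho> z s / z s) (at s within {s..})"
proof -
  have s0: "s > 0" using s u0 by simp
  note Q = profileD[OF P s0 s(2)]
  define W where "W = z s powr (1 - p)"
  define k where "k = kap (\<rho> s)"
  have om: "om = k * f s * W / (p - 1)" unfolding om_def k_def W_def ..
  have dz: "(z has_real_derivative mh - om) (at s within {s..})" using has_field_derivative_at_within[OF Q(4)] unfolding om_def .
  have dk: "((\<lambda>s. kap (\<rho> s)) has_real_derivative m (\<rho> s) * k / \<rho> s * (- \<rho> s / z s)) (at s within {s..})"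
    unfolding k_def by (rule DERIV_chain'[OF has_field_derivative_at_within[OF Q(3)] kap_deriv[OF Q(1)]])
  have dW: "((\<lambda>s. z s powr (1 - p)) has_real_derivative (1 - p) * W / z s * (mh - om)) (at s within {s..})"
    unfolding W_def by (rule powr_within_deriv[OF dz Q(2)])
  have "((\<lambda>s. z s / s - mh + kap (\<rho> s) * f s * z s powr (1 - p) / (p - 1)) has_real_derivative
     ((mh - om) * s - z s) / (s * s) + (((m (\<rho> s) * k / \<rho> s * (- \<rho> s / z s)) * f s + g s * f s / s * k) * W + (1 - p) * W / z s * (mh - om) * (k * f s)) / (p - 1)) (at s within {s..})"
    by (rule DERIV_cong[OF DERIV_add[OF DERIV_diff[OF DERIV_divide[OF dz DERIV_ident] DERIV_const]
          DERIV_cdivide[OF DERIV_mult[OF DERIV_mult[OF dk f_deriv[OF s(1)]] dW]]]])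
       (use s0 in \<open>auto simp: k_def W_def\<close>)
  moreover have "((mh - om) * s - z s) / (s * s) + (((m (\<rho> s) * k / \<rho> s * (- \<rho> s / z s)) * f s + g s * f s / s * k) * W + (1 - p) * W / z s * (mh - om) * (k * f s)) / (p - 1)
     = - zeta \<rho> z s / s - om * N / s + (p - 1) * om * zeta \<rho> z s / z s"
  proof -
    have kf: "k * f s * W = (p - 1) * om" using p unfolding om by simp
    have 1: "((m (\<rho> s) * k / \<rho> s * (- \<rho> s / z s)) * f s + g s * f s / s * k) * W = (g s / s - m (\<rho> s) / z s) * (k * f s * W)"
      using Q(1) by (simp add: field_simps)
    have 2: "(1 - p) * W / z s * (mh - om) * (k * f s) = (1 - p) * (mh - om) / z s * (k * f s * W)" by simp
    have 3: "zeta \<rho> z s = z s / s - mh + om" unfolding zeta_def om_def ..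
    show ?thesis unfolding 1 2 kf 3 N_def using s0 Q(2) p by (simp add: field_simps)
  qed
  moreover have "zeta \<rho> z = (\<lambda>s. z s / s - mh + kap (\<rho> s) * f s * z s powr (1 - p) / (p - 1))"
    by (auto simp: zeta_def)
  ultimately show ?thesis by simp
qed

text \<open>\<open>zeta\<close> times an integrating factor of its linear equation, so that above
  \<open>u0\<close> the sign of the derivative is opposite to that of \<open>N\<close>. For a
  solution, \<open>\<rho> s powr ((p - 1) * mh) * z s powr (p - 1)\<close> is the modulus of the
  flux \<open>r ^ (n - 1) * phi p (u')\<close>.\<close>

definition HH :: "(real \<Rightarrow> real) \<Rightarrow> (real \<Rightarrow> real) \<Rightarrow> real \<Rightarrow> real" where
  "HH \<rho> z s = \<rho> s powr ((p - 1) * mh) * s * z s powr (p - 1) * zeta \<rho> z s"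

lemma HH_sgn:
  assumes "profile \<rho> z \<alpha>" "0 < s" "s < \<alpha>"
  shows "HH \<rho> z s \<le> 0 \<longleftrightarrow> zeta \<rho> z s \<le> 0" "HH \<rho> z s = 0 \<longleftrightarrow> zeta \<rho> z s = 0"
  using assms profileD(1,2)[OF assms] unfolding HH_def by (auto simp: mult_le_0_iff zero_le_mult_iff not_le)

lemma HH_cont:
  assumes P: "profile \<rho> z \<alpha>" and s: "0 < a" "b < \<alpha>"
  shows "continuous_on {a..b} (HH \<rho> z)"
proof (intro continuous_at_imp_continuous_on ballI)
  fix x assume "x \<in> {a..b}"
  then have x: "0 < x" "x < \<alpha>" using s by auto
  have eq: "HH \<rho> z = (\<lambda>s. \<rho> s powr ((p - 1) * mh) * s * z s powr (p - 1) * zeta \<rho> z s)" by (auto simp: HH_def)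
  show "isCont (HH \<rho> z) x" unfolding eq
    using profile_cont[OF P x] zeta_cont[OF P x] profileD[OF P x] p mh
    by (auto intro!: continuous_intros)
qed

lemma HH_right_deriv:
  assumes P: "profile \<rho> z \<alpha>" and s: "u0 < s" "s < \<alpha>"
  defines "om \<equiv> kap (\<rho> s) * f s * z s powr (1 - p) / (p - 1)"
    and "N \<equiv> m (\<rho> s) * s / z s - (g s - (p - 1))"
  shows "(HH \<rho> z has_real_derivative - (\<rho> s powr ((p - 1) * mh) * z s powr (p - 1) * om) * N) (at s within {s..})"
proof -
  have s0: "s > 0" using s u0 by simp
  note Q = profileD[OF P s0 s(2)]
  define V where "V = z s powr (p - 1)"
  define R where "R = \<rho> s powr ((p - 1) * mh)"
  have dz: "(z has_real_derivative mh - om) (at s within {s..})" using has_field_derivative_at_within[OF Q(4)] unfolding om_def .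
  have dV: "((\<lambda>s. z s powr (p - 1)) has_real_derivative (p - 1) * V / z s * (mh - om)) (at s within {s..})"
    unfolding V_def by (rule powr_within_deriv[OF dz Q(2)])
  have dR: "((\<lambda>s. \<rho> s powr ((p - 1) * mh)) has_real_derivative (p - 1) * mh * R / \<rho> s * (- \<rho> s / z s)) (at s within {s..})"
    unfolding R_def by (rule powr_within_deriv[OF has_field_derivative_at_within[OF Q(3)] Q(1)])
  note dzeta = zeta_right_deriv[OF P s, folded om_def N_def]
  have "((\<lambda>s. \<rho> s powr ((p - 1) * mh) * s * z s powr (p - 1) * zeta \<rho> z s) has_real_derivative
     (((p - 1) * mh * R / \<rho> s * (- \<rho> s / z s) * s + R) * V + R * s * ((p - 1) * V / z s * (mh - om))) * zeta \<rho> z s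
     + R * s * V * (- zeta \<rho> z s / s - om * N / s + (p - 1) * om * zeta \<rho> z s / z s)) (at s within {s..})"
    by (rule DERIV_cong[OF DERIV_mult[OF DERIV_mult[OF DERIV_mult[OF dR DERIV_ident] dV] dzeta]])
       (simp add: R_def V_def mult_ac)
  moreover have "(((p - 1) * mh * R / \<rho> s * (- \<rho> s / z s) * s + R) * V + R * s * ((p - 1) * V / z s * (mh - om))) * zeta \<rho> z s
     + R * s * V * (- zeta \<rho> z s / s - om * N / s + (p - 1) * om * zeta \<rho> z s / z s) = - (R * V * om) * N"
    using s0 Q(1,2) by (simp add: field_simps)
  moreover have "HH \<rho> z = (\<lambda>s. \<rho> s powr ((p - 1) * mh) * s * z s powr (p - 1) * zeta \<rho> z s)" by (auto simp: HH_def)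
  ultimately show ?thesis unfolding R_def V_def by simp
qed

lemma om_pos:
  assumes P: "profile \<rho> z \<alpha>" and s: "u0 < s" "s < \<alpha>"
  shows "0 < kap (\<rho> s) * f s * z s powr (1 - p) / (p - 1)"
proof -
  have s0: "s > 0" using s u0 by simp
  show ?thesis using profileD(1,2)[OF P s0 s(2)] kap_pos f_pos[OF s(1)] p by simp
qed

text \<open>The bounds \<open>z powr (p - 1) \<le> f \<alpha> * J\<close> and
  \<open>kap / J \<ge> (p - 1) * mh + m\<close> push the reaction term above \<open>mh\<close>,
  because \<open>f s\<close> tends to \<open>f \<alpha>\<close> and \<open>m\<close> stays above a
  positive \<open>m0\<close> near the top.\<close>

lemma zeta_pos_near_top:
  assumes P: "profile \<rho> z \<alpha>"
  obtains a where "u0 < a" "a < \<alpha>" "\<And>s. a < s \<Longrightarrow> s < \<alpha> \<Longrightarrow> zeta \<rho> z s > 0"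
proof -
  have al: "\<alpha> > u0" using P unfolding profile_def by auto
  define s0 where "s0 = (u0 + \<alpha>) / 2"
  have s0: "u0 < s0" "s0 < \<alpha>" "0 < s0" using al u0 by (auto simp: s0_def)
  define k where "k = (p - 1) * mh"
  have k: "k > 0" using p mh by (simp add: k_def)
  define m0 where "m0 = m (\<rho> s0)"
  have m0: "m0 > 0" unfolding m0_def using m_pos profileD(1)[OF P s0(3,2)] by simp
  have fa: "f \<alpha> > 0" using f_pos al by simp
  have "isCont f \<alpha>" by (rule continuous_on_interior[OF f_cont]) (use al u0 in simp)
  then have "(f \<longlongrightarrow> f \<alpha>) (at_left \<alpha>)" unfolding isCont_def by (rule tendsto_within_subset) simp
  then have "((\<lambda>s. (k + m0) * f s) \<longlongrightarrow> (k + m0) * f \<alpha>) (at_left \<alpha>)" by (intro tendsto_intros)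
  moreover have "k * f \<alpha> < (k + m0) * f \<alpha>" using m0 fa by simp
  ultimately have "\<forall>\<^sub>F s in at_left \<alpha>. k * f \<alpha> < (k + m0) * f s" by (rule order_tendstoD(1))
  then obtain b where b: "b < \<alpha>" "\<And>s. b < s \<Longrightarrow> s < \<alpha> \<Longrightarrow> k * f \<alpha> < (k + m0) * f s"
    unfolding eventually_at_left_field by auto
  show thesis
  proof (rule that[of "max b s0"])
    fix s assume "max b s0 < s" and s: "s < \<alpha>"
    then have bs: "b < s" "s0 < s" by auto
    have su: "u0 < s" "0 < s" using bs s0 by auto
    note Q = profileD(1,2)[OF P su(2) s]
    have mm: "m0 \<le> m (\<rho> s)" unfolding m0_def
      using m_antimono[OF Q(1)] profile_rho_antimono[OF P s0(3) bs(2) s] by simp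
    have z: "z s powr (p - 1) \<le> f \<alpha> * J (\<rho> s)" using P su s unfolding profile_def by auto
    have j: "J (\<rho> s) > 0" using J_pos Q by simp
    have "(k + m0) * J (\<rho> s) \<le> kap (\<rho> s)"
    proof -
      have "k + m0 \<le> kap (\<rho> s) / J (\<rho> s)" using kap_J_ge[OF Q(1)] mm unfolding k_def by linarith
      then show ?thesis using j by (simp add: pos_le_divide_eq)
    qed
    then have 1: "(k + m0) * J (\<rho> s) * f s \<le> kap (\<rho> s) * f s" using f_pos[OF su(1)] by (intro mult_right_mono) auto
    have "k * z s powr (p - 1) \<le> k * (f \<alpha> * J (\<rho> s))" using z k by (intro mult_left_mono) auto
    also have "\<dots> = k * f \<alpha> * J (\<rho> s)" by simp
    also have "\<dots> < (k + m0) * f s * J (\<rho> s)" using b(2)[OF bs(1) s] j by (intro mult_strict_right_mono)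
    also have "\<dots> \<le> kap (\<rho> s) * f s" using 1 by (simp add: mult_ac)
    finally have "k * z s powr (p - 1) * z s powr (1 - p) < kap (\<rho> s) * f s * z s powr (1 - p)"
      using Q by (intro mult_strict_right_mono) auto
    moreover have "z s powr (p - 1) * z s powr (1 - p) = 1" using Q by (simp add: powr_add[symmetric])
    ultimately have "k < kap (\<rho> s) * f s * z s powr (1 - p)" by (simp add: mult.assoc)
    then have "mh < kap (\<rho> s) * f s * z s powr (1 - p) / (p - 1)"
      unfolding k_def using p by (simp add: field_simps)
    moreover have "z s / s > 0" using Q su by simp
    ultimately show "zeta \<rho> z s > 0" unfolding zeta_def by linarith
  qed (use b s0 in auto)
qed

text \<open>Where \<open>f \<le> 0\<close> the equation gives \<open>z' \<ge> mh\<close>, and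
  positivity of \<open>z\<close> takes the place of an initial value at level 0.\<close>

lemma z_ge_below:
  assumes P: "profile \<rho> z \<alpha>" and s: "0 < s" "s \<le> u0"
  shows "mh * s \<le> z s"
proof (rule field_le_epsilon)
  fix e :: real assume e: "e > 0"
  have al: "\<alpha> > u0" using P unfolding profile_def by auto
  define t where "t = min s (e / mh)"
  have t: "0 < t" "t \<le> s" "mh * t \<le> e" using s e mh unfolding t_def by (auto simp: min_def field_simps)
  have "z t - mh * t \<le> z s - mh * s"
  proof (rule DERIV_nonneg_imp_nondecreasing[OF t(2)])
    fix x assume x: "t \<le> x" "x \<le> s"
    then have xx: "0 < x" "x < \<alpha>" "x \<le> u0" using t s al by auto
    note Q = profileD[OF P xx(1,2)]
    have "((\<lambda>x. z x - mh * x) has_real_derivative mh - kap (\<rho> x) * f x * z x powr (1 - p) / (p - 1) - mh * 1) (at x)"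
      by (intro DERIV_diff Q(4) DERIV_cmult DERIV_ident)
    moreover have "kap (\<rho> x) * f x * z x powr (1 - p) / (p - 1) \<le> 0"
      using f_nonpos[OF xx(1,3)] kap_pos[OF Q(1)] p by (simp add: divide_le_0_iff mult_le_0_iff)
    ultimately show "\<exists>y. ((\<lambda>x. z x - mh * x) has_real_derivative y) (at x) \<and> 0 \<le> y" by force
  qed
  moreover have "z t > 0" using profileD(2)[OF P t(1)] t s al by simp
  ultimately show "mh * s \<le> z s + e" using t by simp
qed

lemma beta_antimono_zeta:
  assumes P: "profile \<rho> z \<alpha>" and s: "0 < a" "a \<le> b" "b < \<alpha>" and z: "\<And>s. a \<le> s \<Longrightarrow> s \<le> b \<Longrightarrow> zeta \<rho> z s \<ge> 0"
  shows "z b / b \<le> z a / a"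
proof (rule DERIV_nonpos_imp_nonincreasing[OF s(2)])
  fix x assume x: "a \<le> x" "x \<le> b"
  then have "0 < x" "x < \<alpha>" using s by auto
  from beta_deriv[OF P this] z[OF x] \<open>0 < x\<close>
  show "\<exists>y. ((\<lambda>s. z s / s) has_real_derivative y) (at x) \<and> y \<le> 0" by (intro exI conjI) auto
qed

text \<open>If \<open>zeta\<close> had a zero, take the largest one \<open>s2\<close>. The arc of the orbit above \<open>s2\<close> is a barrier
  for every later arc, so that \<open>beta\<close> can never exceed its value at \<open>s2\<close>, which is less than \<open>mh\<close>.\<close>

lemma zeta_pos:
  assumes P: "profile \<rho> z \<alpha>" and ss: "u0 < ss" "ss < \<alpha>"
  shows "zeta \<rho> z ss > 0"
proof (rule ccontr)
  assume "\<not> zeta \<rho> z ss > 0"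
  then have ssn: "zeta \<rho> z ss \<le> 0" by simp
  obtain a where a: "u0 < a" "a < \<alpha>" "\<And>s. a < s \<Longrightarrow> s < \<alpha> \<Longrightarrow> zeta \<rho> z s > 0" using zeta_pos_near_top[OF P] by blast
  have ssa: "ss \<le> a" using a(3)[of ss] ssn ss by force
  define \<beta> where "\<beta> = (\<lambda>s. z s / s)"
  define \<zeta> where "\<zeta> = zeta \<rho> z"
  have contz: "continuous_on {x..y} \<zeta>" if "0 < x" "y < \<alpha>" for x y
    unfolding \<zeta>_def by (intro continuous_at_imp_continuous_on ballI zeta_cont[OF P]) (use that in auto)
  have contb: "continuous_on {x..y} \<beta>" if "0 < x" "y < \<alpha>" for x y
    unfolding \<beta>_def by (intro continuous_at_imp_continuous_on ballI beta_isCont[OF P]) (use that in auto)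
  have pos: "s > 0" if "s > u0" for s using that u0 by simp
  define Z where "Z = {s \<in> {ss..a}. \<zeta> s \<le> 0}"
  have "closed Z" unfolding Z_def
    by (intro continuous_on_closed_Collect_le contz continuous_on_const closed_atLeastAtMost) (use pos ss a in auto)
  moreover have "ss \<in> Z" using ssn ssa by (auto simp: Z_def \<zeta>_def)
  moreover have bZ: "bdd_above Z" by (auto simp: Z_def)
  ultimately have "Sup Z \<in> Z" by (intro closed_contains_Sup) auto
  define s2 where "s2 = Sup Z"
  have s2: "ss \<le> s2" "s2 \<le> a" "\<zeta> s2 \<le> 0" using \<open>Sup Z \<in> Z\<close> by (auto simp: s2_def Z_def)
  have above: "\<zeta> s > 0" if "s2 < s" "s < \<alpha>" for s
  proof (rule ccontr)
    assume n: "\<not> \<zeta> s > 0"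
    then have "s \<le> a" using a(3)[of s] that by (force simp: \<zeta>_def)
    then have "s \<in> Z" using n that s2 by (auto simp: Z_def)
    then have "s \<le> s2" unfolding s2_def using bZ by (rule cSup_upper)
    then show False using that by simp
  qed
  have s2u: "u0 < s2" "s2 < \<alpha>" "0 < s2" using s2 a ss u0 by auto
  have z0: "\<zeta> s2 = 0"
  proof -
    have "(\<zeta> \<longlongrightarrow> \<zeta> s2) (at_right s2)"
      using zeta_cont[OF P s2u(3,2)] unfolding isCont_def \<zeta>_def by (rule tendsto_within_subset) simp
    moreover have "\<forall>\<^sub>F s in at_right s2. 0 \<le> \<zeta> s"
      using eventually_at_right_real[OF s2u(2)] by eventually_elim (auto intro!: less_imp_le[OF above])
    ultimately have "0 \<le> \<zeta> s2" by (intro tendsto_lowerbound) auto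
    then show ?thesis using s2 by simp
  qed
  define \<beta>2 where "\<beta>2 = \<beta> s2"
  have b2: "\<beta>2 < mh" using z0 om_pos[OF P s2u(1,2)] unfolding \<beta>2_def \<beta>_def \<zeta>_def zeta_def by simp
  have b2p: "\<beta>2 > 0" using profileD(2)[OF P s2u(3,2)] s2u unfolding \<beta>2_def \<beta>_def by simp
  define N where "N s = m (\<rho> s) * s / z s - (g s - (p - 1))" for s
  have Neq: "N s = m (\<rho> s) / \<beta> s - (g s - (p - 1))" for s unfolding N_def \<beta>_def by simp
  have bp: "\<beta> s > 0" if "u0 < s" "s < \<alpha>" for s using profileD(2)[OF P pos[OF that(1)] that(2)] pos[OF that(1)] unfolding \<beta>_def by simp
  have rp: "\<rho> s > 0" if "u0 < s" "s < \<alpha>" for s using profileD(1)[OF P pos[OF that(1)] that(2)] .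
  have dec2: "\<beta> t \<le> \<beta> s" if "s2 \<le> s" "s \<le> t" "t < \<alpha>" for s t
    unfolding \<beta>_def
  proof (rule beta_antimono_zeta[OF P])
    fix x assume "s \<le> x" "x \<le> t"
    then show "0 \<le> zeta \<rho> z x" using above[of x] z0 that unfolding \<zeta>_def by (cases "x = s2") (auto intro: less_imp_le)
  qed (use that s2u in auto)
  \<comment> \<open>If \<open>N s2 > 0\<close>, then \<open>N\<close> is positive on all levels
    above \<open>s2\<close>, where \<open>\<beta>\<close> and \<open>g\<close> are no larger and
    \<open>m\<close> is no smaller. So \<open>HH\<close> would be nonincreasing from its value 0,
    and \<open>zeta\<close> could not be positive above \<open>s2\<close>.\<close>
  have N2: "N s2 \<le> 0"
  proof (rule ccontr)
    assume "\<not> N s2 \<le> 0"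
    then have n: "N s2 > 0" by simp
    define t where "t = (s2 + \<alpha>) / 2"
    have t: "s2 < t" "t < \<alpha>" using s2u by (auto simp: t_def)
    have "- HH \<rho> z s2 \<le> - HH \<rho> z t"
    proof (rule right_deriv_nonneg_imp_le[of s2 t "\<lambda>s. - HH \<rho> z s"])
      show "continuous_on {s2..t} (\<lambda>s. - HH \<rho> z s)" by (intro continuous_intros HH_cont[OF P]) (use s2u t in auto)
      fix x assume x: "s2 \<le> x" "x < t"
      then have xx: "u0 < x" "x < \<alpha>" using s2u t by auto
      have "\<beta> x \<le> \<beta>2" unfolding \<beta>2_def using dec2[of s2 x] x t by auto
      moreover have "m (\<rho> s2) \<le> m (\<rho> x)"
        using m_antimono[OF rp[OF xx], of "\<rho> s2"] profile_rho_antimono[OF P s2u(3), of x] x xx by (cases "x = s2") auto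
      ultimately have "m (\<rho> s2) / \<beta>2 \<le> m (\<rho> x) / \<beta> x"
        using bp[OF xx] m_pos[OF rp[OF s2u(1,2)]] by (intro frac_le) auto
      moreover have "g x \<le> g s2" using g_antimono[OF s2u(1) x(1)] .
      ultimately have "N x \<ge> N s2" unfolding Neq \<beta>2_def by simp
      then have "N x \<ge> 0" using n by simp
      moreover have "((\<lambda>s. - HH \<rho> z s) has_real_derivative - (- (\<rho> x powr ((p - 1) * mh) * z x powr (p - 1) * (kap (\<rho> x) * f x * z x powr (1 - p) / (p - 1))) * N x)) (at x within {x..})"
        unfolding N_def by (rule DERIV_minus[OF HH_right_deriv[OF P xx]])
      moreover have "0 \<le> - (- (\<rho> x powr ((p - 1) * mh) * z x powr (p - 1) * (kap (\<rho> x) * f x * z x powr (1 - p) / (p - 1))) * N x)"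
        unfolding mult_minus_left minus_minus using om_pos[OF P xx] \<open>N x \<ge> 0\<close>
        by (intro mult_nonneg_nonneg less_imp_le[OF om_pos[OF P xx]]) auto
      ultimately show "\<exists>d\<ge>0. ((\<lambda>s. - HH \<rho> z s) has_real_derivative d) (at x within {x..})" by blast
    qed (use t in auto)
    moreover have "HH \<rho> z s2 = 0" using z0 HH_sgn(2)[OF P s2u(3,2)] unfolding \<zeta>_def by simp
    ultimately have "zeta \<rho> z t \<le> 0" using HH_sgn(1)[OF P, of t] t s2u by simp
    then show False using above[OF t] unfolding \<zeta>_def by simp
  qed
  have al: "u0 < \<alpha>" using P unfolding profile_def by auto
  \<comment> \<open>Since \<open>\<beta> u0 \<ge> mh > \<beta>2\<close>, some \<open>s5\<close> just
    above \<open>u0\<close> still has \<open>\<beta> s5 > \<beta>2\<close>; \<open>s4\<close> is the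
    first level after it at which \<open>\<beta>\<close> has come down to
    \<open>\<beta>2\<close>.\<close>
  have "mh \<le> \<beta> u0" using z_ge_below[OF P u0 order_refl] u0 unfolding \<beta>_def by (simp add: field_simps)
  then have "\<beta>2 < \<beta> u0" using b2 by simp
  moreover have "(\<beta> \<longlongrightarrow> \<beta> u0) (at_right u0)"
    using beta_isCont[OF P u0 al] unfolding isCont_def \<beta>_def by (rule tendsto_within_subset) simp
  ultimately have "\<forall>\<^sub>F s in at_right u0. \<beta>2 < \<beta> s" by (intro order_tendstoD(1))
  then have "\<forall>\<^sub>F s in at_right u0. \<beta>2 < \<beta> s \<and> s \<in> {u0<..<s2}"
    using eventually_at_right_real[OF s2u(1)] by eventually_elim simp
  from eventually_happens[OF this] obtain s5 where s5: "\<beta>2 < \<beta> s5" "u0 < s5" "s5 < s2" by auto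
  define L where "L = {s \<in> {s5..s2}. \<beta> s \<le> \<beta>2}"
  have "closed L" unfolding L_def
    by (intro continuous_on_closed_Collect_le contb continuous_on_const closed_atLeastAtMost) (use pos s5 s2u in auto)
  moreover have "s2 \<in> L" using s5 by (auto simp: L_def \<beta>2_def)
  moreover have bL: "bdd_below L" by (auto simp: L_def)
  ultimately have "Inf L \<in> L" by (intro closed_contains_Inf) auto
  define s4 where "s4 = Inf L"
  have s4: "s5 \<le> s4" "s4 \<le> s2" "\<beta> s4 \<le> \<beta>2" using \<open>Inf L \<in> L\<close> by (auto simp: s4_def L_def)
  have s54: "s5 < s4" using s4 s5 by (cases "s4 = s5") auto
  have left4: "\<beta>2 < \<beta> s" if "s5 \<le> s" "s < s4" for s
  proof (rule ccontr)
    assume "\<not> \<beta>2 < \<beta> s"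
    then have "s \<in> L" using that s4 by (auto simp: L_def)
    then have "s4 \<le> s" unfolding s4_def using bL by (rule cInf_lower)
    then show False using that by simp
  qed
  have s4u: "u0 < s4" "s4 < \<alpha>" "0 < s4" using s4 s5 s2u u0 by auto
  have b4: "\<beta> s4 = \<beta>2"
  proof -
    have "(\<beta> \<longlongrightarrow> \<beta> s4) (at_left s4)"
      using beta_isCont[OF P s4u(3,2)] unfolding isCont_def \<beta>_def by (rule tendsto_within_subset) simp
    moreover have "\<forall>\<^sub>F s in at_left s4. \<beta>2 \<le> \<beta> s"
      using eventually_at_left_real[OF s54] by eventually_elim (auto intro!: less_imp_le[OF left4])
    ultimately have "\<beta>2 \<le> \<beta> s4" by (intro tendsto_lowerbound) auto
    then show ?thesis using s4 by simp
  qed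
  \<comment> \<open>Otherwise \<open>\<beta>\<close> decreases beyond \<open>s4\<close> to a value
    \<open>\<beta>3\<close> at the next zero \<open>s3\<close> of \<open>\<zeta>\<close>. The arc
    over \<open>(s4, s3)\<close> is compared with the arc above \<open>s2\<close>, from a value of
    \<open>\<beta>\<close> near \<open>\<beta>3\<close> up to values near \<open>\<beta>2\<close>.
    There \<open>\<zeta>\<close> on the lower arc is at most \<open>\<zeta>\<close> on the upper
    one, which tends to \<open>\<zeta> s2 = 0\<close>, against
    \<open>\<zeta> s4 > 0\<close>.\<close>
  have z4: "\<zeta> s4 \<le> 0"
  proof (rule ccontr)
    assume "\<not> \<zeta> s4 \<le> 0"
    then have e: "\<zeta> s4 > 0" by simp
    have s42: "s4 < s2" using e z0 s4 by (cases "s4 = s2") auto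
    define M where "M = {s \<in> {s4..s2}. \<zeta> s \<le> 0}"
    have "closed M" unfolding M_def
      by (intro continuous_on_closed_Collect_le contz continuous_on_const closed_atLeastAtMost) (use s4u s2u in auto)
    moreover have "s2 \<in> M" using s42 z0 by (auto simp: M_def)
    moreover have bM: "bdd_below M" by (auto simp: M_def)
    ultimately have "Inf M \<in> M" by (intro closed_contains_Inf) auto
    define s3 where "s3 = Inf M"
    have s3: "s4 \<le> s3" "s3 \<le> s2" "\<zeta> s3 \<le> 0" using \<open>Inf M \<in> M\<close> by (auto simp: s3_def M_def)
    have s43: "s4 < s3" using s3 e by (cases "s3 = s4") auto
    have between: "\<zeta> s > 0" if "s4 \<le> s" "s < s3" for s
    proof (rule ccontr)
      assume "\<not> \<zeta> s > 0"
      then have "s \<in> M" using that s3 by (auto simp: M_def)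
      then have "s3 \<le> s" unfolding s3_def using bM by (rule cInf_lower)
      then show False using that by simp
    qed
    have s3u: "u0 < s3" "s3 < \<alpha>" "0 < s3" using s3 s2u s4u by auto
    have z3: "\<zeta> s3 = 0"
    proof -
      have "(\<zeta> \<longlongrightarrow> \<zeta> s3) (at_left s3)"
        using zeta_cont[OF P s3u(3,2)] unfolding isCont_def \<zeta>_def by (rule tendsto_within_subset) simp
      moreover have "\<forall>\<^sub>F s in at_left s3. 0 \<le> \<zeta> s"
        using eventually_at_left_real[OF s43] by eventually_elim (auto intro!: less_imp_le[OF between])
      ultimately have "0 \<le> \<zeta> s3" by (intro tendsto_lowerbound) auto
      then show ?thesis using s3 by simp
    qed
    have sdec: "\<beta> t < \<beta> s" if "s4 \<le> s" "s < t" "t \<le> s3" for s t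
    proof (rule DERIV_neg_imp_decreasing_open[OF that(2)])
      fix x assume x: "s < x" "x < t"
      then have xx: "0 < x" "x < \<alpha>" using that s4u s3u by auto
      have "\<zeta> x > 0" using between x that by auto
      then show "\<exists>y. (\<beta> has_real_derivative y) (at x) \<and> y < 0"
        using beta_deriv[OF P xx] xx(1) unfolding \<beta>_def \<zeta>_def by (intro exI conjI) auto
      next show "continuous_on {s..t} \<beta>" using contb[of s t] that s4u s3u by auto
    qed
    define \<beta>3 where "\<beta>3 = \<beta> s3"
    have b3: "\<beta>3 < \<beta>2" using sdec[of s4 s3] s43 b4 by (simp add: \<beta>3_def)
    have b3p: "\<beta>3 > 0" unfolding \<beta>3_def using bp s3u by simp
    have s32: "s3 < s2" using s3 b3 by (cases "s3 = s2") (auto simp: \<beta>3_def \<beta>2_def)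
    obtain S where S: "\<And>s. s2 < s \<Longrightarrow> s < \<alpha> \<Longrightarrow> S (z s / s) = s"
      "\<And>s. s2 < s \<Longrightarrow> s < \<alpha> \<Longrightarrow> (S has_real_derivative - (s / zeta \<rho> z s)) (at (z s / s))"
      "\<And>s t x. s2 < s \<Longrightarrow> s \<le> t \<Longrightarrow> t < \<alpha> \<Longrightarrow> z t / t \<le> x \<Longrightarrow> x \<le> z s / s \<Longrightarrow> s \<le> S x \<and> S x \<le> t \<and> z (S x) / S x = x"
      "\<And>s t. s2 < s \<Longrightarrow> s < t \<Longrightarrow> t < \<alpha> \<Longrightarrow> z t / t < z s / s"
      by (rule arc_inverse[OF P less_imp_le[OF s2u(1)] order_refl above[unfolded \<zeta>_def]]) blast+
    obtain w where w: "s2 < w" "w < \<alpha>" "\<beta> w = \<beta>3"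
    proof -
      obtain t where t: "s2 < t" "t < \<alpha>" "z t / t < \<beta>3" using beta_small[OF P b3p s2u(2)] .
      obtain w where "s2 \<le> w" "w \<le> t" "z w / w = \<beta>3"
        using beta_IVT[OF P s2u(3), of t \<beta>3] t b3 unfolding \<beta>2_def \<beta>_def by auto
      moreover have "w \<noteq> s2" using calculation b3 unfolding \<beta>2_def \<beta>_def by auto
      ultimately show thesis using that[of w] t unfolding \<beta>_def by auto
    qed
    \<comment> \<open>At the common value \<open>\<beta>3\<close> the lower arc has
      \<open>\<zeta> = 0\<close> and the upper one \<open>\<zeta> > 0\<close>. By continuity the
      resulting strict inequality persists at a level \<open>b\<close> inside the open lower arc,
      where \<open>comparison\<close> can start.\<close>
    have y3: "yy \<rho> s3 < yy \<rho> w"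
    proof -
      have "zeta \<rho> z s3 = \<beta>3 - mh + yy \<rho> s3 * \<beta>3 powr (1 - p) / (p - 1)"
        using zeta_yy[OF s3u(3), of z \<rho>] profileD(2)[OF P s3u(3,2)] unfolding \<beta>3_def \<beta>_def by simp
      moreover have "zeta \<rho> z w = \<beta>3 - mh + yy \<rho> w * \<beta>3 powr (1 - p) / (p - 1)"
        using zeta_yy[of w z \<rho>] profileD(2)[OF P, of w] w s2u unfolding \<beta>_def by simp
      ultimately have "yy \<rho> s3 * \<beta>3 powr (1 - p) / (p - 1) < yy \<rho> w * \<beta>3 powr (1 - p) / (p - 1)"
        using z3 above[OF w(1,2)] unfolding \<zeta>_def by simp
      then show ?thesis using p by (simp add: divide_less_cancel mult_less_cancel_right)
    qed
    have "isCont S \<beta>3" using DERIV_isCont[OF S(2)[OF w(1,2)]] w(3) unfolding \<beta>_def by simp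
    moreover have "isCont \<beta> s3" unfolding \<beta>_def using beta_isCont[OF P s3u(3,2)] .
    ultimately have "isCont (\<lambda>s. S (\<beta> s)) s3" unfolding \<beta>3_def by (intro isCont_o2[of s3 \<beta> S])
    moreover have Sw: "S (\<beta> s3) = w" using S(1)[OF w(1,2)] w(3) unfolding \<beta>3_def \<beta>_def by simp
    moreover have "isCont (yy \<rho>) w" using yy_cont[OF P _ w(2)] w(1) s2u by simp
    ultimately have "isCont (\<lambda>s. yy \<rho> (S (\<beta> s))) s3" by (intro isCont_o2[of s3 "\<lambda>s. S (\<beta> s)" "yy \<rho>"]) simp_all
    then have "isCont (\<lambda>s. yy \<rho> (S (\<beta> s)) - yy \<rho> s) s3" using yy_cont[OF P s3u(3,2)] by (intro continuous_intros)
    then have "((\<lambda>s. yy \<rho> (S (\<beta> s)) - yy \<rho> s) \<longlongrightarrow> yy \<rho> w - yy \<rho> s3) (at_left s3)"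
      unfolding isCont_def Sw by (rule tendsto_within_subset) simp
    from order_tendstoD(1)[OF this, of 0] y3 have ev1: "\<forall>\<^sub>F s in at_left s3. 0 < yy \<rho> (S (\<beta> s)) - yy \<rho> s" by simp
    have "(\<beta> \<longlongrightarrow> \<beta>3) (at_left s3)"
      using \<open>isCont \<beta> s3\<close> unfolding isCont_def \<beta>3_def by (rule tendsto_within_subset) simp
    from order_tendstoD(2)[OF this b3] have ev2: "\<forall>\<^sub>F s in at_left s3. \<beta> s < \<beta>2" .
    have "\<forall>\<^sub>F s in at_left s3. 0 < yy \<rho> (S (\<beta> s)) - yy \<rho> s \<and> \<beta> s < \<beta>2 \<and> s \<in> {s4<..<s3}"
      using ev1 ev2 eventually_at_left_real[OF s43] by eventually_elim simp
    from eventually_happens[OF this] obtain b where b: "0 < yy \<rho> (S (\<beta> b)) - yy \<rho> b" "s4 < b" "b < s3" by auto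
    obtain match: "\<exists>t. s2 < t \<and> t < \<alpha> \<and> \<beta> t = x" if "0 < x" "x < \<beta>2" for x
    proof -
      have "\<exists>t. s2 < t \<and> t < \<alpha> \<and> \<beta> t = x" if x: "0 < x" "x < \<beta>2" for x
      proof -
        obtain t where t: "s2 < t" "t < \<alpha>" "z t / t < x" using beta_small[OF P x(1) s2u(2)] .
        obtain w where "s2 \<le> w" "w \<le> t" "z w / w = x"
          using beta_IVT[OF P s2u(3), of t x] t x unfolding \<beta>2_def \<beta>_def by auto
        moreover have "w \<noteq> s2" using calculation x unfolding \<beta>2_def \<beta>_def by auto
        ultimately show ?thesis using t unfolding \<beta>_def by (intro exI[of _ w]) auto
      qed
      then show thesis using that by blast
    qed
    have bb: "0 < \<beta> b" "\<beta> b < \<beta>2" using bp[of b] sdec[of s4 b] b b4 s4u s3u by auto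
    obtain a1 where a1: "s2 < a1" "a1 < \<alpha>" "\<beta> a1 = \<beta> b" using match[OF bb] by blast
    have Sa1: "S (\<beta> b) = a1" using S(1)[OF a1(1,2)] a1(3) unfolding \<beta>_def by simp
    \<comment> \<open>\<open>\<zeta> s4 / 2\<close> serves as threshold: \<open>\<zeta>\<close> lies
      above it just after \<open>s4\<close> and below it just after \<open>s2\<close>.\<close>
    obtain \<delta> where \<delta>: "\<delta> > 0" "s4 + \<delta> \<le> b" "\<And>s. s4 \<le> s \<Longrightarrow> s < s4 + \<delta> \<Longrightarrow> \<zeta> s > \<zeta> s4 / 2"
    proof -
      have "(\<zeta> \<longlongrightarrow> \<zeta> s4) (at_right s4)"
        using zeta_cont[OF P s4u(3,2)] unfolding isCont_def \<zeta>_def by (rule tendsto_within_subset) simp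
      then have "\<forall>\<^sub>F s in at_right s4. \<zeta> s4 / 2 < \<zeta> s" using e by (intro order_tendstoD(1)) auto
      then obtain c where c: "c > s4" "\<And>s. s4 < s \<Longrightarrow> s < c \<Longrightarrow> \<zeta> s4 / 2 < \<zeta> s" unfolding eventually_at_right_field by auto
      show thesis
      proof (rule that[of "min (c - s4) (b - s4)"])
        fix s assume "s4 \<le> s" "s < s4 + min (c - s4) (b - s4)"
        then show "\<zeta> s > \<zeta> s4 / 2" using c(2)[of s] e by (cases "s = s4") auto
      qed (use c b in auto)
    qed
    have "(\<zeta> \<longlongrightarrow> \<zeta> s2) (at_right s2)"
      using zeta_cont[OF P s2u(3,2)] unfolding isCont_def \<zeta>_def by (rule tendsto_within_subset) simp
    then have f1: "\<forall>\<^sub>F s in at_right s2. \<zeta> s < \<zeta> s4 / 2" using z0 e by (intro order_tendstoD(2)) auto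
    have "(\<beta> \<longlongrightarrow> \<beta>2) (at_right s2)"
      using beta_isCont[OF P s2u(3,2)] unfolding isCont_def \<beta>_def \<beta>2_def by (rule tendsto_within_subset) simp
    moreover have "\<beta> (s4 + \<delta> / 2) < \<beta>2" using sdec[of s4 "s4 + \<delta> / 2"] \<delta> b b4 by auto
    ultimately have f2: "\<forall>\<^sub>F s in at_right s2. \<beta> (s4 + \<delta> / 2) < \<beta> s" by (intro order_tendstoD(1))
    have "\<forall>\<^sub>F s in at_right s2. \<zeta> s < \<zeta> s4 / 2 \<and> \<beta> (s4 + \<delta> / 2) < \<beta> s \<and> s \<in> {s2<..<\<alpha>}"
      using f1 f2 eventually_at_right_real[OF s2u(2)] by eventually_elim simp
    from eventually_happens[OF this] obtain t1 where t1: "\<zeta> t1 < \<zeta> s4 / 2" "\<beta> (s4 + \<delta> / 2) < \<beta> t1" "s2 < t1" "t1 < \<alpha>" by auto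
    have "\<beta> t1 \<le> \<beta> s4" using dec2[of s2 t1] t1 b4 unfolding \<beta>2_def by auto
    then obtain t2 where t2: "s4 \<le> t2" "t2 \<le> s4 + \<delta> / 2" "\<beta> t2 = \<beta> t1"
      using beta_IVT[OF P s4u(3), of "s4 + \<delta> / 2" "\<beta> t1"] t1 \<delta> b s3u unfolding \<beta>_def by auto
    have "t2 \<noteq> s4" 
    proof
      assume "t2 = s4"
      then have "\<beta> t1 = \<beta> s2" using t2 b4 unfolding \<beta>2_def by simp
      moreover have "\<beta> t1 < \<beta> ((s2 + t1) / 2)" using S(4)[of "(s2 + t1) / 2" t1] t1 unfolding \<beta>_def by auto
      moreover have "\<beta> ((s2 + t1) / 2) \<le> \<beta> s2" using dec2[of s2 "(s2 + t1) / 2"] t1 by auto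
      ultimately show False by simp
    qed
    then have t2': "s4 < t2" "t2 < s3" using t2 \<delta> b by auto
    have "t2 < t1 \<and> \<rho> t1 < \<rho> t2 \<and> yy \<rho> t2 \<le> yy \<rho> t1"
    proof (rule comparison[OF P less_imp_le[OF s2u(1)] order_refl above[unfolded \<zeta>_def] P less_imp_le[OF s4u(1)] less_imp_le[OF s3u(2)]])
      show "s2 < a1" "a1 < \<alpha>" "s4 < b" "b < s3" "z a1 / a1 = z b / b" using a1 b unfolding \<beta>_def by auto
      show "b < a1" using a1 b s32 by simp
      then show "\<rho> a1 < \<rho> b" using profile_rho_antimono[OF P] b s4u a1 by simp
      show "yy \<rho> b \<le> yy \<rho> a1" using b Sa1 by simp
      show "s2 < t1" "t1 < \<alpha>" "s4 < t2" "t2 < s3" "z t1 / t1 = z t2 / t2" using t1 t2 t2' unfolding \<beta>_def by auto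
      show "z a1 / a1 \<le> z t1 / t1"
      proof -
        have "\<beta> b \<le> \<beta> (s4 + \<delta> / 2)" using sdec[of "s4 + \<delta> / 2" b] \<delta> b by (cases "b = s4 + \<delta> / 2") auto
        then show ?thesis using a1(3) t1(2) unfolding \<beta>_def by simp
      qed
    qed (use between in \<open>auto simp: \<zeta>_def\<close>)
    then have "yy \<rho> t2 * \<beta> t1 powr (1 - p) / (p - 1) \<le> yy \<rho> t1 * \<beta> t1 powr (1 - p) / (p - 1)"
      using p by (intro divide_right_mono mult_right_mono) auto
    moreover have "\<zeta> t1 = \<beta> t1 - mh + yy \<rho> t1 * \<beta> t1 powr (1 - p) / (p - 1)"
      using zeta_yy[of t1 z \<rho>] profileD(2)[OF P, of t1] t1 s2u unfolding \<beta>_def \<zeta>_def by simp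
    moreover have "\<zeta> t2 = \<beta> t2 - mh + yy \<rho> t2 * \<beta> t2 powr (1 - p) / (p - 1)"
      using zeta_yy[of t2 z \<rho>] profileD(2)[OF P, of t2] t2' s4u s3u unfolding \<beta>_def \<zeta>_def by simp
    ultimately have "\<zeta> t2 \<le> \<zeta> t1" using t2(3) by simp
    moreover have "\<zeta> t2 > \<zeta> s4 / 2" using \<delta>(3)[of t2] t2 \<delta>(1) by simp
    ultimately show False using t1 by simp
  qed
  \<comment> \<open>On levels from \<open>s5\<close> up to \<open>s4\<close> one has
    \<open>\<beta> > \<beta>2\<close>, a larger radius and a lower level than at \<open>s2\<close>,
    so \<open>N \<le> N s2 \<le> 0\<close> and \<open>HH\<close> rises to its nonpositive value at
    \<open>s4\<close>. Hence \<open>zeta \<le> 0\<close> and \<open>\<beta>\<close> cannot fall from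
    \<open>s5\<close> to \<open>s4\<close>.\<close>
  have "\<beta> s5 \<le> \<beta> s4"
  proof (rule DERIV_nonneg_imp_nondecreasing[OF s4(1)])
    fix x assume x: "s5 \<le> x" "x \<le> s4"
    then have xx: "u0 < x" "x < \<alpha>" "0 < x" using s5 s4u u0 by auto
    have "HH \<rho> z x \<le> HH \<rho> z s4"
    proof (rule right_deriv_nonneg_imp_le[OF x(2), of "HH \<rho> z"])
      show "continuous_on {x..s4} (HH \<rho> z)" by (rule HH_cont[OF P]) (use xx s4u in auto)
      fix t assume t: "x \<le> t" "t < s4"
      then have tt: "u0 < t" "t < \<alpha>" "s5 \<le> t" "t < s2" using x xx s4u s4 by auto
      have "m (\<rho> t) \<le> m (\<rho> s2)"
        using m_antimono[OF rp[OF s2u(1,2)], of "\<rho> t"] profile_rho_antimono[OF P pos[OF tt(1)] tt(4) s2u(2)] by auto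
      then have "m (\<rho> t) / \<beta> t \<le> m (\<rho> s2) / \<beta>2"
        using left4[OF tt(3) t(2)] b2p m_pos[OF rp[OF s2u(1,2)]] by (intro frac_le) auto
      moreover have "g s2 \<le> g t" using g_antimono[OF tt(1)] tt by simp
      ultimately have "N t \<le> N s2" unfolding Neq \<beta>2_def by simp
      then have Nt: "N t \<le> 0" using N2 by simp
      have "0 \<le> - (\<rho> t powr ((p - 1) * mh) * z t powr (p - 1) * (kap (\<rho> t) * f t * z t powr (1 - p) / (p - 1))) * N t"
        using Nt by (intro mult_nonpos_nonpos) (auto intro!: mult_nonneg_nonneg less_imp_le[OF om_pos[OF P tt(1,2)]] simp del: times_divide_eq_right)
      then show "\<exists>d\<ge>0. (HH \<rho> z has_real_derivative d) (at t within {t..})"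
        using HH_right_deriv[OF P tt(1,2)] unfolding N_def by blast
    qed
    also have "\<dots> \<le> 0" using z4 HH_sgn(1)[OF P s4u(3,2)] unfolding \<zeta>_def by simp
    finally have "zeta \<rho> z x \<le> 0" using HH_sgn(1)[OF P xx(3,2)] by simp
    then show "\<exists>y. (\<beta> has_real_derivative y) (at x) \<and> 0 \<le> y"
      using beta_deriv[OF P xx(3,2)] xx(3) unfolding \<beta>_def by (intro exI conjI) (auto simp: divide_nonpos_pos)
  qed
  then show False using s5 b4 by simp
qed

end

section \<open>Order of two profiles\<close>

text \<open>The weights \<open>exp (- C * x)\<close> and \<open>exp (C * x)\<close> carry the
  estimate forward and backward from \<open>x0\<close>.\<close>

lemma Gronwall_zero:
  fixes W W' :: "real \<Rightarrow> real"
  assumes der: "\<And>x. x \<in> {c..d} \<Longrightarrow> (W has_real_derivative W' x) (at x)"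
    and bound: "\<And>x. x \<in> {c..d} \<Longrightarrow> \<bar>W' x\<bar> \<le> C * W x"
    and nonneg: "\<And>x. x \<in> {c..d} \<Longrightarrow> 0 \<le> W x" and x0: "x0 \<in> {c..d}" "W x0 = 0" and x: "x \<in> {c..d}"
  shows "W x = 0"
proof (cases "x0 \<le> x")
  case True
  have "W x * exp (- C * x) \<le> W x0 * exp (- C * x0)"
  proof (rule DERIV_nonpos_imp_nonincreasing[OF True])
    fix t assume "x0 \<le> t" "t \<le> x"
    then have t: "t \<in> {c..d}" using x0 x by auto
    have "((\<lambda>x. W x * exp (- C * x)) has_real_derivative (W' t - C * W t) * exp (- C * t)) (at t)"
      by (auto intro!: derivative_eq_intros der[OF t] simp: algebra_simps)
    moreover have "(W' t - C * W t) * exp (- C * t) \<le> 0" using bound[OF t] by (intro mult_nonpos_nonneg) auto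
    ultimately show "\<exists>y. ((\<lambda>x. W x * exp (- C * x)) has_real_derivative y) (at t) \<and> y \<le> 0" by blast
  qed
  then have "W x * exp (- C * x) \<le> 0" using x0 by simp
  then have "W x \<le> 0" by (simp add: mult_le_0_iff)
  then show ?thesis using nonneg[OF x] by simp
next
  case False
  then have xx: "x \<le> x0" by simp
  have "W x * exp (C * x) \<le> W x0 * exp (C * x0)"
  proof (rule DERIV_nonneg_imp_nondecreasing[OF xx])
    fix t assume "x \<le> t" "t \<le> x0"
    then have t: "t \<in> {c..d}" using x0 x by auto
    have "((\<lambda>x. W x * exp (C * x)) has_real_derivative (W' t + C * W t) * exp (C * t)) (at t)"
      by (auto intro!: derivative_eq_intros der[OF t] simp: algebra_simps)
    moreover have "(W' t + C * W t) * exp (C * t) \<ge> 0" using bound[OF t] by (intro mult_nonneg_nonneg) auto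
    ultimately show "\<exists>y. ((\<lambda>x. W x * exp (C * x)) has_real_derivative y) (at t) \<and> y \<ge> 0" by blast
  qed
  then have "W x * exp (C * x) \<le> 0" using x0 by simp
  then have "W x \<le> 0" by (simp add: mult_le_0_iff)
  then show ?thesis using nonneg[OF x] by simp
qed

lemma exp_diff_le:
  fixes x y :: real
  assumes "exp x \<le> E" "exp y \<le> E"
  shows "\<bar>exp x - exp y\<bar> \<le> E * \<bar>x - y\<bar>"
proof -
  have *: "exp b - exp a \<le> exp b * (b - a)" for a b :: real
  proof -
    have "1 + (a - b) \<le> exp (a - b)" by (rule exp_ge_add_one_self)
    then have "exp b * (1 + (a - b)) \<le> exp b * exp (a - b)" by (intro mult_left_mono) auto
    also have "exp b * exp (a - b) = exp a" by (simp add: exp_diff)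
    finally show ?thesis by (simp add: algebra_simps)
  qed
  show ?thesis
  proof (cases "x \<le> y")
    case True
    then have "exp y - exp x \<le> E * (y - x)"
      using *[of y x] mult_right_mono[OF assms(2), of "y - x"] by linarith
    then show ?thesis using True by (simp add: abs_if)
  next
    case False
    then have "exp x - exp y \<le> E * (x - y)"
      using *[of x y] mult_right_mono[OF assms(1), of "x - y"] by linarith
    then show ?thesis using False by (simp add: abs_if)
  qed
qed

section \<open>Order of slopes above \<open>u0\<close> and its consequences below\<close>

context profile_system begin

text \<open>\<open>small_beta_start\<close> provides the ordering at one small value of
  \<open>z / s\<close>, and \<open>comparison\<close> transports it to every larger common value;
  both rely on \<open>zeta > 0\<close> at all levels between \<open>u0\<close> and the tops.\<close>

lemma beta_order:
  assumes P1: "profile \<rho>1 z1 \<alpha>1" and P2: "profile \<rho>2 z2 \<alpha>2" and less: "\<alpha>2 < \<alpha>1"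
    and s: "u0 < s1" "s1 < \<alpha>1" "u0 < s2" "s2 < \<alpha>2" "z1 s1 / s1 = z2 s2 / s2"
  shows "s2 < s1"
proof -
  have bp: "z1 s1 / s1 > 0" using profileD(2)[OF P1, of s1] s(1,2) u0 by simp
  obtain a1 a2 where a: "u0 < a1" "a1 < \<alpha>1" "u0 < a2" "a2 < \<alpha>2" "z1 a1 / a1 = z2 a2 / a2" "z1 a1 / a1 < z1 s1 / s1"
      "a2 < a1" "\<rho>1 a1 < \<rho>2 a2" "yy \<rho>2 a2 \<le> yy \<rho>1 a1"
    by (rule small_beta_start[OF P1 zeta_pos[OF P1] P2 zeta_pos[OF P2] less bp]) blast+
  have "s2 < s1 \<and> \<rho>1 s1 < \<rho>2 s2 \<and> yy \<rho>2 s2 \<le> yy \<rho>1 s1"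
    by (rule comparison[OF P1 order_refl order_refl zeta_pos[OF P1] P2 order_refl order_refl zeta_pos[OF P2] a(1-5,7-9) s less_imp_le[OF a(6)]])
  then show ?thesis by simp
qed

text \<open>If \<open>z2\<close> exceeded \<open>z1\<close> at level \<open>s\<close>, then
  \<open>z2 / s\<close>, which tends to 0 at \<open>\<alpha>2\<close>, would take the value
  \<open>z1 s / s\<close> again at a level above \<open>s\<close>, contrary to
  \<open>beta_order\<close>.\<close>

lemma z_order:
  assumes P1: "profile \<rho>1 z1 \<alpha>1" and P2: "profile \<rho>2 z2 \<alpha>2" and less: "\<alpha>2 < \<alpha>1"
    and s: "u0 < s" "s < \<alpha>2"
  shows "z2 s \<le> z1 s"
proof (rule ccontr)
  assume "\<not> z2 s \<le> z1 s"
  then have lt: "z1 s / s < z2 s / s" using s u0 by (simp add: divide_strict_right_mono)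
  have s0: "s > 0" "s < \<alpha>1" using s u0 less by auto
  have "z1 s / s > 0" using profileD(2)[OF P1 s0] s0 by simp
  then obtain t where t: "s < t" "t < \<alpha>2" "z2 t / t < z1 s / s" by (rule beta_small[OF P2 _ s(2)])
  obtain w where w: "s \<le> w" "w \<le> t" "z2 w / w = z1 s / s"
    using beta_IVT[OF P2 s0(1), of t "z1 s / s"] t lt by auto
  have "w < s" using beta_order[OF P1 P2 less s(1) s0(2), of w] w t s by simp
  then show False using w by simp
qed

lemma z_order_u0:
  assumes P1: "profile \<rho>1 z1 \<alpha>1" and P2: "profile \<rho>2 z2 \<alpha>2" and less: "\<alpha>2 < \<alpha>1"
  shows "z2 u0 \<le> z1 u0"
proof -
  have al: "u0 < \<alpha>2" "u0 < \<alpha>1" using P1 P2 unfolding profile_def by auto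
  have "(z1 \<longlongrightarrow> z1 u0) (at_right u0)" "(z2 \<longlongrightarrow> z2 u0) (at_right u0)"
    using profile_cont(2)[OF P1 u0 al(2)] profile_cont(2)[OF P2 u0 al(1)] unfolding isCont_def
    by (auto intro: tendsto_within_subset)
  moreover have "\<forall>\<^sub>F s in at_right u0. z2 s \<le> z1 s"
    using eventually_at_right_real[OF al(1)] by eventually_elim (auto intro: z_order[OF P1 P2 less])
  ultimately show ?thesis by (intro tendsto_le[of "at_right u0" z1 "z1 u0" z2 "z2 u0"]) auto
qed

lemma kap_strict_mono:
  assumes "0 < r" "r < r'"
  shows "kap r < kap r'"
proof (rule DERIV_pos_imp_increasing[OF assms(2)])
  fix x assume "r \<le> x" "x \<le> r'"
  then have "x > 0" using assms by simp
  then show "\<exists>y. (kap has_real_derivative y) (at x) \<and> 0 < y"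
    using kap_deriv[of x] m_pos[of x] kap_pos[of x] by (intro exI[of _ "m x * kap x / x"]) auto
qed

text \<open>Below level \<open>u0\<close> the reaction term only widens the gap between the two profiles.\<close>

lemma gap_below_u0:
  assumes P1: "profile \<rho>1 z1 \<alpha>1" and P2: "profile \<rho>2 z2 \<alpha>2"
    and rho: "\<rho>1 u0 \<le> \<rho>2 u0" and z: "z2 u0 \<le> z1 u0" and strict: "\<rho>1 u0 < \<rho>2 u0 \<or> z2 u0 < z1 u0"
    and nz: "\<exists>t\<in>{0<..<u0}. f t \<noteq> 0"
  shows False
proof -
  have al: "u0 < \<alpha>2" "u0 < \<alpha>1" using P1 P2 unfolding profile_def by auto
  \<comment> \<open>\<open>q1\<close> and \<open>q2\<close> multiply \<open>- f s / (p - 1)\<close>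
    in the equations for \<open>z1\<close> and \<open>z2\<close>. Where \<open>q1 < q2\<close> and
    \<open>f \<le> 0\<close>, the difference \<open>z1 - z2\<close> grows as the level
    falls.\<close>
  define q1 where "q1 s = kap (\<rho>1 s) * z1 s powr (1 - p)" for s
  define q2 where "q2 s = kap (\<rho>2 s) * z2 s powr (1 - p)" for s
  have pos: "\<rho>1 s > 0" "z1 s > 0" "\<rho>2 s > 0" "z2 s > 0" if "0 < s" "s \<le> u0" for s
    using profileD(1,2)[OF P1, of s] profileD(1,2)[OF P2, of s] that al by auto
  have q_gt: "q1 s < q2 s" if s: "0 < s" "s \<le> u0" and ord: "\<rho>1 s \<le> \<rho>2 s" "z2 s \<le> z1 s" "\<rho>1 s < \<rho>2 s \<or> z2 s < z1 s" for s
  proof -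
    note ps = pos[OF s]
    have zz: "z1 s powr (1 - p) \<le> z2 s powr (1 - p)" using ps ord p by (intro powr_mono2') auto
    have kk: "kap (\<rho>1 s) \<le> kap (\<rho>2 s)" using kap_strict_mono[OF ps(1), of "\<rho>2 s"] ord(1) by (cases "\<rho>1 s = \<rho>2 s") auto
    have k: "kap (\<rho>1 s) > 0" "kap (\<rho>2 s) > 0" using kap_pos ps by auto
    from ord(3) show ?thesis
    proof
      assume "\<rho>1 s < \<rho>2 s"
      then have "kap (\<rho>1 s) < kap (\<rho>2 s)" by (rule kap_strict_mono[OF ps(1)])
      then show ?thesis unfolding q1_def q2_def using zz k ps by (intro mult_less_le_imp_less) auto
    next
      assume "z2 s < z1 s"
      then have "z1 s powr (1 - p) < z2 s powr (1 - p)" using ps p by (intro powr_less_mono2_neg) auto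
      then show ?thesis unfolding q1_def q2_def using kk k ps by (intro mult_le_less_imp_less) auto
    qed
  qed
  have cq: "isCont q1 s" "isCont q2 s" if s: "0 < s" "s \<le> u0" for s
  proof -
    have s': "s < \<alpha>1" "s < \<alpha>2" using s al by auto
    show "isCont q1 s" "isCont q2 s" unfolding q1_def q2_def
      using profile_cont[OF P1 s(1) s'(1)] profile_cont[OF P2 s(1) s'(2)] pos[OF s]
      by (auto intro!: continuous_intros)
  qed
  have dz: "((\<lambda>s. z1 s - z2 s) has_real_derivative f s / (p - 1) * (q2 s - q1 s)) (at s)" if s: "0 < s" "s \<le> u0" for s
  proof -
    have s': "s < \<alpha>1" "s < \<alpha>2" using s al by auto
    show ?thesis
      by (rule DERIV_cong[OF DERIV_diff[OF profileD(4)[OF P1 s(1) s'(1)] profileD(4)[OF P2 s(1) s'(2)]]])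
        (simp add: q1_def q2_def diff_divide_distrib right_diff_distrib mult_ac)
  qed
  have dl: "((\<lambda>s. ln (\<rho>2 s) - ln (\<rho>1 s)) has_real_derivative 1 / z1 s - 1 / z2 s) (at s)" if s: "0 < s" "s \<le> u0" for s
  proof -
    have s': "s < \<alpha>1" "s < \<alpha>2" using s al by auto
    show ?thesis
      by (rule DERIV_cong[OF DERIV_diff[OF DERIV_chain'[OF profileD(3)[OF P2 s(1) s'(2)] DERIV_ln_divide]
           DERIV_chain'[OF profileD(3)[OF P1 s(1) s'(1)] DERIV_ln_divide]]])
        (use pos[OF s] in auto)
  qed
  have z_mono: "z1 t - z2 t \<le> z1 s - z2 s" if st: "0 < s" "s \<le> t" "t \<le> u0" and q: "\<And>x. s < x \<Longrightarrow> x \<le> t \<Longrightarrow> q1 x < q2 x" for s t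
  proof (rule DERIV_nonpos_imp_decreasing_open[OF st(2)])
    show "continuous_on {s..t} (\<lambda>s. z1 s - z2 s)"
      by (intro continuous_at_imp_continuous_on ballI DERIV_isCont[OF dz]) (use st in auto)
    fix x assume x: "s < x" "x < t"
    then have xx: "0 < x" "x \<le> u0" using st by auto
    have "f x / (p - 1) * (q2 x - q1 x) \<le> 0"
      using f_nonpos[OF xx] q[of x] x p by (intro mult_nonpos_nonneg) (auto simp: divide_nonpos_pos)
    then show "\<exists>y. ((\<lambda>s. z1 s - z2 s) has_real_derivative y) (at x) \<and> y \<le> 0" using dz[OF xx] by blast
  qed
  have ord_at: "\<rho>1 s \<le> \<rho>2 s \<and> z2 s \<le> z1 s \<and> (\<rho>1 s < \<rho>2 s \<or> z2 s < z1 s)"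
    if s: "0 < s" "s \<le> u0" and q: "\<And>x. s < x \<Longrightarrow> x \<le> u0 \<Longrightarrow> q1 x < q2 x" for s
  proof -
    have zz: "z1 u0 - z2 u0 \<le> z1 x - z2 x" if "s \<le> x" "x \<le> u0" for x
      by (rule z_mono) (use that s q in auto)
    have "ln (\<rho>2 u0) - ln (\<rho>1 u0) \<le> ln (\<rho>2 s) - ln (\<rho>1 s)"
    proof (rule DERIV_nonpos_imp_nonincreasing[OF s(2)])
      fix x assume x: "s \<le> x" "x \<le> u0"
      then have xx: "0 < x" "x \<le> u0" using s by auto
      have "1 / z1 x - 1 / z2 x \<le> 0" using zz[OF x] z pos[OF xx] by (simp add: frac_le)
      then show "\<exists>y. ((\<lambda>s. ln (\<rho>2 s) - ln (\<rho>1 s)) has_real_derivative y) (at x) \<and> y \<le> 0" using dl[OF xx] by blast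
    qed
    moreover have "ln (\<rho>2 u0) - ln (\<rho>1 u0) \<ge> 0" using rho pos[OF u0 order_refl] by simp
    moreover have "\<rho>1 u0 < \<rho>2 u0 \<Longrightarrow> ln (\<rho>2 u0) - ln (\<rho>1 u0) > 0" using pos[OF u0 order_refl] by simp
    moreover have "\<rho>1 s \<le> \<rho>2 s \<longleftrightarrow> ln (\<rho>2 s) - ln (\<rho>1 s) \<ge> 0" "\<rho>1 s < \<rho>2 s \<longleftrightarrow> ln (\<rho>2 s) - ln (\<rho>1 s) > 0"
      using pos[OF s] by auto
    ultimately show ?thesis using zz[of s] s z strict by linarith
  qed
  \<comment> \<open>Continuation downward from \<open>u0\<close>: at the highest level where
    \<open>q1 < q2\<close> fails, the orderings of radius and slope inherited from above would still
    force it.\<close>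
  have q_all: "q1 s < q2 s" if s: "0 < s" "s \<le> u0" for s
  proof (rule ccontr)
    assume n: "\<not> q1 s < q2 s"
    define Z where "Z = {x \<in> {s..u0}. q2 x \<le> q1 x}"
    have "closed Z" unfolding Z_def
      by (intro continuous_on_closed_Collect_le closed_atLeastAtMost continuous_at_imp_continuous_on ballI cq) (use s in auto)
    moreover have "s \<in> Z" using n s by (auto simp: Z_def)
    moreover have bZ: "bdd_above Z" by (auto simp: Z_def)
    ultimately have "Sup Z \<in> Z" by (intro closed_contains_Sup) auto
    then have x: "s \<le> Sup Z" "Sup Z \<le> u0" "q2 (Sup Z) \<le> q1 (Sup Z)" by (auto simp: Z_def)
    have above: "q1 x < q2 x" if "Sup Z < x" "x \<le> u0" for x
    proof (rule ccontr)
      assume "\<not> q1 x < q2 x"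
      then have "x \<in> Z" using that x by (auto simp: Z_def)
      then have "x \<le> Sup Z" using bZ by (rule cSup_upper)
      then show False using that by simp
    qed
    have "q1 (Sup Z) < q2 (Sup Z)"
      using q_gt[of "Sup Z"] ord_at[of "Sup Z"] above x s by auto
    then show False using x by simp
  qed
  \<comment> \<open>A level with \<open>f t < 0\<close> makes the gap \<open>z1 - z2\<close>
    strictly positive below \<open>t\<close>. From there on \<open>z1\<close> stays bounded away
    from 0, against the last clause of \<open>profile\<close>.\<close>
  obtain t where t: "0 < t" "t < u0" "f t \<noteq> 0" using nz by auto
  then have ft: "f t < 0" using f_nonpos[of t] by simp
  have "f t / (p - 1) * (q2 t - q1 t) < 0"
    using ft p q_all[of t] t by (intro mult_neg_pos) (auto simp: divide_neg_pos)
  from DERIV_neg_dec_left[OF dz this] t obtain d where d: "d > 0" "\<And>h. h > 0 \<Longrightarrow> h < d \<Longrightarrow> z1 t - z2 t < z1 (t - h) - z2 (t - h)"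
    by auto
  define s where "s = t - min (d / 2) (t / 2)"
  have s: "0 < s" "s < t" "z1 t - z2 t < z1 s - z2 s"
    using d(2)[of "min (d / 2) (t / 2)"] d(1) t unfolding s_def by (auto simp: min_def)
  have "z2 t \<le> z1 t" using ord_at[of t] q_all t by auto
  then have gap: "z1 s - z2 s > 0" using s by simp
  have "z1 s - z2 s \<le> z1 x" if x: "x \<in> {0<..<s}" for x
  proof -
    have "z1 s - z2 s \<le> z1 x - z2 x" by (rule z_mono) (use x s t q_all in auto)
    then show ?thesis using pos(4)[of x] x s t by simp
  qed
  then have "\<exists>d>0. \<exists>e>0. \<forall>s\<in>{0<..<e}. d \<le> z1 s" using gap s(1) by blast
  then show False using P1 unfolding profile_def by blast
qed

text \<open>As a function of \<open>ln r\<close>, \<open>ln kap\<close> has slope \<open>m\<close>,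
  which lies between 0 and \<open>m a\<close> beyond \<open>a\<close>.\<close>

lemma ln_kap_Lipschitz:
  assumes "0 < a" "a \<le> r" "a \<le> r'"
  shows "\<bar>ln (kap r) - ln (kap r')\<bar> \<le> m a * \<bar>ln r - ln r'\<bar>"
proof -
  have d: "((\<lambda>x. ln (kap x)) has_real_derivative m x / x) (at x)" if "x > 0" for x
    by (rule DERIV_cong[OF DERIV_chain'[OF kap_deriv[OF that] DERIV_ln_divide[OF kap_pos[OF that]]]])
      (use that kap_pos[OF that] in auto)
  have *: "0 \<le> ln (kap y) - ln (kap x) \<and> ln (kap y) - ln (kap x) \<le> m a * (ln y - ln x)" if xy: "a \<le> x" "x \<le> y" for x y
  proof
    have "ln (kap x) \<le> ln (kap y)"
    proof (rule DERIV_nonneg_imp_nondecreasing[OF xy(2)])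
      fix t assume "x \<le> t" "t \<le> y"
      then have t: "t > 0" using xy assms by auto
      show "\<exists>w. ((\<lambda>x. ln (kap x)) has_real_derivative w) (at t) \<and> 0 \<le> w"
        using d[OF t] m_pos[OF t] t by (intro exI[of _ "m t / t"]) auto
    qed
    then show "0 \<le> ln (kap y) - ln (kap x)" by simp
    have "m a * ln x - ln (kap x) \<le> m a * ln y - ln (kap y)"
    proof (rule DERIV_nonneg_imp_nondecreasing[OF xy(2)])
      fix t assume t: "x \<le> t" "t \<le> y"
      then have t0: "t > 0" "a \<le> t" using xy assms by auto
      have "((\<lambda>x. m a * ln x - ln (kap x)) has_real_derivative m a * (1 / t) - m t / t) (at t)"
        by (intro DERIV_diff DERIV_cmult d DERIV_ln_divide t0)
      moreover have "m a * (1 / t) - m t / t \<ge> 0" using m_antimono[OF assms(1) t0(2)] t0 by (simp add: divide_right_mono)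
      ultimately show "\<exists>w. ((\<lambda>x. m a * ln x - ln (kap x)) has_real_derivative w) (at t) \<and> 0 \<le> w" by blast
    qed
    then show "ln (kap y) - ln (kap x) \<le> m a * (ln y - ln x)" by (simp add: algebra_simps)
  qed
  show ?thesis
  proof (cases "r \<le> r'")
    case True
    then have "ln r \<le> ln r'" using assms by simp
    then show ?thesis using *[of r r'] True assms by (simp add: abs_if)
  next
    case False
    then have "ln r' \<le> ln r" using assms by simp
    then show ?thesis using *[of r' r] False assms by (simp add: abs_if)
  qed
qed

text \<open>Distances are measured in logarithms: \<open>ln kap\<close> is Lipschitz in
  \<open>ln \<rho>\<close> and powers of \<open>z\<close> are exponentials of \<open>ln z\<close>,
  so the derivatives of \<open>a\<close> and \<open>l\<close> are bounded linearly by
  \<open>\<bar>a\<bar> + \<bar>l\<bar>\<close>, and Gronwall applies to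
  \<open>W = a\<^sup>2 + l\<^sup>2\<close>.\<close>

lemma profile_identity:
  assumes P1: "profile \<rho>1 z1 \<alpha>1" and P2: "profile \<rho>2 z2 \<alpha>2"
    and s0: "0 < s0" "s0 < \<alpha>1" "s0 < \<alpha>2" and eq: "\<rho>1 s0 = \<rho>2 s0" "z1 s0 = z2 s0"
    and s: "0 < s" "s < \<alpha>1" "s < \<alpha>2"
  shows "\<rho>1 s = \<rho>2 s \<and> z1 s = z2 s"
proof -
  define c d where "c = min s s0" and "d = max s s0"
  have cd: "0 < c" "d < \<alpha>1" "d < \<alpha>2" "s \<in> {c..d}" "s0 \<in> {c..d}" using s s0 by (auto simp: c_def d_def)
  have x1: "0 < x" "x < \<alpha>1" and x2: "x < \<alpha>2" if "x \<in> {c..d}" for x using that cd by auto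
  have D1: "\<rho>1 x > 0" "z1 x > 0" "(\<rho>1 has_real_derivative - \<rho>1 x / z1 x) (at x)"
    "(z1 has_real_derivative mh - kap (\<rho>1 x) * f x * z1 x powr (1 - p) / (p - 1)) (at x)" if "x \<in> {c..d}" for x
    using profileD[OF P1 x1[OF that]] by auto
  have D2: "\<rho>2 x > 0" "z2 x > 0" "(\<rho>2 has_real_derivative - \<rho>2 x / z2 x) (at x)"
    "(z2 has_real_derivative mh - kap (\<rho>2 x) * f x * z2 x powr (1 - p) / (p - 1)) (at x)" if "x \<in> {c..d}" for x
    using profileD[OF P2 x1(1)[OF that] x2[OF that]] by auto
  have bdd: "\<exists>B. \<forall>x\<in>{c..d}. h x \<le> B" if "\<And>x. x \<in> {c..d} \<Longrightarrow> isCont h x" for h :: "real \<Rightarrow> real"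
  proof -
    have "\<exists>x\<in>{c..d}. \<forall>y\<in>{c..d}. h y \<le> h x"
      by (rule continuous_attains_sup) (use cd(4) that in \<open>auto intro!: continuous_at_imp_continuous_on\<close>)
    then show ?thesis by blast
  qed
  have cont1: "isCont \<rho>1 x" "isCont z1 x" "isCont (\<lambda>s. kap (\<rho>1 s)) x" "isCont f x" if "x \<in> {c..d}" for x
    using profile_cont[OF P1 x1[OF that]] by auto
  have cont2: "isCont \<rho>2 x" "isCont z2 x" "isCont (\<lambda>s. kap (\<rho>2 s)) x" if "x \<in> {c..d}" for x
    using profile_cont[OF P2 x1(1)[OF that] x2[OF that]] by auto
  define e1 where "e1 x = 1 / z1 x" for x
  define e2 where "e2 x = 1 / z2 x" for x
  define k1 where "k1 x = kap (\<rho>1 x) * z1 x powr (- p)" for x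
  define k2 where "k2 x = kap (\<rho>2 x) * z2 x powr (- p)" for x
  have cmax: "isCont (\<lambda>x. max (max (e1 x) (e2 x)) (max (k1 x) (k2 x))) x" if x: "x \<in> {c..d}" for x
    unfolding e1_def e2_def k1_def k2_def
    using cont1[OF x] cont2[OF x] D1(2)[OF x] D2(2)[OF x]
    by (auto intro!: continuous_intros simp: less_imp_neq[symmetric])
  have "\<exists>B. \<forall>x\<in>{c..d}. max (max (e1 x) (e2 x)) (max (k1 x) (k2 x)) \<le> B"
    by (rule bdd) (rule cmax)
  then obtain E where "\<forall>x\<in>{c..d}. max (max (e1 x) (e2 x)) (max (k1 x) (k2 x)) \<le> E" ..
  then have E: "\<And>x. x \<in> {c..d} \<Longrightarrow> e1 x \<le> E \<and> e2 x \<le> E \<and> k1 x \<le> E \<and> k2 x \<le> E" by simp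
  have cabs: "isCont (\<lambda>x. \<bar>f x\<bar>) x" if x: "x \<in> {c..d}" for x using cont1(4)[OF x] by (intro continuous_intros)
  have "\<exists>B. \<forall>x\<in>{c..d}. \<bar>f x\<bar> \<le> B" by (rule bdd) (rule cabs)
  then obtain F where "\<forall>x\<in>{c..d}. \<bar>f x\<bar> \<le> F" ..
  then have F: "\<And>x. x \<in> {c..d} \<Longrightarrow> \<bar>f x\<bar> \<le> F" by simp
  have F0: "F \<ge> 0" using F[OF cd(4)] by simp
  have E0: "E \<ge> 0"
  proof -
    have "0 < e1 s" unfolding e1_def using D1(2)[OF cd(4)] by simp
    then show ?thesis using E[OF cd(4)] by linarith
  qed
  have "isCont (\<lambda>x. max (- \<rho>1 x) (- \<rho>2 x)) x" if x: "x \<in> {c..d}" for x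
    using cont1(1)[OF x] cont2(1)[OF x] by (intro continuous_intros)
  then have "\<exists>x\<in>{c..d}. \<forall>y\<in>{c..d}. max (- \<rho>1 y) (- \<rho>2 y) \<le> max (- \<rho>1 x) (- \<rho>2 x)"
    by (intro continuous_attains_sup continuous_at_imp_continuous_on) (use cd(4) in auto)
  then obtain xa where xa: "xa \<in> {c..d}" "\<And>y. y \<in> {c..d} \<Longrightarrow> max (- \<rho>1 y) (- \<rho>2 y) \<le> max (- \<rho>1 xa) (- \<rho>2 xa)" by blast
  define ra where "ra = min (\<rho>1 xa) (\<rho>2 xa)"
  have ra: "ra > 0" "\<And>y. y \<in> {c..d} \<Longrightarrow> ra \<le> \<rho>1 y \<and> ra \<le> \<rho>2 y"
    using D1(1)[OF xa(1)] D2(1)[OF xa(1)] xa(2) unfolding ra_def by (auto simp: min_def max_def split: if_splits) (smt (verit))+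
  define a where "a x = ln (\<rho>1 x) - ln (\<rho>2 x)" for x
  define l where "l x = ln (z1 x) - ln (z2 x)" for x
  define a' where "a' x = e2 x - e1 x" for x
  define l' where "l' x = mh * (e1 x - e2 x) - f x / (p - 1) * (k1 x - k2 x)" for x
  have da: "(a has_real_derivative a' x) (at x)" if x: "x \<in> {c..d}" for x
    unfolding a_def
    by (rule DERIV_cong[OF DERIV_diff[OF DERIV_chain'[OF D1(3)[OF x] DERIV_ln_divide[OF D1(1)[OF x]]]
           DERIV_chain'[OF D2(3)[OF x] DERIV_ln_divide[OF D2(1)[OF x]]]]])
      (use D1(1)[OF x] D2(1)[OF x] in \<open>auto simp: a'_def e1_def e2_def\<close>)
  have pw: "y powr (1 - p) / y = y powr (- p)" if "y > 0" for y :: real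
    using powr_diff[of y "1 - p" 1] that by simp
  have dl: "(l has_real_derivative l' x) (at x)" if x: "x \<in> {c..d}" for x
  proof -
    have "1 / z1 x * (mh - kap (\<rho>1 x) * f x * z1 x powr (1 - p) / (p - 1)) = mh * e1 x - f x / (p - 1) * k1 x"
      unfolding e1_def k1_def pw[OF D1(2)[OF x], symmetric] by (simp add: right_diff_distrib mult_ac)
    moreover have "1 / z2 x * (mh - kap (\<rho>2 x) * f x * z2 x powr (1 - p) / (p - 1)) = mh * e2 x - f x / (p - 1) * k2 x"
      unfolding e2_def k2_def pw[OF D2(2)[OF x], symmetric] by (simp add: right_diff_distrib mult_ac)
    ultimately show ?thesis unfolding l_def
      by (intro DERIV_cong[OF DERIV_diff[OF DERIV_chain'[OF D1(4)[OF x] DERIV_ln_divide[OF D1(2)[OF x]]]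
           DERIV_chain'[OF D2(4)[OF x] DERIV_ln_divide[OF D2(2)[OF x]]]]])
        (simp add: l'_def right_diff_distrib)
  qed
  \<comment> \<open>The three summands account for \<open>mh * (e1 - e2)\<close>, for the reaction
    term, and for \<open>a'\<close>.\<close>
  define C1 where "C1 = mh * E + F / (p - 1) * (E * (m ra + p)) + E"
  have C1: "C1 \<ge> 0" unfolding C1_def using mh E0 F0 p m_pos[OF ra(1)] by (intro add_nonneg_nonneg mult_nonneg_nonneg) auto
  have bd: "\<bar>a' x\<bar> \<le> C1 * (\<bar>a x\<bar> + \<bar>l x\<bar>)" "\<bar>l' x\<bar> \<le> C1 * (\<bar>a x\<bar> + \<bar>l x\<bar>)" if x: "x \<in> {c..d}" for x
  proof -
    define T where "T = \<bar>a x\<bar> + \<bar>l x\<bar>"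
    have T: "T \<ge> 0" "\<bar>l x\<bar> \<le> T" "\<bar>a x\<bar> \<le> T" unfolding T_def by auto
    have ex: "e1 x = exp (- ln (z1 x))" "e2 x = exp (- ln (z2 x))"
      unfolding e1_def e2_def using D1(2)[OF x] D2(2)[OF x] by (auto simp: exp_minus inverse_eq_divide)
    have "\<bar>e1 x - e2 x\<bar> \<le> E * \<bar>- ln (z1 x) - - ln (z2 x)\<bar>"
      unfolding ex by (rule exp_diff_le) (use E[OF x] ex in auto)
    also have "\<dots> = E * \<bar>l x\<bar>" unfolding l_def by (simp add: abs_minus_commute)
    also have "\<dots> \<le> E * T" using T E0 by (intro mult_left_mono) auto
    finally have e12: "\<bar>e1 x - e2 x\<bar> \<le> E * T" .
    have kx: "k1 x = exp (ln (kap (\<rho>1 x)) - p * ln (z1 x))" "k2 x = exp (ln (kap (\<rho>2 x)) - p * ln (z2 x))"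
      unfolding k1_def k2_def using D1(1,2)[OF x] D2(1,2)[OF x] kap_pos
      by (auto simp: exp_diff powr_def exp_minus divide_inverse)
    have "\<bar>k1 x - k2 x\<bar> \<le> E * \<bar>(ln (kap (\<rho>1 x)) - p * ln (z1 x)) - (ln (kap (\<rho>2 x)) - p * ln (z2 x))\<bar>"
      unfolding kx by (rule exp_diff_le) (use E[OF x] kx in auto)
    also have "\<dots> \<le> E * (m ra * T + p * T)"
    proof (rule mult_left_mono[OF _ E0])
      have "\<bar>ln (kap (\<rho>1 x)) - ln (kap (\<rho>2 x))\<bar> \<le> m ra * \<bar>a x\<bar>"
        unfolding a_def using ln_kap_Lipschitz[OF ra(1)] ra(2)[OF x] by auto
      also have "\<dots> \<le> m ra * T" using T m_pos[OF ra(1)] by (intro mult_left_mono) auto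
      finally have 1: "\<bar>ln (kap (\<rho>1 x)) - ln (kap (\<rho>2 x))\<bar> \<le> m ra * T" .
      have "\<bar>p * l x\<bar> \<le> p * T" using T p by (simp add: abs_mult)
      moreover have "(ln (kap (\<rho>1 x)) - p * ln (z1 x)) - (ln (kap (\<rho>2 x)) - p * ln (z2 x)) = (ln (kap (\<rho>1 x)) - ln (kap (\<rho>2 x))) - p * l x"
        unfolding l_def by (simp add: algebra_simps)
      ultimately show "\<bar>(ln (kap (\<rho>1 x)) - p * ln (z1 x)) - (ln (kap (\<rho>2 x)) - p * ln (z2 x))\<bar> \<le> m ra * T + p * T" using 1 by linarith
    qed
    finally have k12: "\<bar>k1 x - k2 x\<bar> \<le> E * (m ra + p) * T" by (simp add: algebra_simps)
    have fp: "\<bar>f x / (p - 1)\<bar> \<le> F / (p - 1)" using F[OF x] p by (simp add: divide_right_mono)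
    have "\<bar>f x / (p - 1) * (k1 x - k2 x)\<bar> \<le> F / (p - 1) * (E * (m ra + p) * T)"
      unfolding abs_mult using fp k12 F0 p by (intro mult_mono) auto
    moreover have "\<bar>mh * (e1 x - e2 x)\<bar> \<le> mh * (E * T)" using e12 mh by (simp add: abs_mult)
    ultimately have "\<bar>l' x\<bar> \<le> mh * (E * T) + F / (p - 1) * (E * (m ra + p) * T)" unfolding l'_def by linarith
    moreover have "E * T \<ge> 0" using E0 T by simp
    ultimately have "\<bar>l' x\<bar> \<le> C1 * T" unfolding C1_def by (simp add: algebra_simps)
    then show "\<bar>l' x\<bar> \<le> C1 * (\<bar>a x\<bar> + \<bar>l x\<bar>)" unfolding T_def .
    have "0 \<le> (mh * E + F / (p - 1) * (E * (m ra + p))) * T"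
      using mh E0 F0 p m_pos[OF ra(1)] T by (intro add_nonneg_nonneg mult_nonneg_nonneg) auto
    then have "E * T \<le> C1 * T" unfolding C1_def by (simp add: distrib_right)
    then show "\<bar>a' x\<bar> \<le> C1 * (\<bar>a x\<bar> + \<bar>l x\<bar>)" using e12 unfolding a'_def T_def by linarith
  qed
  define W where "W x = (a x)\<^sup>2 + (l x)\<^sup>2" for x
  have "W s = 0"
  proof (rule Gronwall_zero[of c d W "\<lambda>x. 2 * a x * a' x + 2 * l x * l' x" "4 * C1" s0])
    show "(W has_real_derivative 2 * a x * a' x + 2 * l x * l' x) (at x)" if "x \<in> {c..d}" for x
      unfolding W_def using da[OF that] dl[OF that] by (auto intro!: derivative_eq_intros)
    show "\<bar>2 * a x * a' x + 2 * l x * l' x\<bar> \<le> 4 * C1 * W x" if x: "x \<in> {c..d}" for x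
    proof -
      define T where "T = \<bar>a x\<bar> + \<bar>l x\<bar>"
      have "\<bar>2 * a x * a' x + 2 * l x * l' x\<bar> \<le> \<bar>2 * a x * a' x\<bar> + \<bar>2 * l x * l' x\<bar>" by (rule abs_triangle_ineq)
      also have "\<dots> = 2 * (\<bar>a x\<bar> * \<bar>a' x\<bar> + \<bar>l x\<bar> * \<bar>l' x\<bar>)" by (simp add: abs_mult)
      also have "\<dots> \<le> 2 * (\<bar>a x\<bar> * (C1 * T) + \<bar>l x\<bar> * (C1 * T))"
        using bd[OF x] unfolding T_def by (intro mult_left_mono add_mono) auto
      also have "\<dots> = 2 * C1 * T\<^sup>2" unfolding T_def by (simp add: power2_eq_square algebra_simps)
      also have "\<dots> \<le> 2 * C1 * (2 * W x)"
      proof (rule mult_left_mono)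
        have "0 \<le> (\<bar>a x\<bar> - \<bar>l x\<bar>)\<^sup>2" by simp
        then show "T\<^sup>2 \<le> 2 * W x" unfolding T_def W_def by (simp add: power2_eq_square algebra_simps)
      qed (use C1 in simp)
      finally show ?thesis by simp
    qed
    show "W s0 = 0" unfolding W_def a_def l_def using eq by simp
  qed (use cd W_def in auto)
  then have "a s = 0" "l s = 0" unfolding W_def by (auto simp: add_nonneg_eq_0_iff)
  then show ?thesis unfolding a_def l_def using D1(1,2)[OF cd(4)] D2(1,2)[OF cd(4)] by simp
qed

text \<open>Orbits that meet agree up to the lower top \<open>\<alpha>2\<close>; there
  \<open>z2\<close> tends to 0 while \<open>z1\<close> is still positive.\<close>

lemma profile_identity_top:
  assumes P1: "profile \<rho>1 z1 \<alpha>1" and P2: "profile \<rho>2 z2 \<alpha>2"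
    and s0: "0 < s0" "s0 < \<alpha>1" "s0 < \<alpha>2" and eq: "\<rho>1 s0 = \<rho>2 s0" "z1 s0 = z2 s0"
  shows "\<not> \<alpha>2 < \<alpha>1"
proof
  assume less: "\<alpha>2 < \<alpha>1"
  have al: "0 < \<alpha>2" using P2 u0 unfolding profile_def by simp
  have "(z2 \<longlongrightarrow> 0) (at_left \<alpha>2)" using P2 unfolding profile_def by simp
  moreover have "\<forall>\<^sub>F s in at_left \<alpha>2. z2 s = z1 s"
    using eventually_at_left_real[OF al]
    by eventually_elim (use profile_identity[OF P1 P2 s0 eq] less in auto)
  ultimately have "(z1 \<longlongrightarrow> 0) (at_left \<alpha>2)" by (rule Lim_transform_eventually)
  moreover have "(z1 \<longlongrightarrow> z1 \<alpha>2) (at_left \<alpha>2)"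
    using profile_cont(2)[OF P1 al less] unfolding isCont_def by (rule tendsto_within_subset) simp
  ultimately have "z1 \<alpha>2 = 0" by (intro tendsto_unique[of "at_left \<alpha>2"]) auto
  then show False using profileD(2)[OF P1 al less] by simp
qed

theorem profile_top_unique:
  assumes P1: "profile \<rho>1 z1 \<alpha>1" and P2: "profile \<rho>2 z2 \<alpha>2"
    and rho: "\<rho>1 u0 \<le> \<rho>2 u0" and nz: "\<exists>t\<in>{0<..<u0}. f t \<noteq> 0"
  shows "\<not> \<alpha>2 < \<alpha>1"
proof
  assume less: "\<alpha>2 < \<alpha>1"
  have al: "u0 < \<alpha>2" "u0 < \<alpha>1" using P1 P2 unfolding profile_def by auto
  note z = z_order_u0[OF P1 P2 less]
  show False
  proof (cases "\<rho>1 u0 = \<rho>2 u0 \<and> z1 u0 = z2 u0")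
    case True
    then show False using profile_identity_top[OF P1 P2 u0 al(2,1)] less by auto
  next
    case False
    then show False using gap_below_u0[OF P1 P2 rho z _ nz] rho z by fastforce
  qed
qed

end

section \<open>The weight\<close>

lemma limit_le_of_deriv_nonneg:
  fixes F :: "real \<Rightarrow> real"
  assumes "0 < r" and der: "\<And>t. 0 < t \<Longrightarrow> t \<le> r \<Longrightarrow> \<exists>d. (F has_real_derivative d) (at t) \<and> 0 \<le> d"
    and lim: "(F \<longlongrightarrow> L) (at_right 0)"
  shows "L \<le> F r"
proof (rule tendsto_upperbound[OF lim])
  show "\<forall>\<^sub>F t in at_right 0. F t \<le> F r"
    using eventually_at_right_real[OF assms(1)]
  proof eventually_elim
    case (elim t)
    then show ?case by (intro DERIV_nonneg_imp_nondecreasing[of t r F] der) auto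
  qed
qed simp

locale weighted_problem =
  fixes n :: nat and p u0 :: real and K f :: "real \<Rightarrow> real"
  assumes n_pos: "n > 0"
    and p_gt: "p > 1"
    and n_gt: "real n > p"
    and K_pos: "\<forall>r>0. K r > 0"
    and K_C1: "K C1_differentiable_on {0<..}"
    and K1_pos: "\<forall>r>0. p + r * deriv K r / K r > 0"
    and K1_decr: "antimono_on {0<..} (\<lambda>r. p + r * deriv K r / K r)"
    and f1_zero: "f 0 = 0"
    and f1_u0: "u0 > 0"
    and f1_pos: "\<forall>u>u0. f u > 0"
    and f1_nonpos: "\<forall>u\<in>{0<..<u0}. f u \<le> 0"
    and f1_nonzero: "\<exists>u\<in>{0<..<u0}. f u \<noteq> 0"
    and f2_cont: "continuous_on {0..} f"
    and f2_lip: "local_lipschitz (UNIV :: real set) {u0..} (\<lambda>_. f)"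
    and f3: "\<forall>u\<in>diff_points f u0. (p - 1) * f u \<le> deriv f u * (u - u0)"
    and f4: "antimono_on (diff_points f u0 - {u0}) (\<lambda>u. u * deriv f u / f u)"
begin

section \<open>Quantities derived from the weight\<close>

definition mw :: "real \<Rightarrow> real" where "mw r = p + r * deriv K r / K r"
definition kap :: "real \<Rightarrow> real" where "kap r = r powr p * K r"
definition mh :: real where "mh = (real n - p) / (p - 1)"
definition Nw :: "real \<Rightarrow> real" where "Nw r = r ^ n * K r"

lemma mh_pos: "mh > 0" and mh_eq: "(p - 1) * mh = real n - p"
  using p_gt n_gt by (auto simp: mh_def)

lemma n_ge_2: "n \<ge> 2" using p_gt n_gt by linarith

lemma K_deriv: "r > 0 \<Longrightarrow> (K has_real_derivative deriv K r) (at r)"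
proof -
  assume r: "r > 0"
  obtain D where "\<forall>x\<in>{0<..}. (K has_vector_derivative D x) (at x)"
    using K_C1 unfolding C1_differentiable_on_def by blast
  then have "(K has_real_derivative D r) (at r)" using r by (simp add: has_real_derivative_iff_has_vector_derivative)
  then show ?thesis using DERIV_imp_deriv by metis
qed

lemma K_isCont: "r > 0 \<Longrightarrow> isCont K r" using K_deriv DERIV_isCont by blast

lemma mw_pos: "r > 0 \<Longrightarrow> mw r > 0" using K1_pos by (simp add: mw_def)

lemma mw_antimono: "0 < r \<Longrightarrow> r \<le> r' \<Longrightarrow> mw r' \<le> mw r"
  using K1_decr unfolding mw_def monotone_on_def by auto

lemma K_deriv_mw: "r > 0 \<Longrightarrow> deriv K r = (mw r - p) * K r / r"
  using K_pos by (simp add: mw_def field_simps less_imp_neq[symmetric])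

lemma kap_pos: "r > 0 \<Longrightarrow> kap r > 0" using K_pos by (simp add: kap_def)

lemma kap_deriv: "r > 0 \<Longrightarrow> (kap has_real_derivative mw r * kap r / r) (at r)"
proof -
  assume r: "r > 0"
  have "(kap has_real_derivative p * r powr (p - 1) * K r + deriv K r * r powr p) (at r)"
    unfolding kap_def by (rule DERIV_mult[OF has_real_derivative_powr[OF r] K_deriv[OF r]])
  moreover have "p * r powr (p - 1) * K r + deriv K r * r powr p = mw r * kap r / r"
    unfolding K_deriv_mw[OF r] kap_def using r by (simp add: powr_diff field_simps)
  ultimately show ?thesis by simp
qed

lemma Nw_pos: "r > 0 \<Longrightarrow> Nw r > 0" using K_pos by (simp add: Nw_def)

lemma Nw_kap: "r > 0 \<Longrightarrow> Nw r = r powr (real n - p) * kap r"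
  unfolding Nw_def kap_def by (simp add: powr_diff powr_realpow)

lemma Nw_deriv: "r > 0 \<Longrightarrow> (Nw has_real_derivative (mw r + real n - p) * (r ^ (n - 1) * K r)) (at r)"
proof -
  assume r: "r > 0"
  have rn: "r ^ n = r * r ^ (n - 1)" using n_pos by (cases n) auto
  have "(Nw has_real_derivative real n * r ^ (n - 1) * K r + deriv K r * r ^ n) (at r)"
    unfolding Nw_def by (rule DERIV_mult[OF _ K_deriv[OF r]]) (auto intro!: derivative_eq_intros)
  moreover have "real n * r ^ (n - 1) * K r + deriv K r * r ^ n = (mw r + real n - p) * (r ^ (n - 1) * K r)"
    unfolding K_deriv_mw[OF r] rn using r by (simp add: field_simps)
  ultimately show ?thesis by simp
qed

lemma weight_pos: "r > 0 \<Longrightarrow> r ^ (n - 1) * K r > 0" using K_pos by simp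

text \<open>\<open>K\<close> may be unbounded at 0, but on \<open>(0, 1]\<close> the slope of
  \<open>ln kap\<close> with respect to \<open>ln r\<close> is at least \<open>mw 1 > 0\<close>, so
  a positive power of \<open>r\<close> dominates \<open>kap\<close>.\<close>

lemma kap_tendsto_0: "(kap \<longlongrightarrow> 0) (at_right 0)"
proof (rule tendsto_sandwich[of "\<lambda>_. 0" _ _ "\<lambda>r. kap 1 * r powr mw 1"])
  show "\<forall>\<^sub>F r in at_right 0. 0 \<le> kap r"
    using eventually_at_right_less[of 0] by eventually_elim (simp add: less_imp_le[OF kap_pos])
  show "\<forall>\<^sub>F r in at_right 0. kap r \<le> kap 1 * r powr mw 1"
    using eventually_at_right_real[of 0 1, simplified]
  proof eventually_elim
    case (elim r)
    then have r: "0 < r" "r < 1" by auto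
    have "ln (kap r) - mw 1 * ln r \<le> ln (kap 1) - mw 1 * ln 1"
    proof (rule DERIV_nonneg_imp_nondecreasing[of r 1 "\<lambda>r. ln (kap r) - mw 1 * ln r"])
      fix t assume t: "r \<le> t" "t \<le> 1"
      then have t0: "t > 0" using r by simp
      have "((\<lambda>r. ln (kap r) - mw 1 * ln r) has_real_derivative 1 / kap t * (mw t * kap t / t) - mw 1 * (1 / t)) (at t)"
        by (intro DERIV_diff DERIV_cmult DERIV_ln_divide t0 DERIV_chain'[OF kap_deriv[OF t0] DERIV_ln_divide[OF kap_pos[OF t0]]])
      moreover have "1 / kap t * (mw t * kap t / t) - mw 1 * (1 / t) \<ge> 0"
        using kap_pos[OF t0] mw_antimono[OF t0 t(2)] t0 by (simp add: divide_right_mono)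
      ultimately show "\<exists>y. ((\<lambda>r. ln (kap r) - mw 1 * ln r) has_real_derivative y) (at t) \<and> 0 \<le> y" by blast
    qed (use r in simp)
    then have "ln (kap r) \<le> ln (kap 1 * r powr mw 1)"
      using r kap_pos[of 1] by (simp add: ln_mult ln_powr)
    then show ?case using kap_pos[of r] kap_pos[of 1] r by (subst (asm) ln_le_cancel_iff) auto
  qed
  have "((\<lambda>r. r powr mw 1) \<longlongrightarrow> 0 powr mw 1) (at_right 0)"
    by (rule tendsto_powr') (use mw_pos[of 1] eventually_at_right_less[of "0::real"] in \<open>auto elim: eventually_mono\<close>)
  then show "((\<lambda>r. kap 1 * r powr mw 1) \<longlongrightarrow> 0) (at_right 0)"
    using tendsto_mult_left[of "\<lambda>r. r powr mw 1" 0 "at_right 0" "kap 1"] by simp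
qed simp

lemma Nw_tendsto_0: "(Nw \<longlongrightarrow> 0) (at_right 0)"
proof -
  have "((\<lambda>r::real. r powr (real n - p)) \<longlongrightarrow> 0 powr (real n - p)) (at_right 0)"
    by (rule tendsto_powr') (use n_gt eventually_at_right_less[of "0::real"] in \<open>auto elim: eventually_mono\<close>)
  then have "((\<lambda>r. r powr (real n - p) * kap r) \<longlongrightarrow> 0 powr (real n - p) * 0) (at_right 0)"
    by (intro tendsto_mult kap_tendsto_0)
  moreover have "\<forall>\<^sub>F r in at_right 0. r powr (real n - p) * kap r = Nw r"
    using eventually_at_right_less[of 0] by eventually_elim (simp add: Nw_kap)
  ultimately show ?thesis by (auto intro: Lim_transform_eventually)
qed

text \<open>Integrability of the weight at 0. With \<open>c = n - p\<close>,
  \<open>Nw - c * F\<close> is nondecreasing and \<open>Nw > 0\<close>, which bounds an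
  antiderivative \<open>F\<close> from below. As \<open>F\<close> is nondecreasing, it has a limit
  at 0, which is subtracted.\<close>

lemma weight_integral_exists:
  "\<exists>G. (\<forall>r>0. (G has_real_derivative r ^ (n - 1) * K r) (at r)) \<and> (G \<longlongrightarrow> 0) (at_right 0)"
proof -
  have "isCont (\<lambda>r. r ^ (n - 1) * K r) x" if "x > 0" for x using K_isCont[OF that] by (intro continuous_intros)
  then have "\<exists>F. \<forall>x. (0::ereal) < ereal x \<longrightarrow> ereal x < \<infinity> \<longrightarrow> (F has_vector_derivative x ^ (n - 1) * K x) (at x)"
    by (intro einterval_antiderivative) auto
  then obtain F where F: "\<And>r. r > 0 \<Longrightarrow> (F has_real_derivative r ^ (n - 1) * K r) (at r)"
    by (auto simp: has_real_derivative_iff_has_vector_derivative)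
  have mono: "F r \<le> F t" if "0 < r" "r \<le> t" for r t
  proof (rule DERIV_nonneg_imp_nondecreasing[OF that(2)])
    fix x assume "r \<le> x" "x \<le> t"
    then have "x > 0" using that by simp
    then show "\<exists>y. (F has_real_derivative y) (at x) \<and> 0 \<le> y" using F[of x] K_pos by (intro exI conjI) (auto intro: less_imp_le)
  qed
  define c where "c = real n - p"
  have c: "c > 0" using n_gt by (simp add: c_def)
  have lower: "F 1 - Nw 1 / c \<le> F r" if r: "r > 0" for r
  proof (cases "r \<le> 1")
    case True
    have "Nw r - c * F r \<le> Nw 1 - c * F 1"
    proof (rule DERIV_nonneg_imp_nondecreasing[OF True])
      fix x assume "r \<le> x" "x \<le> 1"
      then have x: "x > 0" using r by simp
      have "((\<lambda>r. Nw r - c * F r) has_real_derivative (mw x + real n - p) * (x ^ (n - 1) * K x) - c * (x ^ (n - 1) * K x)) (at x)"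
        by (intro DERIV_diff DERIV_cmult F Nw_deriv x)
      moreover have "(mw x + real n - p) * (x ^ (n - 1) * K x) - c * (x ^ (n - 1) * K x) = mw x * (x ^ (n - 1) * K x)"
        by (simp add: c_def algebra_simps)
      moreover have "0 \<le> mw x * (x ^ (n - 1) * K x)"
        by (intro mult_nonneg_nonneg less_imp_le[OF mw_pos[OF x]] less_imp_le[OF weight_pos[OF x]])
      ultimately show "\<exists>y. ((\<lambda>r. Nw r - c * F r) has_real_derivative y) (at x) \<and> 0 \<le> y" by metis
    qed
    then have "c * F 1 - Nw 1 \<le> c * F r" using Nw_pos[OF r] by simp
    then show ?thesis using c by (simp add: field_simps)
  next
    case False
    then have "F 1 \<le> F r" using mono[of 1 r] by simp
    moreover have "Nw 1 / c > 0" using Nw_pos[of 1] c by simp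
    ultimately show ?thesis by linarith
  qed
  define l where "l = Inf (F ` {0<..})"
  have bdd: "bdd_below (F ` {0<..})" using lower by (intro bdd_belowI2) auto
  have "(F \<longlongrightarrow> l) (at_right 0)"
  proof (rule order_tendstoI)
    fix a assume a: "a < l"
    show "\<forall>\<^sub>F r in at_right 0. a < F r"
      using eventually_at_right_less[of 0]
    proof eventually_elim
      case (elim r)
      then have "l \<le> F r" unfolding l_def using bdd by (intro cInf_lower) auto
      then show ?case using a by simp
    qed
  next
    fix a assume "l < a"
    then obtain t where t: "t > 0" "F t < a" unfolding l_def using cInf_lessD[of "F ` {0<..}" a] by auto
    show "\<forall>\<^sub>F r in at_right 0. F r < a"
      using eventually_at_right_real[OF t(1)]
    proof eventually_elim
      case (elim r)
      then show ?case using mono[of r t] t by auto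
    qed
  qed
  then have "((\<lambda>r. F r - l) \<longlongrightarrow> l - l) (at_right 0)" by (intro tendsto_intros)
  moreover have "((\<lambda>r. F r - l) has_real_derivative r ^ (n - 1) * K r) (at r)" if "r > 0" for r
    using F[OF that] by (auto intro!: derivative_eq_intros)
  ultimately show ?thesis by (intro exI[of _ "\<lambda>r. F r - l"]) auto
qed

text \<open>The integral of \<open>t ^ (n - 1) * K t\<close> over \<open>(0, r)\<close>, improper at
  0 because \<open>K\<close> may be singular there.\<close>

definition Jt :: "real \<Rightarrow> real" where
  "Jt = (SOME G. (\<forall>r>0. (G has_real_derivative r ^ (n - 1) * K r) (at r)) \<and> (G \<longlongrightarrow> 0) (at_right 0))"

lemma Jt_deriv: "r > 0 \<Longrightarrow> (Jt has_real_derivative r ^ (n - 1) * K r) (at r)"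
  and Jt_tendsto_0: "(Jt \<longlongrightarrow> 0) (at_right 0)"
  using someI_ex[OF weight_integral_exists] unfolding Jt_def by auto

lemma Jt_pos: "r > 0 \<Longrightarrow> Jt r > 0"
proof -
  assume r: "r > 0"
  have "0 \<le> Jt (r / 2)"
    by (rule limit_le_of_deriv_nonneg[OF _ _ Jt_tendsto_0]) (use r Jt_deriv weight_pos in \<open>auto intro: less_imp_le\<close>)
  also have "Jt (r / 2) < Jt r"
  proof (rule DERIV_pos_imp_increasing[of "r / 2" r Jt])
    fix x assume "r / 2 \<le> x" "x \<le> r"
    then have "x > 0" using r by simp
    then show "\<exists>y. (Jt has_real_derivative y) (at x) \<and> 0 < y" using Jt_deriv weight_pos by blast
  qed (use r in simp)
  finally show "Jt r > 0" .
qed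

text \<open>Since \<open>Nw' = (mw + n - p) * Jt'\<close> and \<open>mw\<close> decreases, the
  factor is on \<open>(0, r)\<close> at least its value at \<open>r\<close>; both functions tend to
  0 at 0.\<close>

lemma Nw_ge: "r > 0 \<Longrightarrow> (mw r + real n - p) * Jt r \<le> Nw r"
proof -
  assume r: "r > 0"
  define c where "c = mw r + real n - p"
  have "0 \<le> Nw r - c * Jt r"
  proof (rule limit_le_of_deriv_nonneg[OF r, of "\<lambda>r. Nw r - c * Jt r"])
    have "((\<lambda>r. Nw r - c * Jt r) \<longlongrightarrow> 0 - c * 0) (at_right 0)" by (intro tendsto_intros Nw_tendsto_0 Jt_tendsto_0)
    then show "((\<lambda>r. Nw r - c * Jt r) \<longlongrightarrow> 0) (at_right 0)" by simp
    fix t assume t: "0 < t" "t \<le> r"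
    have "((\<lambda>r. Nw r - c * Jt r) has_real_derivative (mw t + real n - p) * (t ^ (n - 1) * K t) - c * (t ^ (n - 1) * K t)) (at t)"
      by (intro DERIV_diff DERIV_cmult Jt_deriv Nw_deriv t)
    moreover have "(mw t + real n - p) * (t ^ (n - 1) * K t) - c * (t ^ (n - 1) * K t) = (mw t - mw r) * (t ^ (n - 1) * K t)"
      by (simp add: c_def algebra_simps)
    moreover have "(mw t - mw r) * (t ^ (n - 1) * K t) \<ge> 0"
      using mw_antimono[OF t] by (intro mult_nonneg_nonneg less_imp_le[OF weight_pos[OF t(1)]]) simp
    ultimately show "\<exists>d. ((\<lambda>r. Nw r - c * Jt r) has_real_derivative d) (at t) \<and> 0 \<le> d" by metis
  qed
  then show ?thesis by (simp add: c_def)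
qed

text \<open>The power of \<open>r\<close> is the one that turns the modulus of the flux into
  \<open>(- (r * u')) powr (p - 1)\<close>.\<close>

definition JJ :: "real \<Rightarrow> real" where "JJ r = r powr (p - real n) * Jt r"

lemma kap_JJ: "r > 0 \<Longrightarrow> kap r / JJ r = Nw r / Jt r"
  unfolding JJ_def kap_def Nw_def by (simp add: powr_diff powr_realpow)

lemma elasticity_exists:
  "\<exists>g. (\<forall>s>u0. (f has_real_derivative g s * f s / s) (at s within {s..}) \<and> g s > p - 1) \<and> antimono_on {u0<..} g"
  "u0 < s \<Longrightarrow> s \<le> t \<Longrightarrow> f s / (s - u0) powr (p - 1) \<le> f t / (t - u0) powr (p - 1)"
proof -
  have f3': "(p - 1) * f u \<le> deriv f u * (u - u0)" if "u > u0" "f differentiable (at u)" for u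
    using f3 that by (auto simp: diff_points_def)
  have f4': "v * deriv f v / f v \<le> u * deriv f u / f u" if "u > u0" "u \<le> v" "f differentiable (at u)" "f differentiable (at v)" for u v
    using f4 that by (auto simp: diff_points_def monotone_on_def)
  note E = elasticity[of u0 p f, OF f1_u0 p_gt f1_pos[rule_format] f2_lip f3' f4']
  show "\<exists>g. (\<forall>s>u0. (f has_real_derivative g s * f s / s) (at s within {s..}) \<and> g s > p - 1) \<and> antimono_on {u0<..} g"
    by (rule E(1)) auto
  show "u0 < s \<Longrightarrow> s \<le> t \<Longrightarrow> f s / (s - u0) powr (p - 1) \<le> f t / (t - u0) powr (p - 1)"
    by (rule E(2)) auto
qed

definition gel :: "real \<Rightarrow> real" where
  "gel = (SOME g. (\<forall>s>u0. (f has_real_derivative g s * f s / s) (at s within {s..}) \<and> g s > p - 1) \<and> antimono_on {u0<..} g)"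

lemma gel: "\<And>s. s > u0 \<Longrightarrow> (f has_real_derivative gel s * f s / s) (at s within {s..})"
  "\<And>s. s > u0 \<Longrightarrow> gel s > p - 1" "antimono_on {u0<..} gel"
  using someI_ex[OF elasticity_exists(1)] unfolding gel_def[symmetric] by auto

lemma f_isCont: "s > 0 \<Longrightarrow> isCont f s"
  by (rule continuous_on_interior[OF f2_cont]) simp

lemma f_u0: "f u0 = 0"
proof (rule antisym)
  have "isCont f u0" using f_isCont f1_u0 .
  then have "(f \<longlongrightarrow> f u0) (at_left u0)" "(f \<longlongrightarrow> f u0) (at_right u0)"
    unfolding isCont_def by (auto intro: tendsto_within_subset)
  moreover have "\<forall>\<^sub>F s in at_left u0. f s \<le> 0"
    using eventually_at_left_real[OF f1_u0] by eventually_elim (use f1_nonpos in auto)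
  moreover have "\<forall>\<^sub>F s in at_right u0. 0 \<le> f s"
    using eventually_at_right_less[of u0] by eventually_elim (use f1_pos in \<open>auto intro: less_imp_le\<close>)
  ultimately show "f u0 \<le> 0" "0 \<le> f u0"
    using tendsto_upperbound[of f "f u0" "at_left u0" 0] tendsto_lowerbound[of f "f u0" "at_right u0" 0] by simp_all
qed

lemma f_nonpos: "0 \<le> s \<Longrightarrow> s \<le> u0 \<Longrightarrow> f s \<le> 0"
  using f1_nonpos f1_zero f_u0 by (cases "s = 0"; cases "s = u0") auto

text \<open>Both monotonicity claims about \<open>JJ\<close> come from \<open>Nw_ge\<close>: the
  derivative of \<open>kap / JJ = Nw / Jt\<close> has the sign of
  \<open>(mw + n - p) * Jt - Nw\<close>, and that of \<open>JJ\<close> the sign of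
  \<open>Nw - (n - p) * Jt\<close>.\<close>

sublocale profile_system p mh u0 kap mw JJ f gel
proof
  show "JJ r > 0" if "r > 0" for r unfolding JJ_def using Jt_pos[OF that] that by simp
  show "(p - 1) * mh + mw r \<le> kap r / JJ r" if "0 < r" for r
  proof -
    have "mw r + real n - p \<le> Nw r / Jt r" using Nw_ge[OF that] Jt_pos[OF that] by (simp add: pos_le_divide_eq)
    then show ?thesis unfolding mh_eq kap_JJ[OF that] by linarith
  qed
  show "kap r' / JJ r' \<le> kap r / JJ r" if r: "0 < r" "r \<le> r'" for r r'
  proof -
    have "Nw r' / Jt r' \<le> Nw r / Jt r"
    proof (rule DERIV_nonpos_imp_nonincreasing[OF r(2)])
      fix x assume "r \<le> x" "x \<le> r'"
      then have x: "x > 0" using r by simp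
      have "((\<lambda>r. Nw r / Jt r) has_real_derivative ((mw x + real n - p) * (x ^ (n - 1) * K x) * Jt x - Nw x * (x ^ (n - 1) * K x)) / (Jt x * Jt x)) (at x)"
        by (rule DERIV_divide[OF Nw_deriv[OF x] Jt_deriv[OF x]]) (use Jt_pos[OF x] in simp)
      moreover have "(mw x + real n - p) * (x ^ (n - 1) * K x) * Jt x - Nw x * (x ^ (n - 1) * K x) = ((mw x + real n - p) * Jt x - Nw x) * (x ^ (n - 1) * K x)"
        by (simp add: algebra_simps)
      moreover have "((mw x + real n - p) * Jt x - Nw x) * (x ^ (n - 1) * K x) / (Jt x * Jt x) \<le> 0"
        using Nw_ge[OF x] weight_pos[OF x] Jt_pos[OF x] by (intro divide_nonpos_pos mult_nonpos_nonneg) auto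
      ultimately show "\<exists>y. ((\<lambda>r. Nw r / Jt r) has_real_derivative y) (at x) \<and> y \<le> 0" by auto
    qed
    then show ?thesis using kap_JJ r by simp
  qed
  show "JJ r \<le> JJ r'" if r: "0 < r" "r \<le> r'" for r r'
  proof (rule DERIV_nonneg_imp_nondecreasing[OF r(2)])
    fix x assume "r \<le> x" "x \<le> r'"
    then have x: "x > 0" using r by simp
    have "(JJ has_real_derivative (p - real n) * x powr (p - real n - 1) * Jt x + x ^ (n - 1) * K x * x powr (p - real n)) (at x)"
      unfolding JJ_def by (rule DERIV_mult[OF has_real_derivative_powr[OF x] Jt_deriv[OF x]])
    moreover have xn: "x ^ n = x * x ^ (n - 1)" using n_pos by (cases n) auto
    have xp: "x powr (p - real n - 1) = x powr (p - real n) / x" using x powr_diff[of x "p - real n" 1] by simp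
    have "(p - real n) * x powr (p - real n - 1) * Jt x + x ^ (n - 1) * K x * x powr (p - real n)
        = x powr (p - real n) / x * (Nw x - (real n - p) * Jt x)"
      unfolding Nw_def xn xp using x by (simp add: field_simps)
    moreover have "Nw x - (real n - p) * Jt x \<ge> 0"
    proof -
      have "0 \<le> mw x * Jt x" using mw_pos[OF x] Jt_pos[OF x] by simp
      then show ?thesis using Nw_ge[OF x] by (simp add: algebra_simps)
    qed
    ultimately show "\<exists>y. (JJ has_real_derivative y) (at x) \<and> 0 \<le> y" using x by (intro exI conjI) auto
  qed
  show "gel t \<le> gel s" if "u0 < s" "s \<le> t" for s t using gel(3) that by (auto simp: monotone_on_def)
qed (use p_gt mh_pos f1_u0 kap_pos kap_deriv mw_pos mw_antimono f2_cont f1_pos f_nonpos gel elasticity_exists(2) in auto)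

end

section \<open>Energy and monotonicity of ground states\<close>

lemma abs_powr_deriv:
  fixes x q :: real
  assumes q: "q > 1"
  shows "((\<lambda>x. \<bar>x\<bar> powr q) has_real_derivative q * \<bar>x\<bar> powr (q - 1) * sgn x) (at x)"
proof -
  consider "x > 0" | "x < 0" | "x = 0" by linarith
  then show ?thesis
  proof cases
    case 1
    have "((\<lambda>x. x powr q) has_real_derivative q * x powr (q - 1)) (at x)" by (rule has_real_derivative_powr[OF 1])
    moreover have "\<forall>\<^sub>F y in nhds x. y powr q = \<bar>y\<bar> powr q"
      using 1 by (intro eventually_mono[OF eventually_nhds_in_open[of "{0<..}" x]]) auto
    ultimately show ?thesis using 1 DERIV_cong_ev[OF refl, of "\<lambda>x. x powr q" "\<lambda>x. \<bar>x\<bar> powr q" x] by simp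
  next
    case 2
    have "((\<lambda>x. (- x) powr q) has_real_derivative q * (- x) powr (q - 1) * (- 1)) (at x)"
      by (rule DERIV_chain'[OF _ has_real_derivative_powr]) (use 2 in \<open>auto intro!: derivative_eq_intros\<close>)
    moreover have "\<forall>\<^sub>F y in nhds x. (- y) powr q = \<bar>y\<bar> powr q"
      using 2 by (intro eventually_mono[OF eventually_nhds_in_open[of "{..<0}" x]]) auto
    ultimately show ?thesis using 2 DERIV_cong_ev[OF refl, of "\<lambda>x. (- x) powr q" "\<lambda>x. \<bar>x\<bar> powr q" x] by simp
  next
    case 3
    have "((\<lambda>h::real. \<bar>h\<bar> powr (q - 1)) \<longlongrightarrow> \<bar>0\<bar> powr (q - 1)) (at 0)"
      by (rule tendsto_powr') (use q in \<open>auto intro!: tendsto_intros tendsto_rabs_zero\<close>)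
    then have lim: "((\<lambda>h::real. \<bar>h\<bar> powr (q - 1)) \<longlongrightarrow> 0) (at 0)" by simp
    have "((\<lambda>h. (\<bar>h\<bar> powr q - \<bar>0\<bar> powr q) / (h - 0)) \<longlongrightarrow> 0) (at 0)"
    proof (rule Lim_null_comparison[OF _ lim])
      show "\<forall>\<^sub>F h in at 0. norm ((\<bar>h\<bar> powr q - \<bar>0\<bar> powr q) / (h - 0)) \<le> \<bar>h\<bar> powr (q - 1)"
        unfolding eventually_at_filter
        by (intro always_eventually) (auto simp: powr_diff abs_divide)
    qed
    then show ?thesis unfolding 3 has_field_derivative_iff by simp
  qed
qed

lemma abs_phi: "\<bar>phi p s\<bar> = \<bar>s\<bar> powr (p - 1)"
  by (cases "s = 0") (auto simp: phi_def abs_mult powr_diff power2_eq_square)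

lemma sgn_phi: "sgn (phi p s) = sgn s"
  by (cases "s = 0") (auto simp: phi_def sgn_mult)

context weighted_problem begin

text \<open>\<open>f\<close> is controlled only on the half-line; composing it with
  \<open>max 0\<close> gives a potential with a two-sided derivative everywhere, also at 0.\<close>

lemma potential_exists: "\<exists>F. (\<forall>x. (F has_real_derivative f (max 0 x)) (at x)) \<and> F 0 = 0"
proof -
  have c: "continuous_on UNIV (\<lambda>x. f (max 0 x))"
    by (rule continuous_on_compose2[OF f2_cont]) (auto intro!: continuous_intros)
  then have "\<exists>F. \<forall>x. - (\<infinity>::ereal) < ereal x \<longrightarrow> ereal x < \<infinity> \<longrightarrow> (F has_vector_derivative f (max 0 x)) (at x)"
    by (intro einterval_antiderivative) (auto simp: continuous_on_eq_continuous_at)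
  then obtain F where F: "\<And>x. (F has_real_derivative f (max 0 x)) (at x)"
    by (auto simp: has_real_derivative_iff_has_vector_derivative)
  then have "((\<lambda>x. F x - F 0) has_real_derivative f (max 0 x)) (at x)" for x
    by (auto intro!: derivative_eq_intros)
  then show ?thesis by (intro exI[of _ "\<lambda>x. F x - F 0"]) simp
qed

definition Fp :: "real \<Rightarrow> real" where
  "Fp = (SOME F. (\<forall>x. (F has_real_derivative f (max 0 x)) (at x)) \<and> F 0 = 0)"

lemma Fp_deriv: "(Fp has_real_derivative f (max 0 x)) (at x)" and Fp_0: "Fp 0 = 0"
  using someI_ex[OF potential_exists] unfolding Fp_def by auto

lemma Fp_isCont: "isCont Fp x" using Fp_deriv DERIV_isCont by blast

lemma Fp_nonpos: "0 \<le> s \<Longrightarrow> s \<le> u0 \<Longrightarrow> Fp s \<le> 0"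
proof -
  assume s: "0 \<le> s" "s \<le> u0"
  have "Fp s \<le> Fp 0"
  proof (rule DERIV_nonpos_imp_nonincreasing[OF s(1), of Fp])
    fix x assume "0 \<le> x" "x \<le> s"
    then have "f (max 0 x) \<le> 0" using f_nonpos s by simp
    then show "\<exists>y. (Fp has_real_derivative y) (at x) \<and> y \<le> 0" using Fp_deriv by blast
  qed
  then show "Fp s \<le> 0" using Fp_0 by simp
qed

text \<open>Above \<open>u0\<close>, \<open>f\<close> is the product of the nondecreasing quotient
  in \<open>f_ratio_mono\<close> and of \<open>(s - u0) powr (p - 1)\<close>.\<close>

lemma f_mono: "u0 \<le> s \<Longrightarrow> s \<le> t \<Longrightarrow> f s \<le> f t"
proof (cases "s = u0")
  case True
  assume "u0 \<le> s" "s \<le> t"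
  then show ?thesis using True f_u0 f1_pos by (cases "t = u0") (auto intro: less_imp_le)
next
  case False
  assume st: "u0 \<le> s" "s \<le> t"
  then have s: "u0 < s" using False by simp
  have eq: "f x = f x / (x - u0) powr (p - 1) * (x - u0) powr (p - 1)" if "x > u0" for x using that by simp
  have "f s / (s - u0) powr (p - 1) * (s - u0) powr (p - 1) \<le> f t / (t - u0) powr (p - 1) * (t - u0) powr (p - 1)"
    using f_ratio_mono[OF s st(2)] s st p_gt f1_pos
    by (intro mult_mono powr_mono2) (auto intro!: divide_nonneg_nonneg less_imp_le)
  then show ?thesis using eq[OF s] eq[of t] s st by simp
qed

end

locale ground_state = weighted_problem +
  fixes u :: "real \<Rightarrow> real"
  assumes sol: "is_solution n p K f u" and nontriv: "nontrivial u"
begin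

section \<open>Regularity and flux of a solution\<close>

abbreviation du :: "real \<Rightarrow> real" where "du \<equiv> half_deriv u"
abbreviation fl :: "real \<Rightarrow> real" where "fl \<equiv> flux n p u"

lemma half_line_deriv:
  assumes "C1_half_line h" "r > 0"
  shows "(h has_real_derivative half_deriv h r) (at r)"
proof -
  have "h differentiable (at r within {0..})" using assms unfolding C1_half_line_def differentiable_on_def by auto
  then have "(h has_vector_derivative half_deriv h r) (at r within {0..})"
    unfolding half_deriv_def by (simp add: vector_derivative_works)
  moreover have "at r within {0..} = at r" using assms(2) by (intro at_within_interior) simp
  ultimately show ?thesis by (simp add: has_real_derivative_iff_has_vector_derivative)
qed

lemma C1u: "C1_half_line u" and C1fl: "C1_half_line fl"
  using sol by (auto simp: is_solution_def)

lemma u_cont: "continuous_on {0..} u" and du_cont: "continuous_on {0..} du" and fl_cont: "continuous_on {0..} fl"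
  using C1u C1fl by (auto simp: C1_half_line_def differentiable_imp_continuous_on)

lemma u_deriv: "r > 0 \<Longrightarrow> (u has_real_derivative du r) (at r)"
  by (rule half_line_deriv[OF C1u])

lemma fl_deriv: "r > 0 \<Longrightarrow> (fl has_real_derivative - (r ^ (n - 1) * K r * f (u r))) (at r)"
proof -
  assume r: "r > 0"
  have "- half_deriv fl r = r ^ (n - 1) * K r * f (u r)" using sol r by (auto simp: is_solution_def)
  then show ?thesis using half_line_deriv[OF C1fl r] by (metis minus_minus)
qed

lemma fl_0: "fl 0 = 0" using n_ge_2 by (simp add: flux_def)

lemma right_limit_at:
  fixes h :: "real \<Rightarrow> real"
  assumes "continuous_on {0..} h" "r \<ge> 0"
  shows "(h \<longlongrightarrow> h r) (at_right r)"
proof -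
  have "(h \<longlongrightarrow> h r) (at r within {0..})" using assms by (simp add: continuous_on_def)
  then show ?thesis by (rule tendsto_within_subset) (use assms in auto)
qed

lemma left_limit_at:
  fixes h :: "real \<Rightarrow> real"
  assumes "continuous_on {0..} h" "r > 0"
  shows "(h \<longlongrightarrow> h r) (at_left r)"
proof -
  have "isCont h r" by (rule continuous_on_interior[OF assms(1)]) (use assms in simp)
  then show ?thesis unfolding isCont_def by (rule tendsto_within_subset) simp
qed

lemma u_nonneg: "r \<ge> 0 \<Longrightarrow> u r \<ge> 0"
proof (cases "r = 0")
  case True
  have "\<forall>\<^sub>F t in at_right 0. 0 \<le> u t"
    using eventually_at_right_less[of "0::real"] by eventually_elim (use sol in \<open>auto simp: is_solution_def\<close>)
  then have "0 \<le> u 0" using right_limit_at[OF u_cont, of 0] by (intro tendsto_lowerbound[of u "u 0" "at_right 0" 0]) auto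
  then show ?thesis using True by simp
qed (use sol in \<open>auto simp: is_solution_def\<close>)

lemma u_at_top: "(u \<longlongrightarrow> 0) at_top" using sol by (simp add: is_solution_def)

definition ww :: "real \<Rightarrow> real" where "ww r = phi p (du r)"

lemma fl_ww: "r > 0 \<Longrightarrow> fl r = r ^ (n - 1) * ww r" by (simp add: flux_def ww_def)

lemma abs_ww: "\<bar>ww r\<bar> = \<bar>du r\<bar> powr (p - 1)" and sgn_ww: "sgn (ww r) = sgn (du r)"
  by (simp_all add: ww_def abs_phi sgn_phi)

lemma abs_ww_powr: "\<bar>ww r\<bar> powr (1 / (p - 1)) = \<bar>du r\<bar>"
  unfolding abs_ww using p_gt by (simp add: powr_powr)

lemma fl_neg_iff: "r > 0 \<Longrightarrow> fl r < 0 \<longleftrightarrow> du r < 0"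
proof -
  assume r: "r > 0"
  have "fl r < 0 \<longleftrightarrow> ww r < 0" unfolding fl_ww[OF r] using r by (simp add: mult_less_0_iff)
  also have "\<dots> \<longleftrightarrow> du r < 0" using sgn_ww[of r] by (metis sgn_less)
  finally show ?thesis .
qed

lemma ww_deriv: "r > 0 \<Longrightarrow> (ww has_real_derivative - K r * f (u r) - (real n - 1) * ww r / r) (at r)"
proof -
  assume r: "r > 0"
  have rn: "r ^ (n - 1) = r * r ^ (n - 2)" using n_ge_2 by (metis Suc_1 Suc_diff_Suc Suc_le_eq numeral_2_eq_2 power_Suc)
  have d1: "((\<lambda>r. r ^ (n - 1)) has_real_derivative (real n - 1) * r ^ (n - 2)) (at r)"
    using n_ge_2 by (auto intro!: derivative_eq_intros simp: of_nat_diff numeral_2_eq_2)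
  have "((\<lambda>r. fl r / r ^ (n - 1)) has_real_derivative
      (- (r ^ (n - 1) * K r * f (u r)) * r ^ (n - 1) - fl r * ((real n - 1) * r ^ (n - 2))) / (r ^ (n - 1) * r ^ (n - 1))) (at r)"
    by (rule DERIV_divide[OF fl_deriv[OF r] d1]) (use r in simp)
  moreover have "(- (r ^ (n - 1) * K r * f (u r)) * r ^ (n - 1) - fl r * ((real n - 1) * r ^ (n - 2))) / (r ^ (n - 1) * r ^ (n - 1))
     = - K r * f (u r) - (real n - 1) * ww r / r"
    unfolding fl_ww[OF r] rn using r by (simp add: field_simps)
  moreover have "\<forall>\<^sub>F t in nhds r. fl t / t ^ (n - 1) = ww t"
    using r by (intro eventually_mono[OF eventually_nhds_in_open[of "{0<..}" r]]) (auto simp: fl_ww)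
  ultimately show ?thesis using DERIV_cong_ev[OF refl, of "\<lambda>r. fl r / r ^ (n - 1)" ww r] by simp
qed

text \<open>The energy with kinetic part \<open>(p - 1) / p * \<bar>du r\<bar> powr p / K r\<close>.
  It is written in \<open>ww = phi p (u')\<close>, because \<open>u'\<close> itself need not be
  differentiable where it vanishes.\<close>

definition En :: "real \<Rightarrow> real" where
  "En r = (p - 1) / p * (\<bar>ww r\<bar> powr (p / (p - 1)) / K r) + Fp (u r)"

lemma ww_powr: "\<bar>ww r\<bar> powr (p / (p - 1)) = \<bar>ww r\<bar> * \<bar>du r\<bar>"
proof -
  have e: "p / (p - 1) = 1 + 1 / (p - 1)" using p_gt by (simp add: field_simps)
  show ?thesis unfolding e powr_add abs_ww_powr by simp
qed

text \<open>The two reaction terms cancel. The friction term \<open>(n - 1) / r\<close> and the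
  variation of \<open>K\<close>, expressed by \<open>r K' = (mw - p) K\<close>, combine into one
  coefficient, which is positive because \<open>n > p\<close> and \<open>mw > 0\<close>.\<close>

lemma En_deriv:
  assumes r: "r > 0"
  shows "(En has_real_derivative - (\<bar>ww r\<bar> * \<bar>du r\<bar> / (r * K r)) * (real n - p + (p - 1) / p * mw r)) (at r)"
proof -
  define w' where "w' = - K r * f (u r) - (real n - 1) * ww r / r"
  have K: "K r > 0" using K_pos r by simp
  have q: "p / (p - 1) > 1" using p_gt by (simp add: field_simps)
  have e: "p / (p - 1) - 1 = 1 / (p - 1)" using p_gt by (simp add: field_simps)
  have "((\<lambda>r. \<bar>ww r\<bar> powr (p / (p - 1))) has_real_derivative p / (p - 1) * \<bar>ww r\<bar> powr (p / (p - 1) - 1) * sgn (ww r) * w') (at r)"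
    by (rule DERIV_chain'[OF ww_deriv[OF r, folded w'_def] abs_powr_deriv[OF q]])
  moreover have "p / (p - 1) * \<bar>ww r\<bar> powr (p / (p - 1) - 1) * sgn (ww r) * w' = p / (p - 1) * (du r * w')"
  proof -
    have "\<bar>du r\<bar> * sgn (du r) = du r" by (rule abs_mult_sgn)
    then show ?thesis unfolding e abs_ww_powr sgn_ww by (metis mult.assoc)
  qed
  ultimately have d1: "((\<lambda>r. \<bar>ww r\<bar> powr (p / (p - 1))) has_real_derivative p / (p - 1) * (du r * w')) (at r)" by metis
  have d2: "((\<lambda>r. Fp (u r)) has_real_derivative f (max 0 (u r)) * du r) (at r)"
    by (rule DERIV_chain'[OF u_deriv[OF r] Fp_deriv])
  have m: "max 0 (u r) = u r" using u_nonneg r by simp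
  have "(En has_real_derivative (p - 1) / p * ((p / (p - 1) * (du r * w') * K r - \<bar>ww r\<bar> powr (p / (p - 1)) * deriv K r) / (K r * K r)) + f (max 0 (u r)) * du r) (at r)"
    unfolding En_def using K
    by (intro DERIV_add DERIV_cmult DERIV_divide d1 d2 K_deriv r) simp
  moreover have "(p - 1) / p * ((p / (p - 1) * (du r * w') * K r - \<bar>ww r\<bar> powr (p / (p - 1)) * deriv K r) / (K r * K r)) + f (max 0 (u r)) * du r
     = - (\<bar>ww r\<bar> * \<bar>du r\<bar> / (r * K r)) * (real n - p + (p - 1) / p * mw r)"
  proof -
    have wd: "ww r * du r = \<bar>ww r\<bar> * \<bar>du r\<bar>"
    proof -
      have "ww r * du r = (\<bar>ww r\<bar> * sgn (du r)) * du r" using sgn_ww[of r] by (metis abs_mult_sgn)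
      also have "\<dots> = \<bar>ww r\<bar> * \<bar>du r\<bar>" by (simp add: abs_sgn mult.assoc mult.commute)
      finally show ?thesis .
    qed
    have a: "du r * w' = - K r * f (u r) * du r - (real n - 1) * (\<bar>ww r\<bar> * \<bar>du r\<bar>) / r"
      unfolding w'_def wd[symmetric] by (simp add: algebra_simps)
    show ?thesis unfolding a m ww_powr K_deriv_mw[OF r] using K r p_gt by (simp add: field_simps)
  qed
  ultimately show ?thesis by simp
qed

lemma dissipation_pos:
  assumes "r > 0"
  shows "real n - p + (p - 1) / p * mw r > 0"
proof -
  have "0 < (p - 1) / p * mw r" using p_gt mw_pos[OF assms] by simp
  then show ?thesis using n_gt by linarith
qed

lemma En_antimono:
  assumes r: "0 < r" "r \<le> t"
  shows "En t \<le> En r"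
proof (rule DERIV_nonpos_imp_nonincreasing[OF r(2)])
  fix x assume "r \<le> x" "x \<le> t"
  then have x: "x > 0" using r by linarith
  have "0 \<le> \<bar>ww x\<bar> * \<bar>du x\<bar> / (x * K x)" using K_pos x by (simp add: less_imp_le)
  then have "- (\<bar>ww x\<bar> * \<bar>du x\<bar> / (x * K x)) * (real n - p + (p - 1) / p * mw x) \<le> 0"
    using dissipation_pos[OF x] by (intro mult_nonpos_nonneg) linarith+
  then show "\<exists>y. (En has_real_derivative y) (at x) \<and> y \<le> 0" using En_deriv[OF x] by blast
qed

lemma Fp_le_En:
  assumes "r > 0"
  shows "Fp (u r) \<le> En r"
proof -
  have "0 \<le> (p - 1) / p * (\<bar>ww r\<bar> powr (p / (p - 1)) / K r)"
    by (rule mult_nonneg_nonneg; rule divide_nonneg_pos) (use assms K_pos p_gt in auto)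
  then show ?thesis unfolding En_def by linarith
qed

text \<open>The energy is nonincreasing and dominates \<open>Fp (u t)\<close>, which tends to
  \<open>Fp 0 = 0\<close>.\<close>

lemma En_nonneg: "r > 0 \<Longrightarrow> 0 \<le> En r"
proof -
  assume r: "r > 0"
  have "((\<lambda>t. Fp (u t)) \<longlongrightarrow> Fp 0) at_top"
    by (rule isCont_tendsto_compose[OF Fp_isCont u_at_top])
  then have "Fp 0 \<le> En r"
  proof (rule tendsto_upperbound)
    show "\<forall>\<^sub>F t in at_top. Fp (u t) \<le> En r"
      using eventually_ge_at_top[of r]
    proof eventually_elim
      case (elim t)
      then show ?case using Fp_le_En[of t] En_antimono[OF r, of t] r by simp
    qed
  qed simp
  then show "0 \<le> En r" using Fp_0 by simp
qed

lemma u_decreasing: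
  assumes "0 \<le> a" "a \<le> b" "\<And>x. a < x \<Longrightarrow> x < b \<Longrightarrow> du x \<le> 0"
  shows "u b \<le> u a"
proof (rule DERIV_nonpos_imp_decreasing_open[OF assms(2)])
  fix x assume "a < x" "x < b"
  then show "\<exists>y. (u has_real_derivative y) (at x) \<and> y \<le> 0" using u_deriv[of x] assms by auto
qed (rule continuous_on_subset[OF u_cont], use assms in auto)

lemma u_increasing:
  assumes "0 \<le> a" "a \<le> b" "\<And>x. a < x \<Longrightarrow> x < b \<Longrightarrow> 0 \<le> du x"
  shows "u a \<le> u b"
proof (rule DERIV_nonneg_imp_increasing_open[OF assms(2)])
  fix x assume "a < x" "x < b"
  then show "\<exists>y. (u has_real_derivative y) (at x) \<and> 0 \<le> y" using u_deriv[of x] assms by auto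
qed (rule continuous_on_subset[OF u_cont], use assms in auto)

text \<open>From \<open>r\<close> on the energy is both nonincreasing and nonnegative, hence 0. Then
  nothing is dissipated, so \<open>u' = 0\<close> and \<open>u\<close> equals its limit 0.\<close>

lemma vanish:
  assumes r: "r > 0" "En r \<le> 0" and t: "t \<ge> r"
  shows "u t = 0"
proof -
  have E0: "En x = 0" if "x \<ge> r" for x
    using En_antimono[OF r(1) that] En_nonneg[of x] r that by simp
  have du0: "du x = 0" if x: "x > r" for x
  proof -
    have x0: "x > 0" using x r by simp
    have "\<forall>\<^sub>F y in nhds x. En y = 0"
      using x by (intro eventually_mono[OF eventually_nhds_in_open[of "{r<..}" x]]) (auto simp: E0)
    then have "(En has_real_derivative 0) (at x)" using DERIV_cong_ev[OF refl, of En "\<lambda>_. 0" x] by simp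
    then have "- (\<bar>ww x\<bar> * \<bar>du x\<bar> / (x * K x)) * (real n - p + (p - 1) / p * mw x) = 0"
      using DERIV_unique En_deriv[OF x0] by blast
    then have "\<bar>ww x\<bar> * \<bar>du x\<bar> = 0" using dissipation_pos[OF x0] K_pos x0 by (auto simp: less_imp_neq[symmetric])
    then show ?thesis using abs_ww[of x] by auto
  qed
  have const: "u x = u t" if "x \<ge> t" for x
  proof -
    have dx: "du y = 0" if "t < y" for y using du0[of y] t that by simp
    have t0: "0 \<le> t" using r(1) t by simp
    have "u x \<le> u t" by (rule u_decreasing[OF t0 that]) (simp add: dx)
    moreover have "u t \<le> u x" by (rule u_increasing[OF t0 that]) (simp add: dx)
    ultimately show ?thesis by simp
  qed
  have "\<forall>\<^sub>F x in at_top. u x = u t" using eventually_ge_at_top[of t] by eventually_elim (rule const)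
  then have "(u \<longlongrightarrow> u t) at_top" by (rule tendsto_eventually)
  then show ?thesis using u_at_top tendsto_unique by (metis trivial_limit_at_top_linorder)
qed

lemma fl_bound:
  obtains C where "C \<ge> 0" "\<And>r. 0 < r \<Longrightarrow> r \<le> 1 \<Longrightarrow> \<bar>fl r\<bar> \<le> C * Jt r"
proof -
  have c: "continuous_on {0..1} (\<lambda>r. f (u r))"
  proof (rule continuous_on_compose2[OF f2_cont continuous_on_subset[OF u_cont]])
    show "u ` {0..1} \<subseteq> {0..}" using u_nonneg by (simp add: image_subset_iff)
    show "{0..1::real} \<subseteq> {0..}" by simp
  qed
  have "bounded ((\<lambda>r. f (u r)) ` {0..1})" by (intro compact_imp_bounded compact_continuous_image c) auto
  then obtain C where "\<forall>y\<in>(\<lambda>r. f (u r)) ` {0..1}. norm y \<le> C" unfolding bounded_iff by blast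
  then have C: "\<bar>f (u r)\<bar> \<le> C" if "0 \<le> r" "r \<le> 1" for r using that by auto
  have fl0: "(fl \<longlongrightarrow> 0) (at_right 0)" using right_limit_at[OF fl_cont, of 0] fl_0 by simp
  show thesis
  proof (rule that[of C])
    show "C \<ge> 0" using C[of 0] by simp
    fix r :: real assume r: "0 < r" "r \<le> 1"
    have dpos: "((\<lambda>r. C * Jt r + a * fl r) has_real_derivative (C - a * f (u t)) * (t ^ (n - 1) * K t)) (at t)" if t: "t > 0" for t a
      by (rule DERIV_cong[OF DERIV_add[OF DERIV_cmult[OF Jt_deriv[OF t]] DERIV_cmult[OF fl_deriv[OF t]]]]) (simp add: algebra_simps)
    have lim: "((\<lambda>r. C * Jt r + a * fl r) \<longlongrightarrow> 0) (at_right 0)" for a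
    proof -
      have "((\<lambda>r. C * Jt r + a * fl r) \<longlongrightarrow> C * 0 + a * 0) (at_right 0)" by (intro tendsto_intros Jt_tendsto_0 fl0)
      then show ?thesis by simp
    qed
    have *: "0 \<le> C * Jt r + a * fl r" if a: "\<bar>a\<bar> = 1" for a
    proof (rule limit_le_of_deriv_nonneg[OF r(1) _ lim])
      fix t assume t: "0 < t" "t \<le> r"
      have "\<bar>a * f (u t)\<bar> \<le> C" using C[of t] t r a by (simp add: abs_mult)
      then have "0 \<le> (C - a * f (u t)) * (t ^ (n - 1) * K t)"
        by (intro mult_nonneg_nonneg less_imp_le[OF weight_pos[OF t(1)]]) simp
      then show "\<exists>d. ((\<lambda>r. C * Jt r + a * fl r) has_real_derivative d) (at t) \<and> 0 \<le> d" using dpos[OF t(1)] by blast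
    qed
    show "\<bar>fl r\<bar> \<le> C * Jt r" using *[of 1] *[of "-1"] by simp
  qed
qed

text \<open>The kinetic part vanishes at 0 whatever \<open>K\<close> does there. Integrating the
  equation gives \<open>\<bar>ww r\<bar> \<le> c * (r * K r)\<close>, and for
  \<open>q = p / (p - 1)\<close> one has
  \<open>(r * K r) powr q / K r = kap r powr (1 / (p - 1))\<close>, which tends to 0.\<close>

lemma En_tendsto: "(En \<longlongrightarrow> Fp (u 0)) (at_right 0)"
proof -
  obtain C where C: "C \<ge> 0" "\<And>r. 0 < r \<Longrightarrow> r \<le> 1 \<Longrightarrow> \<bar>fl r\<bar> \<le> C * Jt r" using fl_bound by blast
  define c where "c = C / (real n - p)"
  have c: "c \<ge> 0" unfolding c_def using C n_gt by simp
  define q where "q = p / (p - 1)"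
  have q: "q > 0" "q - 1 = 1 / (p - 1)" unfolding q_def using p_gt by (auto simp: field_simps)
  have bound: "\<bar>ww r\<bar> powr q / K r \<le> c powr q * kap r powr (1 / (p - 1))" if r: "0 < r" "r \<le> 1" for r
  proof -
    have K: "K r > 0" using K_pos r by simp
    have rn: "r ^ n = r * r ^ (n - 1)" using n_pos by (cases n) auto
    have "(real n - p) * Jt r \<le> (mw r + real n - p) * Jt r"
      using mw_pos[OF r(1)] Jt_pos[OF r(1)] by (intro mult_right_mono) auto
    then have "(real n - p) * Jt r \<le> Nw r" using Nw_ge[OF r(1)] by simp
    then have "Jt r \<le> Nw r / (real n - p)" using n_gt by (simp add: field_simps)
    then have "\<bar>fl r\<bar> \<le> C * (Nw r / (real n - p))" using C(2)[OF r] C(1) mult_left_mono order_trans by blast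
    then have "r ^ (n - 1) * \<bar>ww r\<bar> \<le> r ^ (n - 1) * (c * (r * K r))"
      unfolding fl_ww[OF r(1)] Nw_def c_def rn using r by (simp add: abs_mult mult_ac)
    then have "\<bar>ww r\<bar> \<le> c * (r * K r)" by (rule mult_left_le_imp_le) (use r in simp)
    then have "\<bar>ww r\<bar> powr q \<le> (c * (r * K r)) powr q" using q by (intro powr_mono2) auto
    also have "\<dots> = c powr q * (r powr q * K r powr q)" using c r K by (simp add: powr_mult)
    finally have "\<bar>ww r\<bar> powr q / K r \<le> c powr q * (r powr q * K r powr q) / K r" using K by (intro divide_right_mono) auto
    also have "\<dots> = c powr q * (r powr q * K r powr (q - 1))"
    proof -
      have "K r powr (q - 1) = K r powr q / K r" using K powr_diff[of "K r" q 1] by simp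
      then show ?thesis by (simp only: times_divide_eq_right mult.assoc)
    qed
    also have "r powr q * K r powr (q - 1) = kap r powr (1 / (p - 1))"
      unfolding q(2) kap_def using r K by (simp add: powr_mult powr_powr q_def)
    finally show ?thesis .
  qed
  have "((\<lambda>r. kap r powr (1 / (p - 1))) \<longlongrightarrow> 0 powr (1 / (p - 1))) (at_right 0)"
  proof (rule tendsto_powr'[OF kap_tendsto_0 tendsto_const])
    show "0 \<noteq> 0 \<or> 0 < 1 / (p - 1) \<and> (\<forall>\<^sub>F x in at_right 0. 0 \<le> kap x)"
      using p_gt eventually_mono[OF eventually_at_right_less[of "0::real"], of "\<lambda>x. 0 \<le> kap x"] kap_pos by (auto intro: less_imp_le)
  qed
  then have "((\<lambda>r. c powr q * kap r powr (1 / (p - 1))) \<longlongrightarrow> c powr q * 0) (at_right 0)"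
    by (intro tendsto_intros) simp
  then have lim: "((\<lambda>r. c powr q * kap r powr (1 / (p - 1))) \<longlongrightarrow> 0) (at_right 0)" by simp
  have "((\<lambda>r. \<bar>ww r\<bar> powr q / K r) \<longlongrightarrow> 0) (at_right 0)"
  proof (rule tendsto_sandwich[OF _ _ tendsto_const lim])
    show "\<forall>\<^sub>F r in at_right 0. 0 \<le> \<bar>ww r\<bar> powr q / K r"
      using eventually_at_right_less[of "0::real"] by eventually_elim (use K_pos in \<open>auto intro!: divide_nonneg_pos\<close>)
    show "\<forall>\<^sub>F r in at_right 0. \<bar>ww r\<bar> powr q / K r \<le> c powr q * kap r powr (1 / (p - 1))"
      using eventually_at_right_real[of 0 "1::real", simplified] by eventually_elim (use bound in auto)
  qed
  moreover have "((\<lambda>r. Fp (u r)) \<longlongrightarrow> Fp (u 0)) (at_right 0)"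
    by (rule isCont_tendsto_compose[OF Fp_isCont right_limit_at[OF u_cont]]) simp
  ultimately have "((\<lambda>r. (p - 1) / p * (\<bar>ww r\<bar> powr q / K r) + Fp (u r)) \<longlongrightarrow> (p - 1) / p * 0 + Fp (u 0)) (at_right 0)"
    by (intro tendsto_intros)
  then show ?thesis unfolding En_def q_def by simp
qed

text \<open>A start at or below \<open>u0\<close> has nonpositive potential, hence nonpositive
  energy from the beginning, and \<open>vanish\<close> makes the solution trivial.\<close>

lemma u_0_gt: "u 0 > u0"
proof (rule ccontr)
  assume "\<not> u 0 > u0"
  then have F: "Fp (u 0) \<le> 0" using Fp_nonpos u_nonneg by simp
  have zero: "u t = 0" if t: "t > 0" for t
  proof (rule vanish[OF t _ order_refl])
    have "En t \<le> Fp (u 0)"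
    proof (rule tendsto_lowerbound[OF En_tendsto])
      show "\<forall>\<^sub>F r in at_right 0. En t \<le> En r"
        using eventually_at_right_real[OF t] by eventually_elim (use En_antimono in auto)
    qed simp
    then show "En t \<le> 0" using F by simp
  qed
  have "(u \<longlongrightarrow> 0) (at_right 0)"
    by (rule tendsto_eventually) (use eventually_at_right_less[of "0::real"] zero in \<open>auto elim: eventually_mono\<close>)
  then have "u 0 = 0" using right_limit_at[OF u_cont, of 0] tendsto_unique[of "at_right 0" u] by auto
  then show False using zero nontriv unfolding nontrivial_def by (metis order_le_less)
qed

text \<open>Until \<open>u\<close> first reaches \<open>u0\<close> the flux decreases strictly from
  0. After that, a first critical point \<open>t\<close> would have no kinetic energy and
  \<open>Fp (u t) \<le> 0\<close>, so that \<open>u\<close> would vanish from \<open>t\<close> on,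
  contrary to \<open>u r > 0\<close>.\<close>

lemma du_neg:
  assumes r: "r > 0" and ur: "u r > 0"
  shows "du r < 0"
proof -
  define R where "R = {t. 0 \<le> t \<and> u t \<le> u0}"
  have R: "R = {t \<in> {0..}. u t \<le> u0}" by (auto simp: R_def)
  have "closed R" unfolding R
    by (intro continuous_on_closed_Collect_le u_cont continuous_on_const) auto
  moreover have "R \<noteq> {}"
  proof -
    have "\<forall>\<^sub>F t in at_top. u t < u0" by (rule order_tendstoD(2)[OF u_at_top f1_u0])
    then have "\<forall>\<^sub>F t in at_top. u t < u0 \<and> t \<ge> 0" using eventually_ge_at_top[of "0::real"] by eventually_elim simp
    from eventually_happens[OF this] show ?thesis unfolding R_def by (auto intro: less_imp_le)
  qed
  moreover have bR: "bdd_below R" by (auto simp: R_def)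
  ultimately have "Inf R \<in> R" by (intro closed_contains_Inf)
  define r0 where "r0 = Inf R"
  have r0: "0 \<le> r0" "u r0 \<le> u0" using \<open>Inf R \<in> R\<close> by (auto simp: r0_def R_def)
  have r0p: "r0 > 0" using r0 u_0_gt by (cases "r0 = 0") auto
  have before: "u t > u0" if "0 \<le> t" "t < r0" for t
  proof (rule ccontr)
    assume "\<not> u t > u0"
    then have "t \<in> R" using that by (auto simp: R_def)
    then have "r0 \<le> t" unfolding r0_def using bR by (rule cInf_lower)
    then show False using that by simp
  qed
  have early: "du t < 0" if t: "0 < t" "t \<le> r0" for t
  proof -
    have "fl t < fl 0"
    proof (rule DERIV_neg_imp_decreasing_open[OF t(1)])
      fix x assume x: "0 < x" "x < t"
      have "0 < x ^ (n - 1) * K x * f (u x)" using weight_pos[OF x(1)] f1_pos before[of x] x t by simp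
      then show "\<exists>y. (fl has_real_derivative y) (at x) \<and> y < 0" using fl_deriv[OF x(1)] by (intro exI conjI) auto
    qed (rule continuous_on_subset[OF fl_cont], auto)
    then show ?thesis using fl_0 fl_neg_iff[OF t(1)] by simp
  qed
  show ?thesis
  proof (cases "r \<le> r0")
    case True
    then show ?thesis using early r by simp
  next
    case False
    show ?thesis
    proof (rule ccontr)
      assume n: "\<not> du r < 0"
      define S where "S = {t \<in> {r0..r}. 0 \<le> du t}"
      have "closed S" unfolding S_def
        by (intro continuous_on_closed_Collect_le continuous_on_const continuous_on_subset[OF du_cont]) (use r0 in auto)
      moreover have "r \<in> S" using n False by (auto simp: S_def)
      moreover have bS: "bdd_below S" by (auto simp: S_def)
      ultimately have "Inf S \<in> S" by (intro closed_contains_Inf) auto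
      define t where "t = Inf S"
      have t: "r0 \<le> t" "t \<le> r" "0 \<le> du t" using \<open>Inf S \<in> S\<close> by (auto simp: t_def S_def)
      have t0: "r0 < t" using t early[of r0] r0p by (cases "t = r0") auto
      have neg: "du x < 0" if "r0 \<le> x" "x < t" for x
      proof (rule ccontr)
        assume "\<not> du x < 0"
        then have "x \<in> S" using that t by (auto simp: S_def)
        then have "t \<le> x" unfolding t_def using bS by (rule cInf_lower)
        then show False using that by simp
      qed
      have tp: "t > 0" using t0 r0p by simp
      have "\<forall>\<^sub>F x in at_left t. du x \<le> 0"
        using eventually_at_left_real[OF t0] by eventually_elim (auto intro!: less_imp_le[OF neg])
      then have "du t \<le> 0" using left_limit_at[OF du_cont tp] by (intro tendsto_upperbound[of du "du t" "at_left t" 0]) auto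
      then have d0: "du t = 0" using t by simp
      have "u t \<le> u r0"
        by (rule u_decreasing[OF r0(1) t(1)]) (auto intro!: less_imp_le[OF neg])
      then have "Fp (u t) \<le> 0" using Fp_nonpos u_nonneg[of t] r0 tp by simp
      moreover have "ww t = 0" using abs_ww[of t] d0 by simp
      ultimately have "En t \<le> 0" unfolding En_def by simp
      then show False using vanish[OF tp _ t(2)] ur by simp
    qed
  qed
qed

lemma du_zero:
  assumes r: "r > 0" and ur: "u r = 0"
  shows "du r = 0"
proof (rule DERIV_local_min[OF u_deriv[OF r] r])
  show "\<forall>y. \<bar>r - y\<bar> < r \<longrightarrow> u r \<le> u y" using u_nonneg ur by auto
qed

lemma du_nonpos: "r > 0 \<Longrightarrow> du r \<le> 0"
  using du_neg[of r] du_zero[of r] u_nonneg[of r] by linarith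

lemma u_antimono: "0 \<le> r \<Longrightarrow> r \<le> t \<Longrightarrow> u t \<le> u r"
  by (rule u_decreasing, assumption+, rule du_nonpos) linarith

lemma u_strict:
  assumes r: "0 \<le> r" "r < t" and ut: "u t > 0"
  shows "u t < u r"
proof (rule DERIV_neg_imp_decreasing_open[OF r(2)])
  fix x assume x: "r < x" "x < t"
  then have x0: "x > 0" using r by linarith
  have "u t \<le> u x" by (rule u_antimono) (use x x0 in linarith)+
  then have "u x > 0" using ut by linarith
  then show "\<exists>y. (u has_real_derivative y) (at x) \<and> y < 0" using u_deriv[OF x0] du_neg[OF x0] by blast
next
  show "continuous_on {r..t} u" by (rule continuous_on_subset[OF u_cont]) (use r in auto)
qed

end

section \<open>The profile of a ground state\<close>

context ground_state begin

text \<open>A solution that reaches 0 at a finite radius and stays there is not excluded, so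
  \<open>u\<close> is inverted only where it is positive.\<close>

definition posset :: "real set" where "posset = {r. 0 < r \<and> 0 < u r}"
definition rho :: "real \<Rightarrow> real" where "rho = inv_into posset u"
definition zp :: "real \<Rightarrow> real" where "zp s = - (rho s * du (rho s))"

lemma open_posset: "open posset"
proof -
  have "open ({0<..} \<inter> u -` {0<..})"
    by (rule continuous_open_preimage[OF continuous_on_subset[OF u_cont]]) auto
  moreover have "posset = {0<..} \<inter> u -` {0<..}" by (auto simp: posset_def)
  ultimately show ?thesis by simp
qed

lemma rho_u:
  assumes "0 < r" "0 < u r"
  shows "rho (u r) = r"
proof -
  have "inj_on u posset"
  proof (rule linorder_inj_onI)
    fix x y assume "x < y" "x \<in> posset" "y \<in> posset"
    then show "u x \<noteq> u y" using u_strict[of x y] by (auto simp: posset_def)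
  qed auto
  then show ?thesis unfolding rho_def using assms by (intro inv_into_f_f) (auto simp: posset_def)
qed

lemma u_lt_u0: "0 < r \<Longrightarrow> 0 < u r \<Longrightarrow> u r < u 0"
  by (rule u_strict[OF order_refl])

lemma rho:
  assumes s: "0 < s" "s < u 0"
  shows "0 < rho s" "u (rho s) = s"
proof -
  have "\<forall>\<^sub>F r in at_top. u r < s" by (rule order_tendstoD(2)[OF u_at_top s(1)])
  then have "\<forall>\<^sub>F r in at_top. u r < s \<and> 0 \<le> r" using eventually_ge_at_top[of "0::real"] by eventually_elim simp
  from eventually_happens[OF this] obtain b where b: "u b < s" "0 \<le> b" by auto
  have "\<exists>x\<ge>0. x \<le> b \<and> u x = s"
    by (rule IVT2') (use b s in \<open>auto intro: continuous_on_subset[OF u_cont]\<close>)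
  then obtain x where x: "0 \<le> x" "u x = s" by blast
  then have "0 < x" using s by (cases "x = 0") auto
  then have "rho s = x" using rho_u[of x] x s by simp
  then show "0 < rho s" "u (rho s) = s" using x \<open>0 < x\<close> by auto
qed

lemma rho_deriv:
  assumes s: "0 < s" "s < u 0"
  shows "(rho has_real_derivative 1 / du (rho s)) (at s)"
proof -
  note r = rho[OF s]
  have "(rho has_real_derivative 1 / du (rho s)) (at (u (rho s)))"
  proof (rule DERIV_inverse_open[where f=u and x="rho s", OF open_posset])
    show "rho s \<in> posset" using r s by (simp add: posset_def)
    show "continuous_on posset u" by (rule continuous_on_subset[OF u_cont]) (auto simp: posset_def)
    show "rho (u x) = x" if "x \<in> posset" for x using rho_u that by (simp add: posset_def)
    show "(u has_real_derivative du (rho s)) (at (rho s))" by (rule u_deriv[OF r(1)])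
    show "du (rho s) \<noteq> 0" using du_neg[OF r(1)] r s by simp
  qed
  then show ?thesis unfolding r(2) .
qed

lemma minus_fl:
  assumes "r > 0"
  shows "- fl r = r ^ (n - 1) * \<bar>du r\<bar> powr (p - 1)"
proof -
  have "ww r \<le> 0" using sgn_ww[of r] du_nonpos[OF assms] by (metis sgn_le_0_iff)
  then show ?thesis unfolding fl_ww[OF assms] abs_ww[symmetric] by simp
qed

lemma slope_powr:
  assumes r: "r > 0"
  shows "(- (r * du r)) powr (p - 1) = r powr (p - real n) * (- fl r)"
proof -
  have "r ^ (n - 1) = r powr (real n - 1)" using r n_pos by (simp add: powr_realpow[symmetric] of_nat_diff)
  then have e: "r powr (p - real n) * r ^ (n - 1) = r powr (p - 1)" using r by (simp add: powr_add[symmetric])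
  have "- (r * du r) = r * \<bar>du r\<bar>" using du_nonpos[OF r] by simp
  then have "(- (r * du r)) powr (p - 1) = r powr (p - 1) * \<bar>du r\<bar> powr (p - 1)"
    using r by (simp add: powr_mult)
  then show ?thesis unfolding minus_fl[OF r] e[symmetric] by simp
qed

text \<open>Differentiability is known for the flux and not for \<open>u'\<close>. The slope is
  therefore differentiated as the power \<open>1 / (p - 1)\<close> of
  \<open>A = r powr (p - n) * (- fl r)\<close>, which is positive where \<open>u\<close> is.\<close>

lemma slope_deriv:
  assumes r: "r > 0" "u r > 0"
  defines "z \<equiv> - (r * du r)"
  shows "((\<lambda>r. - (r * du r)) has_real_derivative (z / r) * (kap r * f (u r) * z powr (1 - p) / (p - 1) - mh)) (at r)"
proof -
  have z: "z > 0" unfolding z_def using r du_neg[OF r] by (simp add: mult_pos_neg)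
  define A where "A = (\<lambda>r. r powr (p - real n) * (- fl r))"
  have Az: "A r = z powr (p - 1)" unfolding A_def z_def slope_powr[OF r(1)] ..
  then have Ap: "A r > 0" using z by simp
  have rn: "r powr (p - real n) * (r ^ (n - 1) * K r) = kap r / r"
  proof -
    have "r ^ (n - 1) = r powr (real n - 1)" using r n_pos by (simp add: powr_realpow[symmetric] of_nat_diff)
    then have "r powr (p - real n) * r ^ (n - 1) = r powr (p - 1)" using r by (simp add: powr_add[symmetric])
    then have "r powr (p - real n) * (r ^ (n - 1) * K r) = r powr (p - 1) * K r" by (metis mult.assoc)
    then show ?thesis unfolding kap_def using r by (simp add: powr_diff)
  qed
  have dA: "(A has_real_derivative (p - real n) * A r / r + kap r / r * f (u r)) (at r)"
  proof -
    have "(A has_real_derivative (p - real n) * r powr (p - real n - 1) * (- fl r) + - (- (r ^ (n - 1) * K r * f (u r))) * r powr (p - real n)) (at r)"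
      unfolding A_def by (rule DERIV_mult[OF has_real_derivative_powr[OF r(1)] DERIV_minus[OF fl_deriv[OF r(1)]]])
    moreover have "r powr (p - real n - 1) = r powr (p - real n) / r" using powr_diff[of r "p - real n" 1] r by simp
    then have "(p - real n) * r powr (p - real n - 1) * (- fl r) = (p - real n) * A r / r" unfolding A_def by simp
    moreover have "- (- (r ^ (n - 1) * K r * f (u r))) * r powr (p - real n) = kap r / r * f (u r)"
      unfolding rn[symmetric] by (simp add: mult_ac)
    ultimately show ?thesis by metis
  qed
  have "((\<lambda>r. A r powr (1 / (p - 1))) has_real_derivative 1 / (p - 1) * A r powr (1 / (p - 1)) / A r * ((p - real n) * A r / r + kap r / r * f (u r))) (at r)"
    by (rule powr_within_deriv[OF dA Ap])
  moreover have "A r powr (1 / (p - 1)) = z" unfolding Az using z p_gt by (simp add: powr_powr)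
  moreover have "1 / (p - 1) * z / A r * ((p - real n) * A r / r + kap r / r * f (u r)) = (z / r) * (kap r * f (u r) * z powr (1 - p) / (p - 1) - mh)"
  proof -
    have i: "z powr (1 - p) = 1 / A r" unfolding Az using powr_minus_divide[of z "p - 1"] by simp
    have pn: "p - real n = - ((p - 1) * mh)" using mh_eq by simp
    show ?thesis unfolding i pn using Ap p_gt r by (simp add: field_simps)
  qed
  moreover have "\<forall>\<^sub>F t in nhds r. A t powr (1 / (p - 1)) = - (t * du t)"
  proof (rule eventually_mono[OF eventually_nhds_in_open[of "{0<..}" r]])
    fix t :: real assume "t \<in> {0<..}"
    then have t: "t > 0" by simp
    have "- (t * du t) \<ge> 0" using t du_nonpos[OF t] by (simp add: mult_nonneg_nonpos)
    then show "A t powr (1 / (p - 1)) = - (t * du t)"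
      unfolding A_def slope_powr[OF t, symmetric] using p_gt by (simp add: powr_powr)
  qed (use r in auto)
  ultimately show ?thesis
    using DERIV_cong_ev[OF refl, of "\<lambda>r. A r powr (1 / (p - 1))" "\<lambda>t. - (t * du t)" r] by simp
qed

text \<open>Integration of the equation from 0: on \<open>(0, r]\<close> the values
  \<open>f (u t)\<close> lie between \<open>f (u r)\<close> and \<open>f (u 0)\<close>, because
  \<open>u\<close> decreases and \<open>f\<close> is nondecreasing above \<open>u0\<close>.\<close>

lemma flux_bounds:
  assumes r: "0 < r" "u0 < u r"
  shows "f (u r) * Jt r \<le> - fl r" "- fl r \<le> f (u 0) * Jt r"
proof -
  have fl0: "(fl \<longlongrightarrow> 0) (at_right 0)" using right_limit_at[OF fl_cont, of 0] fl_0 by simp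
  have d: "((\<lambda>r. a * fl r + c * Jt r) has_real_derivative (c - a * f (u t)) * (t ^ (n - 1) * K t)) (at t)" if t: "t > 0" for t a c
    by (rule DERIV_cong[OF DERIV_add[OF DERIV_cmult[OF fl_deriv[OF t]] DERIV_cmult[OF Jt_deriv[OF t]]]]) (simp add: algebra_simps)
  have lim: "((\<lambda>r. a * fl r + c * Jt r) \<longlongrightarrow> 0) (at_right 0)" for a c
  proof -
    have "((\<lambda>r. a * fl r + c * Jt r) \<longlongrightarrow> a * 0 + c * 0) (at_right 0)" by (intro tendsto_intros Jt_tendsto_0 fl0)
    then show ?thesis by simp
  qed
  have *: "0 \<le> a * fl r + c * Jt r" if ac: "\<And>t. 0 < t \<Longrightarrow> t \<le> r \<Longrightarrow> 0 \<le> c - a * f (u t)" for a c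
  proof (rule limit_le_of_deriv_nonneg[OF r(1) _ lim])
    fix t assume t: "0 < t" "t \<le> r"
    have "0 \<le> (c - a * f (u t)) * (t ^ (n - 1) * K t)"
      by (rule mult_nonneg_nonneg[OF ac[OF t] less_imp_le[OF weight_pos[OF t(1)]]])
    then show "\<exists>d. ((\<lambda>r. a * fl r + c * Jt r) has_real_derivative d) (at t) \<and> 0 \<le> d" using d[OF t(1)] by blast
  qed
  have ut: "u r \<le> u t" "u t \<le> u 0" if "0 < t" "t \<le> r" for t using u_antimono[of t r] u_antimono[of 0 t] that by auto
  have "0 \<le> (-1) * fl r + (- f (u r)) * Jt r"
  proof (rule *)
    fix t assume t: "0 < t" "t \<le> r"
    show "0 \<le> - f (u r) - (-1) * f (u t)" using f_mono[of "u r" "u t"] ut[OF t] r by simp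
  qed
  then show "f (u r) * Jt r \<le> - fl r" by simp
  have "0 \<le> 1 * fl r + f (u 0) * Jt r"
  proof (rule *)
    fix t assume t: "0 < t" "t \<le> r"
    show "0 \<le> f (u 0) - 1 * f (u t)" using f_mono[of "u t" "u 0"] ut[OF t] r by simp
  qed
  then show "- fl r \<le> f (u 0) * Jt r" by simp
qed

text \<open>If \<open>- (r * du r) \<ge> d\<close> at all small positive levels,
  \<open>u + d * ln r\<close> is nonincreasing and \<open>u\<close> reaches 0 at a finite radius
  \<open>r2\<close>. There \<open>u' = 0\<close>, because 0 is the minimum of \<open>u\<close>,
  whereas continuity preserves the bound \<open>d\<close>.\<close>

lemma slope_not_bounded_below:
  assumes d: "d > 0" and e: "e > 0" and z: "\<And>s. 0 < s \<Longrightarrow> s < e \<Longrightarrow> s < u 0 \<Longrightarrow> d \<le> zp s"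
  shows False
proof -
  define s where "s = min e (u 0) / 2"
  have s: "0 < s" "s < e" "s < u 0" using e u_0_gt f1_u0 unfolding s_def by auto
  define r1 where "r1 = rho s"
  have r1: "r1 > 0" "u r1 = s" using rho[OF s(1,3)] unfolding r1_def by auto
  have slope: "d \<le> - (r * du r)" if "r1 \<le> r" "u r > 0" for r
  proof -
    have r: "r > 0" using that r1 by linarith
    have "u r \<le> s" using u_antimono[of r1 r] that r1 by simp
    then show ?thesis using z[of "u r"] that s rho_u[OF r that(2)] unfolding zp_def by simp
  qed
  define R where "R = {r \<in> {r1..}. u r \<le> 0}"
  have "closed R" unfolding R_def
    by (intro continuous_on_closed_Collect_le continuous_on_const continuous_on_subset[OF u_cont] closed_atLeast) (use r1 in auto)
  moreover have "R \<noteq> {}"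
  proof
    assume "R = {}"
    then have up: "u r > 0" if "r \<ge> r1" for r using that by (force simp: R_def)
    \<comment> \<open>The radius by which a logarithmic decay at rate \<open>d\<close> has used up
      the level \<open>s = u r1\<close>.\<close>
    define r2 where "r2 = r1 * exp (s / d)"
    have r2: "r1 \<le> r2" unfolding r2_def using r1 s d by simp
    have "u r2 + d * ln r2 \<le> u r1 + d * ln r1"
    proof (rule DERIV_nonpos_imp_nonincreasing[OF r2, of "\<lambda>r. u r + d * ln r"])
      fix x assume x: "r1 \<le> x" "x \<le> r2"
      then have x0: "x > 0" using r1 by linarith
      have "((\<lambda>r. u r + d * ln r) has_real_derivative du x + d * (1 / x)) (at x)"
        by (intro DERIV_add DERIV_cmult u_deriv DERIV_ln_divide x0)
      moreover have "du x + d * (1 / x) \<le> 0" using slope[OF x(1) up[OF x(1)]] x0 by (simp add: field_simps)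
      ultimately show "\<exists>y. ((\<lambda>r. u r + d * ln r) has_real_derivative y) (at x) \<and> y \<le> 0" by blast
    qed
    moreover have "ln r2 = ln r1 + s / d" unfolding r2_def using r1 by (simp add: ln_mult)
    ultimately have "u r2 \<le> 0" using r1 d by (simp add: distrib_left)
    then show False using up[OF r2] by simp
  qed
  moreover have "bdd_below R" by (auto simp: R_def)
  ultimately have RI: "Inf R \<in> R" by (intro closed_contains_Inf)
  define r2 where "r2 = Inf R"
  have r2: "r1 \<le> r2" "u r2 \<le> 0" using RI by (auto simp: r2_def R_def)
  have r21: "r1 < r2" using r2 r1 s by (cases "r1 = r2") auto
  have r2p: "r2 > 0" using r21 r1 by linarith
  have up: "u r > 0" if "r1 \<le> r" "r < r2" for r
  proof (rule ccontr)
    assume "\<not> u r > 0"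
    then have "r \<in> R" using that by (auto simp: R_def)
    then have "r2 \<le> r" unfolding r2_def using \<open>bdd_below R\<close> by (intro cInf_lower)
    then show False using that by simp
  qed
  have "(du \<longlongrightarrow> du r2) (at_left r2)" by (rule left_limit_at[OF du_cont r2p])
  then have lim: "((\<lambda>r. - (r * du r)) \<longlongrightarrow> - (r2 * du r2)) (at_left r2)" by (intro tendsto_intros)
  have "d \<le> - (r2 * du r2)"
  proof (rule tendsto_lowerbound[OF lim])
    show "\<forall>\<^sub>F r in at_left r2. d \<le> - (r * du r)"
      using eventually_at_left_real[OF r21]
    proof eventually_elim
      case (elim r)
      then have "r1 \<le> r" "r < r2" by auto
      then show ?case using slope up by blast
    qed
  qed simp
  moreover have "u r2 = 0" using r2 u_nonneg[of r2] r2p by simp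
  then have "du r2 = 0" by (rule du_zero[OF r2p])
  ultimately show False using d by simp
qed

lemma zp_tendsto_0: "(zp \<longlongrightarrow> 0) (at_left (u 0))"
proof (rule tendstoI)
  fix e :: real assume e: "e > 0"
  have "((\<lambda>r. r * du r) \<longlongrightarrow> 0 * du 0) (at_right 0)"
    by (intro tendsto_intros right_limit_at[OF du_cont]) simp
  from tendstoD[OF this e] have "\<forall>\<^sub>F r in at_right 0. \<bar>r * du r\<bar> < e" by (simp add: dist_real_def)
  then obtain b where b: "b > 0" "\<And>r. 0 < r \<Longrightarrow> r < b \<Longrightarrow> \<bar>r * du r\<bar> < e"
    unfolding eventually_at_right_field by auto
  have ub: "u b < u 0"
  proof (cases "u b > 0")
    case True
    then show ?thesis using u_lt_u0[OF b(1)] by simp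
  next
    case False
    then show ?thesis using u_0_gt f1_u0 by linarith
  qed
  define c where "c = max (u b) 0"
  have c: "c < u 0" using ub u_0_gt f1_u0 by (simp add: c_def)
  show "\<forall>\<^sub>F s in at_left (u 0). dist (zp s) 0 < e"
    using eventually_at_left_real[OF c]
  proof eventually_elim
    case (elim s)
    then have s: "0 < s" "s < u 0" "u b < s" by (auto simp: c_def)
    note r = rho[OF s(1,2)]
    have "rho s < b"
    proof (rule ccontr)
      assume "\<not> rho s < b"
      then have "u (rho s) \<le> u b" using u_antimono[of b "rho s"] b by simp
      then show False using r s by simp
    qed
    then show ?case using b(2)[OF r(1)] unfolding zp_def by (simp add: dist_real_def)
  qed
qed

lemma profile_rho: "profile rho zp (u 0)"
  unfolding profile_def
proof (intro conjI ballI)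
  show "u0 < u 0" by (rule u_0_gt)
  show "(zp \<longlongrightarrow> 0) (at_left (u 0))" by (rule zp_tendsto_0)
  fix s
  {
    assume "s \<in> {0<..<u 0}"
    then have s: "0 < s" "s < u 0" by auto
    note r = rho[OF s]
    have ur: "u (rho s) > 0" using r s by simp
    have dn: "du (rho s) < 0" by (rule du_neg[OF r(1) ur])
    show "0 < rho s" by (rule r)
    show zpos: "0 < zp s" unfolding zp_def using r dn by (simp add: mult_pos_neg)
    show "(rho has_real_derivative - rho s / zp s) (at s)"
      by (rule DERIV_cong[OF rho_deriv[OF s]]) (use r dn in \<open>simp add: zp_def\<close>)
    have "((\<lambda>s. - (rho s * du (rho s))) has_real_derivative
       (zp s / rho s) * (kap (rho s) * f (u (rho s)) * zp s powr (1 - p) / (p - 1) - mh) * (1 / du (rho s))) (at s)"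
      unfolding zp_def by (rule DERIV_chain'[OF rho_deriv[OF s] slope_deriv[OF r(1) ur]])
    moreover have "(zp s / rho s) * (kap (rho s) * f (u (rho s)) * zp s powr (1 - p) / (p - 1) - mh) * (1 / du (rho s))
      = mh - kap (rho s) * f s * zp s powr (1 - p) / (p - 1)"
    proof -
      have "zp s / rho s * (1 / du (rho s)) = -1" unfolding zp_def using r dn by simp
      then have "(zp s / rho s) * X * (1 / du (rho s)) = - X" for X
        by (metis mult.commute mult.left_commute mult_minus1_right)
      then show ?thesis unfolding r(2) by simp
    qed
    moreover have "zp = (\<lambda>s. - (rho s * du (rho s)))" by (auto simp: zp_def)
    ultimately show "(zp has_real_derivative mh - kap (rho s) * f s * zp s powr (1 - p) / (p - 1)) (at s)" by simp
  }
  {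
    assume "s \<in> {u0<..<u 0}"
    then have s: "0 < s" "s < u 0" "u0 < s" using f1_u0 by auto
    note r = rho[OF s(1,2)]
    have e: "zp s powr (p - 1) = rho s powr (p - real n) * (- fl (rho s))" unfolding zp_def by (rule slope_powr[OF r(1)])
    have b: "f s * Jt (rho s) \<le> - fl (rho s)" "- fl (rho s) \<le> f (u 0) * Jt (rho s)"
      using flux_bounds[OF r(1)] r s by auto
    have "rho s powr (p - real n) * (f s * Jt (rho s)) \<le> rho s powr (p - real n) * (- fl (rho s))"
      by (rule mult_left_mono[OF b(1)]) simp
    then show "f s * JJ (rho s) \<le> zp s powr (p - 1)" unfolding e JJ_def by (simp add: mult_ac)
    have "rho s powr (p - real n) * (- fl (rho s)) \<le> rho s powr (p - real n) * (f (u 0) * Jt (rho s))"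
      by (rule mult_left_mono[OF b(2)]) simp
    then show "zp s powr (p - 1) \<le> f (u 0) * JJ (rho s)" unfolding e JJ_def by (simp add: mult_ac)
  }
next
  show "\<not> (\<exists>d>0. \<exists>e>0. \<forall>s\<in>{0<..<e}. d \<le> zp s)" using slope_not_bounded_below by (metis greaterThanLessThan_iff)
qed

end

section \<open>Uniqueness\<close>

lemma Young_powr:
  fixes a c p :: real
  assumes "p > 1" "a > 0" "c > 0"
  shows "p * a * c powr (p - 1) \<le> a powr p + (p - 1) * c powr p"
proof -
  have "(a powr p) powr (1 / p) * (c powr p) powr (1 - 1 / p) \<le> 1 / p * a powr p + (1 - 1 / p) * c powr p"
    by (rule Youngs_inequality_0) (use assms in auto)
  moreover have "(a powr p) powr (1 / p) = a" using assms by (simp add: powr_powr)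
  moreover have "p * (1 - 1 / p) = p - 1" using assms by (simp add: field_simps)
  then have "(c powr p) powr (1 - 1 / p) = c powr (p - 1)" by (simp add: powr_powr)
  ultimately have "a * c powr (p - 1) \<le> 1 / p * a powr p + (1 - 1 / p) * c powr p" by simp
  from mult_left_mono[OF this, of p] show ?thesis
    using assms \<open>p * (1 - 1 / p) = p - 1\<close> by (simp add: distrib_left mult.assoc[symmetric])
qed

context weighted_problem begin

text \<open>Picone's identity: the hypothesis on the growth of \<open>f\<close> makes \<open>PP\<close> nonincreasing, although it
  vanishes at both ends of the interval.\<close>

lemma Picone:
  assumes "ground_state n p u0 K f u" and "ground_state n p u0 K f v"
    and r0: "0 < r0" "u r0 = u0" "u0 < v r0" and le: "\<And>r. 0 < r \<Longrightarrow> r < r0 \<Longrightarrow> u0 < u r \<and> u r \<le> v r"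
  shows False
proof -
  interpret U: ground_state n p u0 K f u by fact
  interpret V: ground_state n p u0 K f v by fact
  define X where "X r = u r - u0" for r
  define Y where "Y r = v r - u0" for r
  \<comment> \<open>Because both functions are taken relative to \<open>u0\<close>,
    \<open>PP\<close> vanishes at \<open>r0\<close> through \<open>X\<close>; at 0 it vanishes
    through the fluxes.\<close>
  define PP where "PP r = (- U.fl r) * X r - (- V.fl r) * (X r powr p * Y r powr (1 - p))" for r
  have Xp: "X r > 0" if "0 \<le> r" "r < r0" for r
    using le[of r] U.u_0_gt that unfolding X_def by (cases "r = 0") auto
  have Yp: "Y r > 0" if "0 \<le> r" "r \<le> r0" for r
    using le[of r] V.u_0_gt r0 that unfolding Y_def by (cases "r = 0"; cases "r = r0") auto
  have X0: "X r0 = 0" using r0 by (simp add: X_def)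
  have cX: "continuous_on {0..r0} X" unfolding X_def
    by (intro continuous_intros continuous_on_subset[OF U.u_cont]) auto
  have cY: "continuous_on {0..r0} Y" unfolding Y_def
    by (intro continuous_intros continuous_on_subset[OF V.u_cont]) auto
  have X_nonneg: "X r \<ge> 0" if "0 \<le> r" "r \<le> r0" for r using Xp[of r] X0 that by (cases "r = r0") auto
  have cP: "continuous_on {0..r0} PP"
  proof -
    have "continuous_on {0..r0} (\<lambda>r. X r powr p)"
      by (rule continuous_on_powr'[OF cX continuous_on_const]) (use X_nonneg p_gt in auto)
    moreover have "continuous_on {0..r0} (\<lambda>r. Y r powr (1 - p))"
    proof (rule continuous_on_powr'[OF cY continuous_on_const], rule ballI)
      fix r assume "r \<in> {0..r0}"
      then have "Y r > 0" using Yp by simp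
      then show "0 \<le> Y r \<and> (Y r = 0 \<longrightarrow> 0 < 1 - p)" by simp
    qed
    moreover have "continuous_on {0..r0} U.fl" "continuous_on {0..r0} V.fl"
      by (auto intro: continuous_on_subset[OF U.fl_cont] continuous_on_subset[OF V.fl_cont])
    ultimately show ?thesis unfolding PP_def
      by (intro continuous_on_diff continuous_on_mult continuous_on_minus cX)
  qed
  have dP: "\<exists>y. (PP has_real_derivative y) (at r) \<and> y \<le> 0" if r: "0 < r" "r < r0" for r
  proof -
    have x: "X r > 0" and y: "Y r > 0" using Xp Yp r by auto
    define a where "a = \<bar>U.du r\<bar>"
    define b where "b = \<bar>V.du r\<bar>"
    have uv: "u r > 0" "v r > 0" using x y f1_u0 unfolding X_def Y_def by auto
    have ab: "U.du r = - a" "V.du r = - b" "a > 0" "b > 0"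
      using U.du_neg[OF r(1) uv(1)] V.du_neg[OF r(1) uv(2)] unfolding a_def b_def by auto
    define R where "R = r ^ (n - 1)"
    have R: "R > 0" unfolding R_def using r by simp
    have fl: "- U.fl r = R * a powr (p - 1)" "- V.fl r = R * b powr (p - 1)"
      unfolding R_def a_def b_def using U.minus_fl[OF r(1)] V.minus_fl[OF r(1)] by auto
    have dX: "(X has_real_derivative - a) (at r)" "(Y has_real_derivative - b) (at r)"
      unfolding X_def Y_def ab(1,2)[symmetric]
      using DERIV_diff[OF U.u_deriv[OF r(1)] DERIV_const[of u0]] DERIV_diff[OF V.u_deriv[OF r(1)] DERIV_const[of u0]] by auto
    define x1 where "x1 = X r powr p"
    define y1 where "y1 = Y r powr (1 - p)"
    have x1: "x1 > 0" "y1 > 0" unfolding x1_def y1_def using x y by auto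
    have dXp: "((\<lambda>r. X r powr p) has_real_derivative p * x1 / X r * (- a)) (at r)"
      unfolding x1_def by (rule powr_within_deriv[OF dX(1) x])
    have dYp: "((\<lambda>r. Y r powr (1 - p)) has_real_derivative (1 - p) * y1 / Y r * (- b)) (at r)"
      unfolding y1_def by (rule powr_within_deriv[OF dX(2) y])
    have dP: "(PP has_real_derivative (- (- (R * K r * f (u r))) * X r + (- a) * (- U.fl r))
       - (- (- (R * K r * f (v r))) * (x1 * y1) + (p * x1 / X r * (- a) * y1 + (1 - p) * y1 / Y r * (- b) * x1) * (- V.fl r))) (at r)"
      unfolding PP_def
      by (rule DERIV_cong[OF DERIV_diff[OF DERIV_mult[OF DERIV_minus[OF U.fl_deriv[OF r(1)]] dX(1)]
           DERIV_mult[OF DERIV_minus[OF V.fl_deriv[OF r(1)]] DERIV_mult[OF dXp dYp]]]])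
        (simp add: R_def x1_def y1_def)
    \<comment> \<open>\<open>c\<close> is the slope that \<open>u\<close> would have if
      \<open>X / Y\<close> were stationary; Young's inequality compares it with the actual slope
      \<open>a\<close>.\<close>
    define c where "c = b * (X r / Y r)"
    have c: "c > 0" unfolding c_def using x y ab by simp
    have c1: "b powr (p - 1) * (x1 / X r * y1) = c powr (p - 1)"
    proof -
      have "x1 / X r = X r powr (p - 1)" unfolding x1_def using x by (simp add: powr_diff)
      moreover have "y1 = 1 / Y r powr (p - 1)" unfolding y1_def using y powr_minus_divide[of "Y r" "p - 1"] by simp
      ultimately show ?thesis unfolding c_def using x y ab by (simp add: powr_mult powr_divide)
    qed
    have cp: "c powr (p - 1) * c = c powr p" "a powr (p - 1) * a = a powr p"
      using c ab by (simp_all add: powr_diff)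
    have "p * x1 / X r * (- a) * y1 * (R * b powr (p - 1)) = - (R * (p * a)) * (b powr (p - 1) * (x1 / X r * y1))" by simp
    then have t1: "p * x1 / X r * (- a) * y1 * (R * b powr (p - 1)) = - (R * (p * a * c powr (p - 1)))" unfolding c1 by simp
    have "(1 - p) * y1 / Y r * (- b) * x1 * (R * b powr (p - 1)) = R * (p - 1) * (b powr (p - 1) * (x1 / X r * y1)) * (b * (X r / Y r))"
      using x y by (simp add: field_simps)
    then have t2: "(1 - p) * y1 / Y r * (- b) * x1 * (R * b powr (p - 1)) = R * ((p - 1) * c powr p)"
      unfolding c1 c_def[symmetric] cp(1)[symmetric] by simp
    have t3: "(- a) * (R * a powr (p - 1)) = - (R * a powr p)" unfolding cp(2)[symmetric] by simp
    have "(- (- (R * K r * f (u r))) * X r + (- a) * (- U.fl r))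
       - (- (- (R * K r * f (v r))) * (x1 * y1) + (p * x1 / X r * (- a) * y1 + (1 - p) * y1 / Y r * (- b) * x1) * (- V.fl r))
      = R * K r * (f (u r) * X r - f (v r) * (x1 * y1)) - R * (a powr p - p * a * c powr (p - 1) + (p - 1) * c powr p)"
      unfolding fl distrib_right[of _ _ "R * b powr (p - 1)"] t1 t2 t3 by (simp add: algebra_simps)
    moreover have "R * (a powr p - p * a * c powr (p - 1) + (p - 1) * c powr p) \<ge> 0"
      using Young_powr[OF p_gt ab(3) c] R by (intro mult_nonneg_nonneg) auto
    \<comment> \<open>This is \<open>f_ratio_mono\<close> for \<open>u r \<le> v r\<close>,
      multiplied by \<open>X powr p\<close>.\<close>
    moreover have "R * K r * (f (u r) * X r - f (v r) * (x1 * y1)) \<le> 0"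
    proof -
      have u1: "u0 < u r" "u r \<le> v r" using le[OF r] by auto
      have "f (u r) / X r powr (p - 1) \<le> f (v r) / Y r powr (p - 1)"
        unfolding X_def Y_def by (rule f_ratio_mono[OF u1])
      then have "f (u r) / X r powr (p - 1) * x1 \<le> f (v r) / Y r powr (p - 1) * x1"
        using x1 by (intro mult_right_mono) auto
      moreover have "x1 = X r powr (p - 1) * X r" unfolding x1_def using x by (simp add: powr_diff)
      then have "f (u r) / X r powr (p - 1) * x1 = f (u r) * X r" using x by simp
      moreover have "y1 = 1 / Y r powr (p - 1)" unfolding y1_def using y powr_minus_divide[of "Y r" "p - 1"] by simp
      then have "f (v r) / Y r powr (p - 1) * x1 = f (v r) * (x1 * y1)" by simp
      ultimately have "f (u r) * X r - f (v r) * (x1 * y1) \<le> 0" by linarith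
      moreover have "R * K r \<ge> 0" using weight_pos[OF r(1)] unfolding R_def by (rule less_imp_le)
      ultimately show ?thesis by (rule mult_nonneg_nonpos[rotated])
    qed
    ultimately have "(- (- (R * K r * f (u r))) * X r + (- a) * (- U.fl r))
       - (- (- (R * K r * f (v r))) * (x1 * y1) + (p * x1 / X r * (- a) * y1 + (1 - p) * y1 / Y r * (- b) * x1) * (- V.fl r)) \<le> 0"
      by linarith
    with dP show ?thesis by blast
  qed
  have mono: "PP t \<le> PP s" if "0 \<le> s" "s \<le> t" "t \<le> r0" for s t
  proof (rule DERIV_nonpos_imp_decreasing_open[OF that(2)])
    show "continuous_on {s..t} PP" by (rule continuous_on_subset[OF cP]) (use that in auto)
    fix x assume "s < x" "x < t"
    then show "\<exists>y. (PP has_real_derivative y) (at x) \<and> y \<le> 0" using dP[of x] that by auto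
  qed
  have ends: "PP 0 = 0" "PP r0 = 0" unfolding PP_def X0 using U.fl_0 V.fl_0 p_gt by auto
  have zero: "PP r = 0" if "0 < r" "r < r0" for r
    using mono[of 0 r] mono[of r r0] ends that by simp
  \<comment> \<open>\<open>PP = 0\<close> says that \<open>u'\<close> and \<open>v'\<close> are in
    the ratio of \<open>X\<close> and \<open>Y\<close>, so \<open>X / Y\<close> has derivative 0. It
    is positive at 0 and vanishes at \<open>r0\<close>, a contradiction.\<close>
  have ratio: "\<exists>y. ((\<lambda>r. X r / Y r) has_real_derivative y) (at r) \<and> 0 \<le> y" if r: "0 < r" "r < r0" for r
  proof -
    have x: "X r > 0" and y: "Y r > 0" using Xp Yp r by auto
    have xp: "X r powr p = X r powr (p - 1) * X r" using x by (simp add: powr_diff)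
    have yp: "Y r powr (1 - p) = 1 / Y r powr (p - 1)" using y powr_minus_divide[of "Y r" "p - 1"] by simp
    have R: "r ^ (n - 1) > 0" using r by simp
    have "(r ^ (n - 1) * \<bar>U.du r\<bar> powr (p - 1)) * X r = (r ^ (n - 1) * \<bar>V.du r\<bar> powr (p - 1)) * (X r powr (p - 1) * X r * (1 / Y r powr (p - 1)))"
      using zero[OF r] unfolding PP_def U.minus_fl[OF r(1)] V.minus_fl[OF r(1)] xp yp by simp
    then have "(r ^ (n - 1) * X r) * \<bar>U.du r\<bar> powr (p - 1) = (r ^ (n - 1) * X r) * (\<bar>V.du r\<bar> powr (p - 1) * (X r powr (p - 1) / Y r powr (p - 1)))"
      by (simp add: mult_ac)
    moreover have "r ^ (n - 1) * X r \<noteq> 0" using R x by (metis less_irrefl mult_pos_pos)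
    ultimately have "\<bar>U.du r\<bar> powr (p - 1) = \<bar>V.du r\<bar> powr (p - 1) * (X r powr (p - 1) / Y r powr (p - 1))"
      by (metis mult_left_cancel)
    also have "\<dots> = (\<bar>V.du r\<bar> * (X r / Y r)) powr (p - 1)" using x y by (simp add: powr_mult powr_divide)
    finally have "(\<bar>U.du r\<bar> powr (p - 1)) powr (1 / (p - 1)) = ((\<bar>V.du r\<bar> * (X r / Y r)) powr (p - 1)) powr (1 / (p - 1))" by simp
    then have "\<bar>U.du r\<bar> = \<bar>V.du r\<bar> * (X r / Y r)" using x y p_gt by (simp add: powr_powr)
    then have e: "U.du r = V.du r * (X r / Y r)" using U.du_nonpos[OF r(1)] V.du_nonpos[OF r(1)] by simp
    have "((\<lambda>r. X r / Y r) has_real_derivative (U.du r * Y r - X r * V.du r) / (Y r * Y r)) (at r)"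
    proof (rule DERIV_divide)
      show "(X has_real_derivative U.du r) (at r)" "(Y has_real_derivative V.du r) (at r)"
        unfolding X_def Y_def
        using DERIV_diff[OF U.u_deriv[OF r(1)] DERIV_const[of u0]] DERIV_diff[OF V.u_deriv[OF r(1)] DERIV_const[of u0]] by auto
    qed (use y in simp)
    moreover have "U.du r * Y r - X r * V.du r = 0" unfolding e using y by simp
    ultimately show ?thesis by (intro exI conjI) auto
  qed
  have "X 0 / Y 0 \<le> X r0 / Y r0"
  proof (rule DERIV_nonneg_imp_increasing_open[of 0 r0 "\<lambda>r. X r / Y r"])
    show "continuous_on {0..r0} (\<lambda>r. X r / Y r)"
      using Yp by (intro continuous_on_divide cX cY) (auto, metis atLeastAtMost_iff less_irrefl)
  qed (use r0 ratio in auto)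
  moreover have "X 0 / Y 0 > 0" using Xp[of 0] Yp[of 0] r0 by simp
  ultimately show False using X0 by simp
qed

text \<open>If \<open>v\<close> reached \<open>u0\<close> later than \<open>u\<close>, then by
  \<open>z_order\<close> the gap of the logarithmic radii would grow with the level, so that
  \<open>v > u\<close> as long as \<open>u \<ge> u0\<close>; this is the situation excluded by
  \<open>Picone\<close>.\<close>

lemma larger_crosses:
  assumes gu: "ground_state n p u0 K f u" and gv: "ground_state n p u0 K f v" and less: "u 0 < v 0"
  shows "ground_state.rho v u0 \<le> ground_state.rho u u0"
proof (rule ccontr)
  interpret U: ground_state n p u0 K f u by fact
  interpret V: ground_state n p u0 K f v by fact
  assume "\<not> V.rho u0 \<le> U.rho u0"
  then have lt: "U.rho u0 < V.rho u0" by simp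
  have a: "u0 < u 0" "u0 < v 0" using U.u_0_gt V.u_0_gt by auto
  note PU = U.profile_rho and PV = V.profile_rho
  have gap: "U.rho s < V.rho s" if s: "u0 \<le> s" "s < u 0" for s
  proof -
    have d: "((\<lambda>s. ln (V.rho s) - ln (U.rho s)) has_real_derivative 1 / U.zp x - 1 / V.zp x) (at x)" if x: "u0 \<le> x" "x \<le> s" for x
    proof -
      have x': "0 < x" "x < u 0" "x < v 0" using x s less f1_u0 by auto
      note D1 = profileD[OF PU x'(1,2)] and D2 = profileD[OF PV x'(1,3)]
      show ?thesis
        by (rule DERIV_cong[OF DERIV_diff[OF DERIV_chain'[OF D2(3) DERIV_ln_divide[OF D2(1)]] DERIV_chain'[OF D1(3) DERIV_ln_divide[OF D1(1)]]]])
          (use D1(1) D2(1) in simp)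
    qed
    have "ln (V.rho u0) - ln (U.rho u0) \<le> ln (V.rho s) - ln (U.rho s)"
    proof (rule DERIV_nonneg_imp_nondecreasing[OF s(1), of "\<lambda>s. ln (V.rho s) - ln (U.rho s)"])
      fix x assume x: "u0 \<le> x" "x \<le> s"
      have x': "0 < x" "x < u 0" "x < v 0" using x s less f1_u0 by auto
      have "U.zp x \<le> V.zp x"
        using z_order[OF PV PU less, of x] z_order_u0[OF PV PU less] x x' by (cases "x = u0") auto
      then have "0 \<le> 1 / U.zp x - 1 / V.zp x"
        using profileD(2)[OF PU x'(1,2)] profileD(2)[OF PV x'(1,3)] by (simp add: frac_le)
      then show "\<exists>y. ((\<lambda>s. ln (V.rho s) - ln (U.rho s)) has_real_derivative y) (at x) \<and> 0 \<le> y" using d[OF x] by blast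
    qed
    moreover have "ln (V.rho u0) - ln (U.rho u0) > 0" using lt U.rho(1)[OF f1_u0 a(1)] by simp
    ultimately have "ln (U.rho s) < ln (V.rho s)" by linarith
    then show ?thesis using U.rho(1)[of s] V.rho(1)[of s] s less f1_u0 by (subst (asm) ln_less_cancel_iff) auto
  qed
  have above: "u r < v r" if r: "0 < r" "r \<le> U.rho u0" for r
  proof -
    have "u (U.rho u0) \<le> u r" using U.u_antimono[of r "U.rho u0"] r by simp
    then have s: "u0 \<le> u r" using U.rho(2)[OF f1_u0 a(1)] by simp
    then have ur: "u r > 0" using f1_u0 by linarith
    have s2: "u r < u 0" by (rule U.u_lt_u0[OF r(1) ur])
    have "r < V.rho (u r)" using gap[OF s s2] U.rho_u[OF r(1) ur] by simp
    moreover have "v (V.rho (u r)) = u r" using V.rho(2)[of "u r"] ur s2 less by simp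
    ultimately show ?thesis using V.u_strict[of r "V.rho (u r)"] r ur by simp
  qed
  show False
  proof (rule Picone[OF gu gv])
    show "0 < U.rho u0" "u (U.rho u0) = u0" using U.rho[OF f1_u0 a(1)] by auto
    then show "u0 < v (U.rho u0)" using above[of "U.rho u0"] by simp
    fix r assume r: "0 < r" "r < U.rho u0"
    have "u (U.rho u0) < u r" using U.u_strict[of r "U.rho u0"] r U.rho(2)[OF f1_u0 a(1)] f1_u0 by simp
    then show "u0 < u r \<and> u r \<le> v r" using above[of r] r U.rho(2)[OF f1_u0 a(1)] by simp
  qed
qed

text \<open>At \<open>r = 0\<close> the slope vanishes and the inverse of \<open>phi p\<close> need
  not be Lipschitz. The estimate is therefore relative: the quotient of the fluxes is close to 1,
  where powers are Lipschitz, so \<open>\<bar>u' - v'\<bar> \<le> q * \<bar>u'\<bar>\<close>.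
  Integration bounds the maximal distance \<open>M\<close> by \<open>q\<close> times the drop of
  \<open>u\<close>, and \<open>q\<close> is itself proportional to \<open>M\<close>.\<close>

lemma equal_start:
  assumes gu: "ground_state n p u0 K f u" and gv: "ground_state n p u0 K f v" and eq: "u 0 = v 0"
  shows "\<exists>r>0. \<forall>t\<in>{0..r}. u t = v t \<and> 0 < u t"
proof -
  interpret U: ground_state n p u0 K f u by fact
  interpret V: ground_state n p u0 K f v by fact
  define \<alpha> where "\<alpha> = u 0"
  have al: "u0 < \<alpha>" using U.u_0_gt by (simp add: \<alpha>_def)
  define b where "b = (u0 + \<alpha>) / 2"
  have b: "u0 < b" "b < \<alpha>" using al by (auto simp: b_def)
  have "local_lipschitz {0::real} {b..\<alpha>} (\<lambda>_. f)"
    by (rule local_lipschitz_subset[OF f2_lip]) (use b in auto)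
  then obtain L where "\<And>t. t \<in> {0::real} \<Longrightarrow> L-lipschitz_on {b..\<alpha>} f"
    using local_lipschitz_compact_implies_lipschitz[where X="{b..\<alpha>}" and T="{0::real}" and f="\<lambda>_. f"] by auto
  then have L: "L-lipschitz_on {b..\<alpha>} f" by simp
  have L0: "L \<ge> 0" using L lipschitz_on_nonneg by blast
  define c0 where "c0 = f b"
  have c0: "c0 > 0" unfolding c0_def using f1_pos b by simp
  define k where "k = 1 / (p - 1)"
  have k: "k > 0" unfolding k_def using p_gt by simp
  have "\<exists>C. C-lipschitz_on {1/2..3/2} (\<lambda>x::real. x powr k)"
  proof (rule C1_Lipschitz)
    show "((\<lambda>x. x powr k) has_real_derivative k * x powr (k - 1)) (at x)" if "x \<in> {1/2..3/2}" for x
      using that by (intro has_real_derivative_powr) auto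
    show "continuous_on {1/2..3/2} (\<lambda>x::real. k * x powr (k - 1))" by (intro continuous_intros) auto
  qed
  then obtain C where C: "C-lipschitz_on {1/2..3/2} (\<lambda>x::real. x powr k)" by blast
  have C0: "C \<ge> 0" using C lipschitz_on_nonneg by blast
  \<comment> \<open>The three bounds keep the levels above \<open>b\<close>, keep the flux quotient
    in \<open>[1/2, 3/2]\<close>, and make the final contraction factor
    \<open>C * L / c0 * \<epsilon>\<close> at most 1/2. The summands \<open>+ 1\<close> admit
    \<open>L = 0\<close> and \<open>C * L = 0\<close>.\<close>
  define \<epsilon> where "\<epsilon> = min (\<alpha> - b) (min (c0 / (4 * (L + 1))) (c0 / (2 * (C * L + 1))))"
  have CL: "C * L \<ge> 0" using C0 L0 by simp
  have e: "\<epsilon> > 0" "\<epsilon> \<le> \<alpha> - b" "\<epsilon> \<le> c0 / (4 * (L + 1))" "\<epsilon> \<le> c0 / (2 * (C * L + 1))"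
    unfolding \<epsilon>_def using b c0 L0 CL by auto
  have "\<forall>\<^sub>F t in at_right 0. \<alpha> - \<epsilon> < u t" "\<forall>\<^sub>F t in at_right 0. \<alpha> - \<epsilon> < v t"
    using order_tendstoD(1)[OF U.right_limit_at[OF U.u_cont order_refl], of "\<alpha> - \<epsilon>"]
      order_tendstoD(1)[OF V.right_limit_at[OF V.u_cont order_refl], of "\<alpha> - \<epsilon>"] e eq by (auto simp: \<alpha>_def)
  then have "\<forall>\<^sub>F t in at_right 0. \<alpha> - \<epsilon> < u t \<and> \<alpha> - \<epsilon> < v t" by eventually_elim simp
  then obtain d where d: "d > 0" "\<And>t. 0 < t \<Longrightarrow> t < d \<Longrightarrow> \<alpha> - \<epsilon> < u t \<and> \<alpha> - \<epsilon> < v t"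
    unfolding eventually_at_right_field by auto
  define r where "r = d / 2"
  have r: "0 < r" using d by (simp add: r_def)
  have near: "\<alpha> - \<epsilon> < u t" "\<alpha> - \<epsilon> < v t" "u t \<le> \<alpha>" "v t \<le> \<alpha>" if "0 \<le> t" "t \<le> r" for t
    using d(2)[of t] that d(1) e(1) U.u_antimono[of 0 t] V.u_antimono[of 0 t] eq unfolding r_def \<alpha>_def by (cases "t = 0"; force)+
  have inI: "u t \<in> {b..\<alpha>}" "v t \<in> {b..\<alpha>}" if "0 \<le> t" "t \<le> r" for t using near[OF that] e(2) by auto
  have "continuous_on {0..r} (\<lambda>t. \<bar>u t - v t\<bar>)"
    by (intro continuous_intros continuous_on_subset[OF U.u_cont] continuous_on_subset[OF V.u_cont]) auto
  then have "\<exists>x\<in>{0..r}. \<forall>t\<in>{0..r}. \<bar>u t - v t\<bar> \<le> \<bar>u x - v x\<bar>"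
    by (intro continuous_attains_sup) (use r in auto)
  then obtain x where x: "x \<in> {0..r}" "\<And>t. t \<in> {0..r} \<Longrightarrow> \<bar>u t - v t\<bar> \<le> \<bar>u x - v x\<bar>" by blast
  define M where "M = \<bar>u x - v x\<bar>"
  have M: "\<bar>u t - v t\<bar> \<le> M" if "0 \<le> t" "t \<le> r" for t using x(2)[of t] that by (simp add: M_def)
  have M0: "M \<ge> 0" by (simp add: M_def)
  have Me: "M \<le> \<epsilon>" using near[of x] x(1) unfolding M_def by auto
  have flux_lower: "c0 * Jt t \<le> - U.fl t" if t: "0 < t" "t \<le> r" for t
  proof -
    have "c0 \<le> f (u t)" unfolding c0_def using f_mono[of b "u t"] inI[of t] t b by auto
    then have "c0 * Jt t \<le> f (u t) * Jt t" using Jt_pos[OF t(1)] by (intro mult_right_mono) auto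
    also have "\<dots> \<le> - U.fl t" using U.flux_bounds(1)[OF t(1)] inI[of t] t b by auto
    finally show ?thesis .
  qed
  have flux_diff: "\<bar>V.fl t - U.fl t\<bar> \<le> L * M * Jt t" if t: "0 < t" "t \<le> r" for t
  proof -
    have lim: "((\<lambda>t. L * M * Jt t + a * (V.fl t - U.fl t)) \<longlongrightarrow> 0) (at_right 0)" for a
    proof -
      have "(U.fl \<longlongrightarrow> 0) (at_right 0)" "(V.fl \<longlongrightarrow> 0) (at_right 0)"
        using U.right_limit_at[OF U.fl_cont, of 0] V.right_limit_at[OF V.fl_cont, of 0] U.fl_0 V.fl_0 by auto
      then have "((\<lambda>t. L * M * Jt t + a * (V.fl t - U.fl t)) \<longlongrightarrow> L * M * 0 + a * (0 - 0)) (at_right 0)"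
        by (intro tendsto_intros Jt_tendsto_0)
      then show ?thesis by simp
    qed
    have *: "0 \<le> L * M * Jt t + a * (V.fl t - U.fl t)" if a: "\<bar>a\<bar> = 1" for a
    proof (rule limit_le_of_deriv_nonneg[OF t(1) _ lim])
      fix s assume s: "0 < s" "s \<le> t"
      then have sr: "0 \<le> s" "s \<le> r" using t by auto
      have "((\<lambda>t. L * M * Jt t + a * (V.fl t - U.fl t)) has_real_derivative (L * M - a * (f (v s) - f (u s))) * (s ^ (n - 1) * K s)) (at s)"
        by (rule DERIV_cong[OF DERIV_add[OF DERIV_cmult[OF Jt_deriv[OF s(1)]] DERIV_cmult[OF DERIV_diff[OF V.fl_deriv[OF s(1)] U.fl_deriv[OF s(1)]]]]])
          (simp add: algebra_simps)
      moreover have "0 \<le> (L * M - a * (f (v s) - f (u s))) * (s ^ (n - 1) * K s)"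
      proof (rule mult_nonneg_nonneg[OF _ less_imp_le[OF weight_pos[OF s(1)]]])
        have "\<bar>f (v s) - f (u s)\<bar> \<le> L * \<bar>v s - u s\<bar>"
          using lipschitz_onD[OF L inI(2)[OF sr] inI(1)[OF sr]] by (simp add: dist_real_def)
        also have "\<dots> \<le> L * M" using M[OF sr] L0 by (intro mult_left_mono) (auto simp: abs_minus_commute)
        finally have "\<bar>a * (f (v s) - f (u s))\<bar> \<le> L * M" using a by (simp add: abs_mult)
        then show "0 \<le> L * M - a * (f (v s) - f (u s))" by linarith
      qed
      ultimately show "\<exists>d. ((\<lambda>t. L * M * Jt t + a * (V.fl t - U.fl t)) has_real_derivative d) (at s) \<and> 0 \<le> d" by blast
    qed
    show ?thesis using *[of 1] *[of "-1"] by simp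
  qed
  define q where "q = C * (L / c0) * M"
  have slope_diff: "\<bar>U.du t - V.du t\<bar> \<le> q * (- U.du t)" if t: "0 < t" "t \<le> r" for t
  proof -
    have Fp: "- U.fl t > 0" using flux_lower[OF t] Jt_pos[OF t(1)] c0 by (smt (verit) mult_pos_pos)
    define y where "y = (- V.fl t) / (- U.fl t)"
    have y1: "\<bar>y - 1\<bar> \<le> L / c0 * M"
    proof -
      have "y - 1 = (U.fl t - V.fl t) / (- U.fl t)" unfolding y_def using Fp by (simp add: field_simps)
      then have "\<bar>y - 1\<bar> = \<bar>V.fl t - U.fl t\<bar> / (- U.fl t)" using Fp by (simp add: abs_divide abs_minus_commute)
      also have "\<dots> \<le> (L * M * Jt t) / (c0 * Jt t)"
        using flux_diff[OF t] flux_lower[OF t] Fp c0 Jt_pos[OF t(1)] by (intro frac_le) auto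
      also have "\<dots> = L / c0 * M" using Jt_pos[OF t(1)] by simp
      finally show ?thesis .
    qed
    have "L / c0 * M \<le> 1 / 2"
    proof -
      have "L * M \<le> L * (c0 / (4 * (L + 1)))" using Me e(3) L0 by (intro mult_left_mono) auto
      also have "\<dots> = L / (L + 1) * (c0 / 4)" using L0 by (simp add: field_simps)
      also have "\<dots> \<le> 1 * (c0 / 4)" using L0 c0 by (intro mult_right_mono) auto
      finally show ?thesis using c0 by (simp add: field_simps)
    qed
    then have "\<bar>y - 1\<bar> \<le> 1 / 2" using y1 by linarith
    then have "1 / 2 \<le> y \<and> y \<le> 3 / 2" by linarith
    then have yI: "y \<in> {1/2..3/2}" by simp
    have R: "t ^ (n - 1) > 0" using t by simp
    have u': "\<bar>U.du t\<bar> > 0" using Fp unfolding U.minus_fl[OF t(1)] by (auto simp: zero_less_mult_iff)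
    have "y = \<bar>V.du t\<bar> powr (p - 1) / \<bar>U.du t\<bar> powr (p - 1)"
      unfolding y_def U.minus_fl[OF t(1)] V.minus_fl[OF t(1)] using R by (intro mult_divide_mult_cancel_left) linarith
    also have "\<dots> = (\<bar>V.du t\<bar> / \<bar>U.du t\<bar>) powr (p - 1)" using u' by (simp add: powr_divide)
    finally have "y powr k = \<bar>V.du t\<bar> / \<bar>U.du t\<bar>" unfolding k_def using p_gt by (simp add: powr_powr)
    then have vk: "\<bar>V.du t\<bar> = y powr k * \<bar>U.du t\<bar>" using u' by simp
    have "\<bar>y powr k - 1 powr k\<bar> \<le> C * \<bar>y - 1\<bar>"
      using lipschitz_onD[OF C yI, of 1] by (simp add: dist_real_def)
    also have "\<dots> \<le> C * (L / c0 * M)" using y1 C0 by (intro mult_left_mono) auto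
    finally have yk: "\<bar>y powr k - 1\<bar> \<le> q" unfolding q_def by simp
    have "U.du t - V.du t = (y powr k - 1) * \<bar>U.du t\<bar>"
      using vk U.du_nonpos[OF t(1)] V.du_nonpos[OF t(1)] by (simp add: algebra_simps)
    then have "\<bar>U.du t - V.du t\<bar> = \<bar>y powr k - 1\<bar> * \<bar>U.du t\<bar>" by (simp add: abs_mult)
    also have "\<dots> \<le> q * \<bar>U.du t\<bar>" using yk by (intro mult_right_mono) auto
    finally show ?thesis using U.du_nonpos[OF t(1)] by simp
  qed
  have bound: "a * (u x - v x) \<le> q * (\<alpha> - u x)" if a: "\<bar>a\<bar> = 1" for a
  proof -
    have x0: "0 \<le> x" "x \<le> r" using x(1) by auto
    have "a * (u x - v x) + q * u x \<le> a * (u 0 - v 0) + q * u 0"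
    proof (rule DERIV_nonpos_imp_decreasing_open[OF x0(1), of "\<lambda>x. a * (u x - v x) + q * u x"])
      show "continuous_on {0..x} (\<lambda>x. a * (u x - v x) + q * u x)"
        by (intro continuous_intros continuous_on_subset[OF U.u_cont] continuous_on_subset[OF V.u_cont]) auto
      fix t assume t: "0 < t" "t < x"
      then have tr: "0 < t" "t \<le> r" using x0 by auto
      have "((\<lambda>x. a * (u x - v x) + q * u x) has_real_derivative a * (U.du t - V.du t) + q * U.du t) (at t)"
        by (intro DERIV_add DERIV_cmult DERIV_diff U.u_deriv V.u_deriv tr)
      moreover have "\<bar>a * (U.du t - V.du t)\<bar> \<le> q * (- U.du t)" using slope_diff[OF tr] a by (simp add: abs_mult)
      then have "a * (U.du t - V.du t) + q * U.du t \<le> 0" by (simp add: abs_le_iff)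
      ultimately show "\<exists>y. ((\<lambda>x. a * (u x - v x) + q * u x) has_real_derivative y) (at t) \<and> y \<le> 0" by blast
    qed
    then show ?thesis using eq by (simp add: \<alpha>_def algebra_simps)
  qed
  have "M \<le> q * (\<alpha> - u x)" using bound[of 1] bound[of "-1"] unfolding M_def by (simp add: abs_le_iff)
  also have "\<dots> \<le> q * \<epsilon>"
    using near[of x] x(1) CL c0 M0 C0 L0 unfolding q_def by (intro mult_left_mono) auto
  also have "\<dots> = M * (C * L / c0 * \<epsilon>)" unfolding q_def by simp
  also have "\<dots> \<le> M * (1 / 2)"
  proof (rule mult_left_mono[OF _ M0])
    have "C * L * \<epsilon> \<le> C * L * (c0 / (2 * (C * L + 1)))" using e(4) CL by (intro mult_left_mono) auto
    also have "\<dots> = (C * L) / (C * L + 1) * (c0 / 2)" using CL by (simp add: field_simps)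
    also have "\<dots> \<le> 1 * (c0 / 2)" using CL c0 by (intro mult_right_mono) auto
    finally show "C * L / c0 * \<epsilon> \<le> 1 / 2" using c0 by (simp add: field_simps)
  qed
  finally have "M = 0" using M0 by simp
  then have "\<forall>t\<in>{0..r}. u t = v t \<and> 0 < u t" using M inI b f1_u0 by force
  then show ?thesis using r by blast
qed

text \<open>With equal tops, \<open>equal_start\<close> yields a radius \<open>t > 0\<close> near
  which the solutions coincide; their radii and slopes then agree at level \<open>u t\<close>, and
  \<open>profile_identity\<close> extends this to all levels. Wherever one solution is positive the
  other has the same value, so the zeros match as well.\<close>

lemma ground_state_unique:
  assumes gu: "ground_state n p u0 K f u" and gv: "ground_state n p u0 K f v" and r: "r \<ge> 0"
  shows "u r = v r"
proof -
  interpret U: ground_state n p u0 K f u by fact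
  interpret V: ground_state n p u0 K f v by fact
  have "\<not> u 0 < v 0" using profile_top_unique[OF V.profile_rho U.profile_rho larger_crosses[OF gu gv] f1_nonzero] by blast
  moreover have "\<not> v 0 < u 0" using profile_top_unique[OF U.profile_rho V.profile_rho larger_crosses[OF gv gu] f1_nonzero] by blast
  ultimately have eq: "u 0 = v 0" by simp
  obtain d where d: "d > 0" "\<forall>t\<in>{0..d}. u t = v t \<and> 0 < u t"
    using equal_start[OF gu gv eq] by blast
  define t where "t = d / 2"
  have t: "0 < t" "t < d" using d by (auto simp: t_def)
  have ut: "u t = v t" "0 < u t" using d(2)[rule_format, of t] t by auto
  have "\<forall>\<^sub>F x in nhds t. u x = v x"
    using t d by (intro eventually_mono[OF eventually_nhds_in_open[of "{0<..<d}" t]]) auto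
  then have "(v has_real_derivative U.du t) (at t)"
    using U.u_deriv[OF t(1)] DERIV_cong_ev[OF refl, of u v t] by simp
  then have dd: "U.du t = V.du t" using V.u_deriv[OF t(1)] DERIV_unique by blast
  have rt: "U.rho (u t) = t" "V.rho (u t) = t" using U.rho_u[OF t(1) ut(2)] V.rho_u[OF t(1)] ut by auto
  have same: "U.rho s = V.rho s" if s: "0 < s" "s < u 0" for s
  proof -
    have "U.rho s = V.rho s \<and> U.zp s = V.zp s"
    proof (rule profile_identity[OF U.profile_rho V.profile_rho ut(2)])
      show "u t < u 0" "u t < v 0" using U.u_lt_u0[OF t(1) ut(2)] eq by auto
      show "U.zp (u t) = V.zp (u t)" unfolding U.zp_def V.zp_def rt dd ..
    qed (use rt s eq in auto)
    then show ?thesis by simp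
  qed
  have one: "v r = u r" if r: "r > 0" "u r > 0"
  proof -
    have "U.rho (u r) = V.rho (u r)" using same U.u_lt_u0[OF r] r by simp
    then have "V.rho (u r) = r" using U.rho_u[OF r] by simp
    then show ?thesis using V.rho(2)[of "u r"] U.u_lt_u0[OF r] r eq by simp
  qed
  have two: "u r = v r" if r: "r > 0" "v r > 0"
  proof -
    have "U.rho (v r) = V.rho (v r)" using same V.u_lt_u0[OF r] r eq by simp
    then have "U.rho (v r) = r" using V.rho_u[OF r] by simp
    then show ?thesis using U.rho(2)[of "v r"] V.u_lt_u0[OF r] r eq by simp
  qed
  consider "r = 0" | "r > 0" "u r > 0" | "r > 0" "v r > 0" | "u r = 0" "v r = 0"
    using r U.u_nonneg[OF r] V.u_nonneg[OF r] by linarith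
  then show ?thesis
  proof cases
    case 1
    then show ?thesis using eq by (simp only:)
  next
    case 2
    then show ?thesis by (rule one[symmetric])
  next
    case 3
    then show ?thesis by (rule two)
  next
    case 4
    then show ?thesis by (simp only:)
  qed
qed

end

theorem theorem1p1:
  fixes n :: nat and p u0 :: real and K f :: "real \<Rightarrow> real"
  assumes n_pos: "n > 0"
    and p_gt: "p > 1"
    and n_gt: "real n > p"
    and K_pos: "\<forall>r>0. K r > 0"
    and K_C1: "K C1_differentiable_on {0<..}"
    and K1_pos: "\<forall>r>0. p + r * deriv K r / K r > 0"
    and K1_decr: "antimono_on {0<..} (\<lambda>r. p + r * deriv K r / K r)"
    and f1_zero: "f 0 = 0"
    and f1_u0: "u0 > 0"
    and f1_pos: "\<forall>u>u0. f u > 0"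
    and f1_nonpos: "\<forall>u\<in>{0<..<u0}. f u \<le> 0"
    and f1_nonzero: "\<exists>u\<in>{0<..<u0}. f u \<noteq> 0"
    and f2_cont: "continuous_on {0..} f"
    and f2_lip: "local_lipschitz (UNIV :: real set) {u0..} (\<lambda>_. f)"
    and f3: "\<forall>u\<in>diff_points f u0. (p - 1) * f u \<le> deriv f u * (u - u0)"
    and f4: "antimono_on (diff_points f u0 - {u0}) (\<lambda>u. u * deriv f u / f u)"
  shows "\<forall>u v. is_solution n p K f u \<and> nontrivial u \<and>
               is_solution n p K f v \<and> nontrivial v \<longrightarrow> (\<forall>r\<ge>0. u r = v r)"
proof -
  interpret weighted_problem n p u0 K f
    by unfold_locales (fact assms)+
  have "ground_state n p u0 K f u" if "is_solution n p K f u" "nontrivial u" for u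
    using that by unfold_locales
  then show ?thesis using ground_state_unique by blast
qed

end
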